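(* The equivalence group $G^\sim_{\bar{\mathcal F}'}$ of the class $\bar{\mathcal F}'$ of Fokker--Planck equations with time-independent coefficients, $u_t=(A(x)u)_{xx}+(B(x)u)_x$ with $A\ne0$, consists of the point transformations of the form \[ \tilde t=c_1t+c_2,\quad\tilde x=X(x),\quad\tilde u=\frac{c_3}{X_x}u,\quad\tilde A=\frac{X_x^2}{c_1}A,\quad\tilde B=\frac{X_x}{c_1}B-\frac{X_{xx}}{c_1}A, \] where $X$ is an arbitrary function of $x$ with $X_x\neq0$, and $c_1$, $c_2$ and $c_3$ are arbitrary constants with $c_1c_3\ne0$.
   Context: Everything is real, smooth and local; $f\neq0$ for a function means that it vanishes nowhere on its domain. The arbitrary elements of the class are the smooth functions $A$ and $B$ of $x$ with $A\neq0$, regarded as coordinates when working with equivalence transformations. The (usual) equivalence (pseudo)group of the class consists of the point transformations (local diffeomorphisms) in the space with coordinates $(t,x,u_{(2)},A,B)$, where $u_{(2)}$ denotes $u$ and its derivatives up to order two (with components for derivatives of the arbitrary elements obtained by prolongation if these are needed), that are projectable to the spaces of $(t,x,u)$ and of $(t,x,u_{(2)})$, are consistent with the contact structure of the second-order jet space (so their components for derivatives are obtained by standard prolongation and are not listed), and map every equation of the class to an equation of the class (with the transformed arbitrary elements) for any values of the arbitrary elements. *)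

theory Defs
  imports "HOL-Analysis.Analysis"
begin

(* For open S: all iterated directional derivatives of order at most n exist and are
   continuous on S, that is, f is of class C^n on S. *)
primrec C_upto :: "nat \<Rightarrow> 'a::real_normed_vector set \<Rightarrow> ('a \<Rightarrow> 'b::real_normed_vector) \<Rightarrow> bool" where
  "C_upto 0 S f \<longleftrightarrow> continuous_on S f"
| "C_upto (Suc n) S f \<longleftrightarrow>
     (\<forall>p\<in>S. f differentiable (at p)) \<and> (\<forall>v. C_upto n S (\<lambda>p. frechet_derivative f (at p) v))"

definition smooth_on :: "'a::real_normed_vector set \<Rightarrow> ('a \<Rightarrow> 'b::real_normed_vector) \<Rightarrow> bool" where
  "smooth_on S f \<longleftrightarrow> (\<forall>n. C_upto n S f)"

definition diffeomorphism_on :: "'a::real_normed_vector set \<Rightarrow> ('a \<Rightarrow> 'b::real_normed_vector) \<Rightarrow> bool" where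
  "diffeomorphism_on S f \<longleftrightarrow>
     open S \<and> open (f ` S) \<and> smooth_on S f \<and>
     (\<exists>g. smooth_on (f ` S) g \<and> (\<forall>p\<in>S. g (f p) = p))"


(* Coordinates (t, x, u). *)
type_synonym base = "real \<times> real \<times> real"

(* ((t, x, u), (u_t, u_x), (u_tt, u_tx, u_xx)) *)
type_synonym jet = "base \<times> (real \<times> real) \<times> (real \<times> real \<times> real)"

(* A second-order jet together with the values (A, B) of the arbitrary elements. *)
type_synonym ext = "jet \<times> (real \<times> real)"

fun jet_base :: "jet \<Rightarrow> base" where
  "jet_base ((t, x, u), (ut, ux), (utt, utx, uxx)) = (t, x, u)"
fun jet_x :: "jet \<Rightarrow> real" where
  "jet_x ((t, x, u), (ut, ux), (utt, utx, uxx)) = x"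
fun jet_u :: "jet \<Rightarrow> real" where
  "jet_u ((t, x, u), (ut, ux), (utt, utx, uxx)) = u"
fun jet_ut :: "jet \<Rightarrow> real" where
  "jet_ut ((t, x, u), (ut, ux), (utt, utx, uxx)) = ut"

definition ext_base :: "ext \<Rightarrow> base" where
  "ext_base p = jet_base (fst p)"
definition ext_x :: "ext \<Rightarrow> real" where
  "ext_x p = jet_x (fst p)"

definition ext_space :: "ext set" where
  "ext_space = {(z, a, b). a \<noteq> 0}"


(* The total derivatives D_t and D_x, without the terms in the derivatives with respect to
   u_tt, u_tx, u_xx.  They agree with the full total derivatives on functions depending on
   jets of order at most one only, and they are only applied to such functions. *)
fun dir_t :: "jet \<Rightarrow> jet" where
  "dir_t ((t, x, u), (ut, ux), (utt, utx, uxx)) = ((1, 0, ut), (utt, utx), (0, 0, 0))"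
fun dir_x :: "jet \<Rightarrow> jet" where
  "dir_x ((t, x, u), (ut, ux), (utt, utx, uxx)) = ((0, 1, ux), (utx, uxx), (0, 0, 0))"

definition total_t :: "(jet \<Rightarrow> real) \<Rightarrow> jet \<Rightarrow> real" where
  "total_t F z = frechet_derivative F (at z) (dir_t z)"
definition total_x :: "(jet \<Rightarrow> real) \<Rightarrow> jet \<Rightarrow> real" where
  "total_x F z = frechet_derivative F (at z) (dir_x z)"

(* The total derivatives with respect to the new independent variables T and Y, obtained by
   solving D_t F = F_T D_t T + F_Y D_t Y and D_x F = F_T D_x T + F_Y D_x Y for F_T and F_Y. *)
definition total_jacobian :: "(jet \<Rightarrow> real) \<Rightarrow> (jet \<Rightarrow> real) \<Rightarrow> jet \<Rightarrow> real" where
  "total_jacobian T Y z = total_t T z * total_x Y z - total_x T z * total_t Y z"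
definition new_total_t :: "(jet \<Rightarrow> real) \<Rightarrow> (jet \<Rightarrow> real) \<Rightarrow> (jet \<Rightarrow> real) \<Rightarrow> jet \<Rightarrow> real" where
  "new_total_t T Y F z =
     (total_t F z * total_x Y z - total_x F z * total_t Y z) / total_jacobian T Y z"
definition new_total_x :: "(jet \<Rightarrow> real) \<Rightarrow> (jet \<Rightarrow> real) \<Rightarrow> (jet \<Rightarrow> real) \<Rightarrow> jet \<Rightarrow> real" where
  "new_total_x T Y F z =
     (total_t T z * total_x F z - total_x T z * total_t F z) / total_jacobian T Y z"

definition prolongation :: "(base \<Rightarrow> base) \<Rightarrow> jet \<Rightarrow> jet" where
  "prolongation \<phi> z =
    (let T = (\<lambda>z. fst (\<phi> (jet_base z)));
         Y = (\<lambda>z. fst (snd (\<phi> (jet_base z))));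
         U = (\<lambda>z. snd (snd (\<phi> (jet_base z))));
         Ut = new_total_t T Y U;
         Ux = new_total_x T Y U
     in (\<phi> (jet_base z), (Ut z, Ux z),
         (new_total_t T Y Ut z, new_total_x T Y Ut z, new_total_x T Y Ux z)))"

(* The common kernel at z of the contact forms
   du - u_t dt - u_x dx,  du_t - u_tt dt - u_tx dx,  du_x - u_tx dt - u_xx dx. *)
fun contact_plane :: "jet \<Rightarrow> jet set" where
  "contact_plane ((t, x, u), (ut, ux), (utt, utx, uxx)) =
     {((dt, dx, du), (dut, dux), (dutt, dutx, duxx)) | dt dx du dut dux dutt dutx duxx.
        du = ut * dt + ux * dx \<and> dut = utt * dt + utx * dx \<and> dux = utx * dt + uxx * dx}"

definition preserves_contact :: "ext set \<Rightarrow> (ext \<Rightarrow> ext) \<Rightarrow> bool" where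
  "preserves_contact \<Omega> \<Phi> \<longleftrightarrow>
     (\<forall>p\<in>\<Omega>. \<forall>v. fst v \<in> contact_plane (fst p) \<longrightarrow>
        fst (frechet_derivative \<Phi> (at p) v) \<in> contact_plane (fst (\<Phi> p)))"

definition projectable :: "ext set \<Rightarrow> (ext \<Rightarrow> ext) \<Rightarrow> bool" where
  "projectable \<Omega> \<Phi> \<longleftrightarrow>
     (\<exists>\<phi>. \<forall>p\<in>\<Omega>. ext_base (\<Phi> p) = \<phi> (ext_base p)) \<and>
     (\<exists>\<psi>. \<forall>p\<in>\<Omega>. fst (\<Phi> p) = \<psi> (fst p))"


definition arbitrary_elements :: "real set \<Rightarrow> (real \<Rightarrow> real) \<Rightarrow> (real \<Rightarrow> real) \<Rightarrow> bool" where
  "arbitrary_elements I A B \<longleftrightarrow>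
     open I \<and> smooth_on I A \<and> smooth_on I B \<and> (\<forall>x\<in>I. A x \<noteq> 0)"

(* The equation u_t = (A u)_xx + (B u)_x as a subset of the second-order jet space. *)
definition fokker_planck :: "real set \<Rightarrow> (real \<Rightarrow> real) \<Rightarrow> (real \<Rightarrow> real) \<Rightarrow> jet set" where
  "fokker_planck I A B =
     {z. jet_x z \<in> I \<and>
         jet_ut z = total_x (total_x (\<lambda>w. A (jet_x w) * jet_u w)) z
                  + total_x (\<lambda>w. B (jet_x w) * jet_u w) z}"

definition maps_class :: "ext set \<Rightarrow> (ext \<Rightarrow> ext) \<Rightarrow> bool" where
  "maps_class \<Omega> \<Phi> \<longleftrightarrow>
     (\<forall>I A B. arbitrary_elements I A B \<longrightarrow>
        (\<exists>I' A' B'. arbitrary_elements I' A' B' \<and>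
           (\<forall>z z' a' b'.
              jet_x z \<in> I \<and> (z, A (jet_x z), B (jet_x z)) \<in> \<Omega> \<and>
              \<Phi> (z, A (jet_x z), B (jet_x z)) = (z', a', b') \<longrightarrow>
                jet_x z' \<in> I' \<and> a' = A' (jet_x z') \<and> b' = B' (jet_x z') \<and>
                (z \<in> fokker_planck I A B \<longleftrightarrow> z' \<in> fokker_planck I' A' B'))))"

definition equivalence_transformation :: "ext set \<Rightarrow> (ext \<Rightarrow> ext) \<Rightarrow> bool" where
  "equivalence_transformation \<Omega> \<Phi> \<longleftrightarrow>
     \<Omega> \<subseteq> ext_space \<and> \<Phi> ` \<Omega> \<subseteq> ext_space \<and>
     diffeomorphism_on \<Omega> \<Phi> \<and> projectable \<Omega> \<Phi> \<and> preserves_contact \<Omega> \<Phi> \<and> maps_class \<Omega> \<Phi>"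

definition locally_near_points :: "(ext set \<Rightarrow> (ext \<Rightarrow> ext) \<Rightarrow> bool) \<Rightarrow> ext set \<Rightarrow> (ext \<Rightarrow> ext) \<Rightarrow> bool" where
  "locally_near_points P \<Omega> \<Phi> \<longleftrightarrow> (\<forall>p\<in>\<Omega>. \<exists>V. open V \<and> p \<in> V \<and> V \<subseteq> \<Omega> \<and> P V \<Phi>)"

definition equivalence_pseudogroup :: "(ext set \<times> (ext \<Rightarrow> ext)) set" where
  "equivalence_pseudogroup = {(\<Omega>, \<Phi>). locally_near_points equivalence_transformation \<Omega> \<Phi>}"


definition fp_transformation :: "real \<Rightarrow> real \<Rightarrow> real \<Rightarrow> (real \<Rightarrow> real) \<Rightarrow> ext \<Rightarrow> ext" where
  "fp_transformation c1 c2 c3 X = (\<lambda>(z, a, b).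
     (prolongation (\<lambda>(t, x, u). (c1 * t + c2, X x, c3 / deriv X x * u)) z,
      (deriv X (jet_x z))\<^sup>2 / c1 * a,
      deriv X (jet_x z) / c1 * b - deriv (deriv X) (jet_x z) / c1 * a))"

definition has_fp_form :: "ext set \<Rightarrow> (ext \<Rightarrow> ext) \<Rightarrow> bool" where
  "has_fp_form \<Omega> \<Phi> \<longleftrightarrow>
     (\<exists>c1 c2 c3 X. c1 * c3 \<noteq> 0 \<and> smooth_on (ext_x ` \<Omega>) X \<and>
        (\<forall>x \<in> ext_x ` \<Omega>. deriv X x \<noteq> 0) \<and>
        (\<forall>p\<in>\<Omega>. \<Phi> p = fp_transformation c1 c2 c3 X p))"

end

theory Submission
  imports Defs
begin

text \<open>
  Sufficiency is a computation: with m = 1/X' the prolonged transformation is polynomial in m, m', m''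
  and in the jet coordinates, and the inverse is of the same form.

  For necessity, let the base components of an equivalence transformation be T, Y and U, and write k
  for the value of B_x.
  (1) If Y varied with t or u, there would be a curve along which x varies and Y is constant; the new
  coefficients are constant on it for all choices of A and B, so they would not depend on the old
  ones.  Hence Y = X(x).
  (2) A point with u nonzero lies on the equation with A constant and B affine of suitable slope k.
  There u_tt is free, so the new u_xx must not depend on it, and by the contact conditions
  this forces D_x T = 0; hence T depends on t only.
  (3) Varying u_xx and u_t along the equation gives the new A as a X'^2 / T'.  Since it must not
  depend on t, T'' = 0.
  (4) Now the new equation is a polynomial identity in u_x, k, b and a.  Its u_x^2 coefficient
  gives U_uu = 0, the coefficients of k and b give U = u U_u and (X' U)_x = 0, and
  the remaining one gives U_t = 0.  Hence X' U is a constant multiple of u.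
  Points with u = 0 are reached by continuity.
\<close>

section \<open>Smooth functions\<close>

text \<open>The class is tested only through coefficients affine in x. Their values and slopes at a
  point can be prescribed freely, and all points of \<Omega> over the graph of one test pair share
  one new pair (A, B); comparing such points is the source of the necessary conditions. The slope of
  B enters the equation only through B_x u. It can therefore be used to put a jet on the equation
  exactly when u is nonzero, which is why the points with u = 0 need a limit.

  The new equation also contains A_x, A_xx and B_x, whose values a map of the space of (t, x, u_(2),
  A, B) does not prescribe directly. They are recovered by differentiating the formulas for the new
  A and B along a line on which x moves, u and A are fixed and B has slope k.

  Convexity of the projection to (t, x, u) serves both directions: vanishing partial derivatives can
  be integrated to functions of one variable on an interval, and a function X with nonvanishing
  derivative is injective on an interval.\<close>

lemma smooth_on_D:
  assumes "smooth_on S f"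
  shows "C_upto n S f"
  using assms by (simp add: smooth_on_def)

lemma C_upto_subset: "C_upto n S f \<Longrightarrow> T \<subseteq> S \<Longrightarrow> C_upto n T f"
  by (induction n arbitrary: f) (auto intro: continuous_on_subset)

lemma smooth_on_subset: "smooth_on S f \<Longrightarrow> T \<subseteq> S \<Longrightarrow> smooth_on T f"
  by (auto simp: smooth_on_def intro: C_upto_subset)

text \<open>The two functions have the same derivatives at \<open>p\<close>, so the choice operator
  inside \<open>frechet_derivative\<close> picks the same value even where neither is
  differentiable.\<close>

lemma frechet_derivative_cong_open:
  assumes "open S" "p \<in> S" "\<And>q. q \<in> S \<Longrightarrow> f q = g q"
  shows "frechet_derivative f (at p) = frechet_derivative g (at p)"
proof -
  have "(f has_derivative D) (at p) \<longleftrightarrow> (g has_derivative D) (at p)" for D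
    using has_derivative_transform_within_open[OF _ assms(1,2), of f D UNIV g]
      has_derivative_transform_within_open[OF _ assms(1,2), of g D UNIV f] assms(3) by auto
  then show ?thesis by (simp add: frechet_derivative_def)
qed

lemma differentiable_cong_open:
  assumes "f differentiable (at p)" "open S" "p \<in> S" "\<And>q. q \<in> S \<Longrightarrow> f q = g q"
  shows "g differentiable (at p)"
  using assms has_derivative_transform_within_open[OF _ assms(2,3), of f _ UNIV g]
  unfolding differentiable_def by blast

lemma C_upto_cong:
  assumes "C_upto n S f" "open S" "\<And>q. q \<in> S \<Longrightarrow> f q = g q"
  shows "C_upto n S g"
  using assms
proof (induction n arbitrary: f g)
  case 0
  then show ?case by (simp cong: continuous_on_cong)
next
  case (Suc n)
  have "C_upto n S (\<lambda>p. frechet_derivative g (at p) v)" for v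
  proof (rule Suc.IH)
    show "C_upto n S (\<lambda>p. frechet_derivative f (at p) v)" using Suc.prems by simp
    show "frechet_derivative f (at q) v = frechet_derivative g (at q) v" if "q \<in> S" for q
      using frechet_derivative_cong_open[OF Suc.prems(2) that, of f g] Suc.prems(3) by simp
  qed fact
  moreover have "g differentiable (at p)" if "p \<in> S" for p
    using differentiable_cong_open[of f p S g] Suc.prems that by auto
  ultimately show ?case by simp
qed

lemma smooth_on_cong:
  "smooth_on S f \<Longrightarrow> open S \<Longrightarrow> (\<And>q. q \<in> S \<Longrightarrow> f q = g q) \<Longrightarrow> smooth_on S g"
  unfolding smooth_on_def using C_upto_cong by blast

lemma C_upto_Suc_has_derivative:
  "C_upto (Suc n) S f \<Longrightarrow> p \<in> S \<Longrightarrow> (f has_derivative frechet_derivative f (at p)) (at p)"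
  using frechet_derivative_works by auto

lemma C_upto_continuous:
  assumes "C_upto n S f"
  shows "continuous_on S f"
proof (cases n)
  case (Suc k)
  show ?thesis
    by (rule has_derivative_continuous_on[OF has_derivative_at_withinI[OF
            C_upto_Suc_has_derivative[OF assms[unfolded Suc]]]])
qed (use assms in simp)

lemma C_upto_Suc_D: "C_upto (Suc n) S f \<Longrightarrow> C_upto n S f"
proof (induction n arbitrary: f)
  case 0
  then show ?case using C_upto_continuous[OF 0] by simp
next
  case (Suc n)
  then show ?case by auto
qed

lemma smooth_on_continuous: "smooth_on S f \<Longrightarrow> continuous_on S f"
  using C_upto_continuous smooth_on_D by blast

lemma smooth_on_differentiable: "smooth_on S f \<Longrightarrow> p \<in> S \<Longrightarrow> f differentiable (at p)"
  using smooth_on_D[of S f "Suc 0"] by simp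

lemma smooth_on_has_derivative:
  "smooth_on S f \<Longrightarrow> p \<in> S \<Longrightarrow> (f has_derivative frechet_derivative f (at p)) (at p)"
  using smooth_on_differentiable frechet_derivative_works by blast

lemma smooth_on_frechet: "smooth_on S f \<Longrightarrow> smooth_on S (\<lambda>p. frechet_derivative f (at p) v)"
  unfolding smooth_on_def
proof
  fix n assume "\<forall>n. C_upto n S f"
  then have "C_upto (Suc n) S f" by blast
  then show "C_upto n S (\<lambda>p. frechet_derivative f (at p) v)" by simp
qed

text \<open>Exchanges the chosen derivative for an explicit formula \<open>D\<close>. The closure
  properties below are inductions on \<open>n\<close> in which the formula is built from functions
  already known to be of class C^n.\<close>

lemma C_upto_SucI:
  assumes "open S" "\<And>p. p \<in> S \<Longrightarrow> (f has_derivative D p) (at p)" "\<And>v. C_upto n S (\<lambda>p. D p v)"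
  shows "C_upto (Suc n) S f"
proof -
  have *: "frechet_derivative f (at p) = D p" if "p \<in> S" for p
    using frechet_derivative_at[OF assms(2)[OF that]] by simp
  have "C_upto n S (\<lambda>p. frechet_derivative f (at p) v)" for v
    by (rule C_upto_cong[OF assms(3)[of v] assms(1)]) (simp add: *)
  with assms(2) show ?thesis by (auto simp: differentiable_def)
qed

lemma C_upto_local:
  assumes "\<And>p. p \<in> S \<Longrightarrow> \<exists>N. open N \<and> p \<in> N \<and> C_upto n N f"
  shows "C_upto n S f"
  using assms
proof (induction n arbitrary: f)
  case 0
  have "isCont f p" if "p \<in> S" for p
    using 0[OF that] continuous_on_eq_continuous_at by auto
  then show ?case by (simp add: continuous_at_imp_continuous_on)
next
  case (Suc n)
  have "C_upto n S (\<lambda>p. frechet_derivative f (at p) v)" for v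
    by (rule Suc.IH) (use Suc.prems in force)
  moreover have "f differentiable (at p)" if "p \<in> S" for p
    using Suc.prems[OF that] by auto
  ultimately show ?case by simp
qed

text \<open>Meant for functions obtained by choice, which are identified with a visibly smooth
  composite only near each point.\<close>

lemma smooth_on_local:
  assumes "\<And>p. p \<in> S \<Longrightarrow> \<exists>N. open N \<and> p \<in> N \<and> smooth_on N f"
  shows "smooth_on S f"
  unfolding smooth_on_def
proof
  fix n show "C_upto n S f" by (rule C_upto_local) (use assms in \<open>auto simp: smooth_on_def\<close>)
qed

section \<open>Closure properties of C^n and smooth maps\<close>

lemma C_upto_const: "open S \<Longrightarrow> C_upto n S (\<lambda>_. c)"
proof (induction n arbitrary: c)
  case (Suc n)
  then show ?case by (intro C_upto_SucI[where D = "\<lambda>_ _. 0"]) (auto intro!: derivative_eq_intros)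
qed simp

lemma smooth_on_const [simp]: "open S \<Longrightarrow> smooth_on S (\<lambda>_. c)"
  by (simp add: smooth_on_def C_upto_const)

lemma C_upto_bounded_linear:
  assumes "bounded_linear L" "C_upto n S f" "open S"
  shows "C_upto n S (\<lambda>p. L (f p))"
  using assms(2)
proof (induction n arbitrary: f)
  case 0
  then show ?case using assms(1) by (simp add: bounded_linear.continuous_on)
next
  case (Suc n)
  show ?case
    by (rule C_upto_SucI[OF assms(3), where D = "\<lambda>p v. L (frechet_derivative f (at p) v)"])
      (use Suc in \<open>auto intro!: bounded_linear.has_derivative[OF assms(1)] C_upto_Suc_has_derivative\<close>)
qed

lemma smooth_on_bounded_linear:
  "bounded_linear L \<Longrightarrow> smooth_on S f \<Longrightarrow> open S \<Longrightarrow> smooth_on S (\<lambda>p. L (f p))"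
  unfolding smooth_on_def using C_upto_bounded_linear by blast

lemma C_upto_id: "open S \<Longrightarrow> C_upto n S (\<lambda>p. p)"
proof (cases n)
  case (Suc k)
  assume "open S"
  then show ?thesis unfolding Suc
    by (intro C_upto_SucI[where D = "\<lambda>_ v. v"]) (auto intro!: derivative_eq_intros C_upto_const)
qed simp

lemma smooth_on_linear: "bounded_linear L \<Longrightarrow> open S \<Longrightarrow> smooth_on S L"
  using smooth_on_bounded_linear[of L S "\<lambda>p. p"] by (simp add: smooth_on_def C_upto_id)

lemma C_upto_add:
  assumes "C_upto n S f" "C_upto n S g" "open S"
  shows "C_upto n S (\<lambda>p. f p + g p)"
  using assms(1,2)
proof (induction n arbitrary: f g)
  case 0
  then show ?case by (simp add: continuous_on_add)
next
  case (Suc n)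
  show ?case
    by (rule C_upto_SucI[OF assms(3),
          where D = "\<lambda>p v. frechet_derivative f (at p) v + frechet_derivative g (at p) v"])
      (use Suc in \<open>auto intro!: has_derivative_add C_upto_Suc_has_derivative\<close>)
qed

lemma smooth_on_add:
  "smooth_on S f \<Longrightarrow> smooth_on S g \<Longrightarrow> open S \<Longrightarrow> smooth_on S (\<lambda>p. f p + g p)"
  unfolding smooth_on_def using C_upto_add by blast

lemma C_upto_sum:
  assumes "\<And>i. i \<in> I \<Longrightarrow> C_upto n S (f i)" "open S"
  shows "C_upto n S (\<lambda>p. \<Sum>i\<in>I. f i p)"
  using assms
  by (induction I rule: infinite_finite_induct) (auto intro: C_upto_const C_upto_add)

text \<open>By the Leibniz rule the derivative is a sum of two values of \<open>B\<close> at pairs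
  that are again of class C^n. The general bilinear form covers both the product of reals and the
  scalar multiplication that occurs in the chain rule.\<close>

lemma C_upto_bilinear:
  assumes "bounded_bilinear B" "C_upto n S f" "C_upto n S g" "open S"
  shows "C_upto n S (\<lambda>p. B (f p) (g p))"
  using assms(2,3)
proof (induction n arbitrary: f g)
  case 0
  then show ?case using bounded_bilinear.continuous_on[OF assms(1)] by auto
next
  case (Suc n)
  show ?case
  proof (rule C_upto_SucI[OF assms(4)])
    show "((\<lambda>p. B (f p) (g p)) has_derivative
      (\<lambda>v. B (f p) (frechet_derivative g (at p) v) + B (frechet_derivative f (at p) v) (g p))) (at p)"
      if "p \<in> S" for p
      by (intro bounded_bilinear.FDERIV[OF assms(1)] Suc.prems[THEN C_upto_Suc_has_derivative] that)
    show "C_upto n S (\<lambda>p. B (f p) (frechet_derivative g (at p) v)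
         + B (frechet_derivative f (at p) v) (g p))" for v
      using Suc.prems by (intro C_upto_add Suc.IH assms(4)) (auto intro: C_upto_Suc_D)
  qed
qed

lemma smooth_on_mult:
  fixes f g :: "'a::real_normed_vector \<Rightarrow> real"
  shows "smooth_on S f \<Longrightarrow> smooth_on S g \<Longrightarrow> open S \<Longrightarrow> smooth_on S (\<lambda>p. f p * g p)"
  unfolding smooth_on_def using C_upto_bilinear[OF bounded_bilinear_mult] by blast

lemma smooth_on_minus:
  fixes f :: "'a::real_normed_vector \<Rightarrow> 'b::real_normed_vector"
  shows "smooth_on S f \<Longrightarrow> open S \<Longrightarrow> smooth_on S (\<lambda>p. - f p)"
  by (intro smooth_on_bounded_linear[of uminus] bounded_linear_minus bounded_linear_ident)

lemma smooth_on_diff: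
  fixes f g :: "'a::real_normed_vector \<Rightarrow> 'b::real_normed_vector"
  shows "smooth_on S f \<Longrightarrow> smooth_on S g \<Longrightarrow> open S \<Longrightarrow> smooth_on S (\<lambda>p. f p - g p)"
  using smooth_on_add[OF _ smooth_on_minus, of S f g] by simp

lemma smooth_on_Pair:
  assumes "smooth_on S f" "smooth_on S g" "open S"
  shows "smooth_on S (\<lambda>p. (f p, g p))"
proof -
  have "smooth_on S (\<lambda>p. (f p, 0) + (0, g p))"
    using assms
    by (intro smooth_on_add smooth_on_bounded_linear[of "\<lambda>x. (x, 0)"]
        smooth_on_bounded_linear[of "\<lambda>x. (0, x)"] bounded_linear_Pair bounded_linear_ident
        bounded_linear_zero)
  then show ?thesis by simp
qed

text \<open>In the chain rule the direction fed to the derivative of \<open>g\<close> moves with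
  \<open>p\<close>, while \<open>C_upto\<close> speaks about fixed directions. Expanding that
  direction in the basis of the Euclidean space in the middle leaves a finite sum of products of a
  coordinate of Df and a derivative of \<open>g\<close> in a fixed direction, to which the induction
  hypothesis applies.\<close>

lemma C_upto_compose:
  fixes f :: "'a::real_normed_vector \<Rightarrow> 'b::euclidean_space"
    and g :: "'b \<Rightarrow> 'c::real_normed_vector"
  assumes "C_upto n T g" "C_upto n S f" "open S" "open T" "f ` S \<subseteq> T"
  shows "C_upto n S (\<lambda>p. g (f p))"
  using assms(1,2)
proof (induction n arbitrary: g)
  case 0
  then show ?case using assms(5) by (auto intro: continuous_on_compose2)
next
  case (Suc n)
  show ?case
  proof (rule C_upto_SucI[OF assms(3)])
    fix p assume p: "p \<in> S"
    let ?Df = "frechet_derivative f (at p)" and ?Dg = "frechet_derivative g (at (f p))"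
    have f: "(f has_derivative ?Df) (at p)"
      using Suc.prems(2) p by (rule C_upto_Suc_has_derivative)
    have g: "(g has_derivative ?Dg) (at (f p))"
      using Suc.prems(1) by (rule C_upto_Suc_has_derivative) (use p assms(5) in auto)
    have c: "((\<lambda>p. g (f p)) has_derivative (\<lambda>v. ?Dg (?Df v))) (at p)"
      using diff_chain_at[OF f g] by (simp add: o_def)
    have Dg: "?Dg w = (\<Sum>i\<in>Basis. (w \<bullet> i) *\<^sub>R ?Dg i)" for w
    proof -
      have "?Dg w = ?Dg (\<Sum>i\<in>Basis. (w \<bullet> i) *\<^sub>R i)" by (simp add: euclidean_representation)
      also have "\<dots> = (\<Sum>i\<in>Basis. (w \<bullet> i) *\<^sub>R ?Dg i)"
        using has_derivative_linear[OF g] by (simp add: linear_sum linear_cmul o_def)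
      finally show ?thesis .
    qed
    show "((\<lambda>p. g (f p)) has_derivative
       (\<lambda>v. \<Sum>i\<in>Basis. (?Df v \<bullet> i) *\<^sub>R ?Dg i)) (at p)"
      by (rule has_derivative_eq_rhs[OF c]) (rule ext, rule Dg)
  next
    fix v
    show "C_upto n S (\<lambda>p. \<Sum>i\<in>Basis. (frechet_derivative f (at p) v \<bullet> i) *\<^sub>R
            frechet_derivative g (at (f p)) i)"
      using Suc.prems
      by (intro C_upto_sum C_upto_bilinear[OF bounded_bilinear_scaleR] assms(3)
          C_upto_bounded_linear[OF bounded_linear_inner_left]
          Suc.IH[where g = "\<lambda>q. frechet_derivative g (at q) _"])
        (auto intro: C_upto_Suc_D)
  qed
qed

lemma smooth_on_compose:
  fixes f :: "'a::real_normed_vector \<Rightarrow> 'b::euclidean_space"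
    and g :: "'b \<Rightarrow> 'c::real_normed_vector"
  assumes "smooth_on T g" "smooth_on S f" "open S" "open T" "f ` S \<subseteq> T"
  shows "smooth_on S (\<lambda>p. g (f p))"
  unfolding smooth_on_def
  using C_upto_compose[OF smooth_on_D[OF assms(1)] smooth_on_D[OF assms(2)] assms(3-5)] by (rule allI)

text \<open>The derivative of \<open>inverse\<close> is a product of two copies of
  \<open>inverse\<close> and a constant, so the induction closes on its own.\<close>

lemma smooth_on_inverse_real: "smooth_on (- {0::real}) inverse"
proof -
  have o: "open (- {0::real})" by (simp add: open_Compl)
  have "C_upto n (- {0::real}) inverse" for n
  proof (induction n)
    case 0
    show ?case by (auto intro!: continuous_intros)
  next
    case (Suc n)
    show ?case
    proof (rule C_upto_SucI[OF o])
      show "(inverse has_derivative (\<lambda>v. (inverse p * inverse p) * (- v))) (at p)"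
        if "p \<in> - {0}" for p :: real
        using that by (auto intro!: derivative_eq_intros)
      show "C_upto n (- {0}) (\<lambda>p::real. inverse p * inverse p * - v)" for v
        by (intro C_upto_bilinear[OF bounded_bilinear_mult] Suc C_upto_const o)
    qed
  qed
  then show ?thesis by (simp add: smooth_on_def)
qed

lemma smooth_on_divide:
  fixes f g :: "'a::real_normed_vector \<Rightarrow> real"
  assumes "smooth_on S f" "smooth_on S g" "open S" "\<And>p. p \<in> S \<Longrightarrow> g p \<noteq> 0"
  shows "smooth_on S (\<lambda>p. f p / g p)"
  unfolding divide_inverse
proof (rule smooth_on_mult[OF assms(1) _ assms(3)])
  show "smooth_on S (\<lambda>p. inverse (g p))"
    by (rule smooth_on_compose[OF smooth_on_inverse_real assms(2,3)]) (use assms(4) in auto)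
qed

lemma smooth_on_power:
  fixes f :: "'a::real_normed_vector \<Rightarrow> real"
  shows "smooth_on S f \<Longrightarrow> open S \<Longrightarrow> smooth_on S (\<lambda>p. f p ^ n)"
  by (induction n) (auto intro: smooth_on_mult)

section \<open>Smooth functions of one real variable and their inverses\<close>

lemma smooth_on_DERIV:
  fixes f :: "real \<Rightarrow> real"
  shows "smooth_on I f \<Longrightarrow> x \<in> I \<Longrightarrow> (f has_real_derivative deriv f x) (at x)"
  using smooth_on_differentiable[of I f x] real_differentiable_def DERIV_deriv_iff_real_differentiable
  by (metis DERIV_imp_deriv)

lemma frechet_derivative_real:
  fixes f :: "real \<Rightarrow> real"
  assumes "(f has_real_derivative D) (at x)"
  shows "frechet_derivative f (at x) v = D * v"
  using frechet_derivative_at[OF assms[unfolded has_field_derivative_def]] by metis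

lemma smooth_on_deriv:
  fixes f :: "real \<Rightarrow> real"
  assumes "smooth_on I f" "open I"
  shows "smooth_on I (deriv f)"
  by (rule smooth_on_cong[OF smooth_on_frechet[OF assms(1), of 1] assms(2)])
    (simp add: frechet_derivative_real[OF smooth_on_DERIV[OF assms(1)]])

text \<open>The derivative of \<open>g\<close> comes from the inverse function theorem. It equals 1
  / f'(g y) and involves only \<open>g\<close> itself, so \<open>g\<close> of class C^n has a
  derivative of class C^n and is of class C^(n+1).\<close>

lemma smooth_on_inverse_function:
  fixes f g :: "real \<Rightarrow> real"
  assumes "smooth_on I f" "open I" "open (f ` I)"
    and "\<And>x. x \<in> I \<Longrightarrow> g (f x) = x" "\<And>x. x \<in> I \<Longrightarrow> deriv f x \<noteq> 0"
  shows "smooth_on (f ` I) g"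
    and "\<And>x. x \<in> I \<Longrightarrow> (g has_real_derivative inverse (deriv f x)) (at (f x))"
proof -
  show g: "(g has_real_derivative inverse (deriv f x)) (at (f x))" if "x \<in> I" for x
    unfolding has_field_derivative_def
    by (rule has_derivative_inverse_strong[OF assms(2) that smooth_on_continuous[OF assms(1)] assms(4)
          smooth_on_DERIV[OF assms(1) that, unfolded has_field_derivative_def]])
      (use assms(5)[OF that] in \<open>auto simp: fun_eq_iff\<close>)
  have "C_upto n (f ` I) g" for n
  proof (induction n)
    case 0
    show ?case using g DERIV_isCont by (auto intro!: continuous_at_imp_continuous_on)
  next
    case (Suc n)
    have d: "C_upto n (f ` I) (\<lambda>y. inverse (deriv f (g y)))"
      by (rule C_upto_compose[OF smooth_on_D[OF smooth_on_inverse_real]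
            C_upto_compose[OF smooth_on_D[OF smooth_on_deriv[OF assms(1,2)]] Suc]])
        (use assms in auto)
    show ?case
      by (rule C_upto_SucI[OF assms(3), where D = "\<lambda>y v. inverse (deriv f (g y)) * v"])
        (use g assms(4) C_upto_bilinear[OF bounded_bilinear_mult d C_upto_const[OF assms(3)] assms(3)]
          in \<open>auto simp: has_field_derivative_def\<close>)
  qed
  then show "smooth_on (f ` I) g" by (simp add: smooth_on_def)
qed

lemma smooth_on_ident: "open S \<Longrightarrow> smooth_on S (\<lambda>p. p)"
  by (simp add: smooth_on_def C_upto_id)

lemma smooth_on_fst:
  "smooth_on S f \<Longrightarrow> open S \<Longrightarrow> smooth_on S (\<lambda>p. fst (f p))"
  by (rule smooth_on_bounded_linear[OF bounded_linear_fst])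

lemma smooth_on_snd:
  "smooth_on S f \<Longrightarrow> open S \<Longrightarrow> smooth_on S (\<lambda>p. snd (f p))"
  by (rule smooth_on_bounded_linear[OF bounded_linear_snd])

lemmas smooth_on_intros =
  smooth_on_Pair smooth_on_add smooth_on_diff smooth_on_minus smooth_on_mult smooth_on_divide
  smooth_on_power smooth_on_const smooth_on_fst smooth_on_snd smooth_on_ident

lemma smooth_on_deriv_has_derivative:
  fixes f :: "real \<Rightarrow> real"
  assumes "smooth_on I f" "(g has_derivative g') (at p within S)" "g p \<in> I"
  shows "((\<lambda>q. f (g q)) has_derivative (\<lambda>v. deriv f (g p) * g' v)) (at p within S)"
  using has_derivative_compose[OF assms(2) smooth_on_DERIV[OF assms(1,3), unfolded has_field_derivative_def]]
  by simp

section \<open>The Fokker--Planck class and prolongation in coordinates\<close>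

lemma jet_fun_has_derivative:
  fixes f :: "real \<Rightarrow> real" and z :: jet
  assumes "smooth_on J f" "fst (snd (fst z)) \<in> J"
  shows "((\<lambda>w. f (fst (snd (fst w)))) has_derivative
    (\<lambda>v. deriv f (fst (snd (fst z))) * fst (snd (fst v)))) (at z)"
  by (rule smooth_on_deriv_has_derivative[OF assms(1)]) (auto intro!: derivative_intros assms(2))

lemma jet_base_eq: "jet_base z = fst z" by (cases z rule: jet_base.cases) simp
lemma jet_x_eq: "jet_x z = fst (snd (fst z))" by (cases z rule: jet_base.cases) simp
lemma jet_u_eq: "jet_u z = snd (snd (fst z))" by (cases z rule: jet_base.cases) simp
lemma jet_ut_eq: "jet_ut z = fst (fst (snd z))" by (cases z rule: jet_base.cases) simp

lemmas jet_coordinates = jet_base_eq jet_x_eq jet_u_eq jet_ut_eq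

lemma ext_base_eq: "ext_base p = fst (fst p)" by (simp add: ext_base_def jet_coordinates)
lemma ext_x_eq: "ext_x p = fst (snd (fst (fst p)))" by (simp add: ext_x_def jet_coordinates)

lemma total_derivatives:
  assumes "(F has_derivative D) (at z)"
  shows "total_t F z = D (dir_t z)" and "total_x F z = D (dir_x z)"
  unfolding total_t_def total_x_def using frechet_derivative_at[OF assms] by simp_all

lemma total_tI: "(F has_derivative D) (at z) \<Longrightarrow> D (dir_t z) = c \<Longrightarrow> total_t F z = c"
  and total_xI: "(F has_derivative D) (at z) \<Longrightarrow> D (dir_x z) = c \<Longrightarrow> total_x F z = c"
  using total_derivatives by auto

lemma total_cong_open:
  assumes "open S" "z \<in> S" "\<And>w. w \<in> S \<Longrightarrow> F w = G w"
  shows "total_t F z = total_t G z" and "total_x F z = total_x G z"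
  unfolding total_t_def total_x_def using frechet_derivative_cong_open[OF assms] by simp_all

lemma dir_t_eq: "dir_t z = ((1, 0, fst (fst (snd z))), (fst (snd (snd z)), fst (snd (snd (snd z)))), 0)"
  by (cases z rule: jet_base.cases) (simp add: zero_prod_def)
lemma dir_x_eq: "dir_x z = ((0, 1, snd (fst (snd z))), (fst (snd (snd (snd z))), snd (snd (snd (snd z)))), 0)"
  by (cases z rule: jet_base.cases) (simp add: zero_prod_def)

lemma open_jet_x: "open J \<Longrightarrow> open {z. jet_x z \<in> J}"
proof -
  assume "open J"
  moreover have "continuous_on UNIV (\<lambda>z::jet. fst (snd (fst z)))" by (intro continuous_intros)
  ultimately show ?thesis
    using open_vimage[of J "\<lambda>z::jet. fst (snd (fst z))"] by (simp add: vimage_def jet_coordinates)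
qed

lemma fokker_planck_iff:
  assumes "open I" "smooth_on I A" "smooth_on I B" "x \<in> I"
  shows "((t, x, u), (ut, ux), (utt, utx, uxx)) \<in> fokker_planck I A B \<longleftrightarrow>
    ut = deriv (deriv A) x * u + 2 * deriv A x * ux + A x * uxx + (deriv B x * u + B x * ux)"
proof -
  let ?z = "((t, x, u), (ut, ux), (utt, utx, uxx)) :: jet"
  have first: "total_x (\<lambda>w. f (jet_x w) * jet_u w) w
      = deriv f (jet_x w) * jet_u w + f (jet_x w) * snd (fst (snd w))"
    if "smooth_on I f" "jet_x w \<in> I" for f w
    unfolding jet_coordinates
    by (insert that(2)[unfolded jet_coordinates], rule total_xI, (rule jet_fun_has_derivative[OF that(1)] derivative_intros | assumption)+)
      (simp add: dir_x_eq algebra_simps)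
  \<comment> \<open>The outer total derivative sees a neighbourhood, so the inner one is replaced on
    the open set of all jets with x in \<open>I\<close>, not just at the given jet.\<close>
  have "total_x (total_x (\<lambda>w. A (jet_x w) * jet_u w)) ?z
      = total_x (\<lambda>w. deriv A (jet_x w) * jet_u w + A (jet_x w) * snd (fst (snd w))) ?z"
    by (rule total_cong_open(2)[OF open_jet_x[OF assms(1)]]) (use assms first in auto)
  also have "\<dots> = deriv (deriv A) x * u + 2 * deriv A x * ux + A x * uxx"
    unfolding jet_coordinates
    by (rule total_xI, (rule jet_fun_has_derivative[OF assms(2)]
          jet_fun_has_derivative[OF smooth_on_deriv[OF assms(2,1)]] derivative_intros
          | simp only: fst_conv snd_conv assms(4))+) (simp add: algebra_simps)
  finally show ?thesis using first[OF assms(3), of ?z] assms(4)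
    by (simp add: fokker_planck_def)
qed

section \<open>Closed form of the prolonged transformation\<close>

definition recip_deriv :: "(real \<Rightarrow> real) \<Rightarrow> real \<Rightarrow> real" where
  "recip_deriv X x = 1 / deriv X x"

lemma smooth_on_recip_deriv:
  assumes "smooth_on J X" "open J" "\<And>x. x \<in> J \<Longrightarrow> deriv X x \<noteq> 0"
  shows "smooth_on J (recip_deriv X)"
  unfolding recip_deriv_def[abs_def] by (intro smooth_on_intros smooth_on_deriv assms)

text \<open>The closed form of the transformation; m = \<open>recip_deriv X\<close> absorbs X'' through
  m' = - X''/X'^2.\<close>

definition fp_explicit :: "real \<Rightarrow> real \<Rightarrow> real \<Rightarrow> (real \<Rightarrow> real) \<Rightarrow> ext \<Rightarrow> ext" where
  "fp_explicit c1 c2 c3 X = (\<lambda>(((t, x, u), (ut, ux), (utt, utx, uxx)), (a, b)).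
    (((c1 * t + c2, X x, c3 * recip_deriv X x * u),
      (c3 * recip_deriv X x * ut / c1,
       c3 * recip_deriv X x * (deriv (recip_deriv X) x * u + recip_deriv X x * ux)),
      (c3 * recip_deriv X x * utt / c1\<^sup>2,
       c3 * recip_deriv X x * (deriv (recip_deriv X) x * ut + recip_deriv X x * utx) / c1,
       c3 * recip_deriv X x *
         (((deriv (recip_deriv X) x)\<^sup>2 + recip_deriv X x * deriv (deriv (recip_deriv X)) x) * u
          + 3 * recip_deriv X x * deriv (recip_deriv X) x * ux + (recip_deriv X x)\<^sup>2 * uxx))),
     (a / (c1 * (recip_deriv X x)\<^sup>2),
      b / (c1 * recip_deriv X x) + deriv (recip_deriv X) x * a / (c1 * (recip_deriv X x)\<^sup>2))))"

lemma deriv_recip_deriv: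
  assumes "smooth_on J X" "open J" "deriv X x \<noteq> 0" "x \<in> J"
  shows "deriv (recip_deriv X) x = - deriv (deriv X) x / (deriv X x)\<^sup>2"
  unfolding recip_deriv_def[abs_def]
  by (rule DERIV_imp_deriv)
    (use assms in \<open>auto intro!: derivative_eq_intros smooth_on_DERIV[OF smooth_on_deriv]
       simp: power2_eq_square\<close>)

text \<open>The new t depends on t alone and the new x on x alone, so the total Jacobian is c1 X'
  and the new total derivatives are D_t / c1 and m D_x. They are applied twice to c3 m u. The pair
  \<open>ab\<close> is arbitrary because the jet part of \<open>fp_explicit\<close> does not involve
  it.\<close>

lemma prolongation_fp:
  assumes "smooth_on J X" "open J" "\<And>x. x \<in> J \<Longrightarrow> deriv X x \<noteq> 0" "x \<in> J" "c1 \<noteq> 0"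
  shows "prolongation (\<lambda>(t, x, u). (c1 * t + c2, X x, c3 / deriv X x * u))
      ((t, x, u), (ut, ux), (utt, utx, uxx)) =
    fst (fp_explicit c1 c2 c3 X (((t, x, u), (ut, ux), (utt, utx, uxx)), ab))"
proof -
  define m where "m = recip_deriv X"
  let ?z = "((t, x, u), (ut, ux), (utt, utx, uxx)) :: jet"
  let ?S = "{z. jet_x z \<in> J}"
  define T where "T = (\<lambda>z::jet. c1 * fst (fst z) + c2)"
  define Y where "Y = (\<lambda>z::jet. X (fst (snd (fst z))))"
  define U where "U = (\<lambda>z::jet. c3 * m (fst (snd (fst z))) * snd (snd (fst z)))"
  have X: "deriv X (fst (snd (fst z))) \<noteq> 0" if "z \<in> ?S" for z :: jet
    using that assms by (auto simp: jet_coordinates)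
  have mX: "m (fst (snd (fst z))) = 1 / deriv X (fst (snd (fst z)))" for z :: jet
    by (simp add: m_def recip_deriv_def)
  have sm: "smooth_on J m" unfolding m_def by (rule smooth_on_recip_deriv) (use assms in auto)
  note sm1 = smooth_on_deriv[OF sm assms(2)]
  note ders = jet_fun_has_derivative[OF assms(1)] jet_fun_has_derivative[OF sm]
    jet_fun_has_derivative[OF sm1]
  note m0 = assms(4,5)
  have T: "total_t T z = c1" "total_x T z = 0" for z
    unfolding T_def by (insert m0, (rule total_tI total_xI, (rule derivative_intros | simp only: fst_conv snd_conv simp_thms m0)+)[1], simp add: dir_t_eq dir_x_eq )+
  have Y: "total_t Y z = 0" "total_x Y z = deriv X (fst (snd (fst z)))" if "z \<in> ?S" for z
    unfolding Y_def
    by (insert that[unfolded mem_Collect_eq jet_coordinates], (rule total_tI total_xI, (rule ders derivative_intros | assumption)+)[1], simp add: dir_t_eq dir_x_eq jet_coordinates)+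
  have U: "total_t U z = c3 * m (fst (snd (fst z))) * fst (fst (snd z))"
      "total_x U z = c3 * (deriv m (fst (snd (fst z))) * snd (snd (fst z)) + m (fst (snd (fst z))) * snd (fst (snd z)))"
      if "z \<in> ?S" for z
    unfolding U_def
    by (insert that[unfolded mem_Collect_eq jet_coordinates], (rule total_tI total_xI, (rule ders derivative_intros | assumption)+)[1], simp add: dir_t_eq dir_x_eq jet_coordinates algebra_simps)+
  have new: "new_total_t T Y F z = total_t F z / c1"
    "new_total_x T Y F z = m (fst (snd (fst z))) * total_x F z" if "z \<in> ?S" for F z
    unfolding new_total_t_def new_total_x_def total_jacobian_def
    using that X[OF that] assms(5) by (simp_all add: T Y mX)
  \<comment> \<open>Explicit forms of the new u_t and u_x on the whole open set \<open>?S\<close>,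
    so that they can replace the originals under one more total derivative.\<close>
  define Ut where "Ut = (\<lambda>z::jet. c3 * m (fst (snd (fst z))) * fst (fst (snd z)) / c1)"
  define Ux where "Ux = (\<lambda>z::jet. c3 * m (fst (snd (fst z))) * (deriv m (fst (snd (fst z))) * snd (snd (fst z)) + m (fst (snd (fst z))) * snd (fst (snd z))))"
  have Ut: "new_total_t T Y U z = Ut z" and Ux: "new_total_x T Y U z = Ux z" if "z \<in> ?S" for z
    using that by (simp_all add: new U Ut_def Ux_def)
  have z: "?z \<in> ?S" using assms(4) by simp
  note cong = total_cong_open[OF open_jet_x[OF assms(2)] z]
  have 1: "new_total_t T Y (new_total_t T Y U) ?z = total_t Ut ?z / c1"
    "new_total_x T Y (new_total_t T Y U) ?z = m x * total_x Ut ?z"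
    "new_total_x T Y (new_total_x T Y U) ?z = m x * total_x Ux ?z"
    using cong[of "new_total_t T Y U" Ut] cong[of "new_total_x T Y U" Ux] by (simp_all add: new[OF z] Ut Ux)
  have 2: "total_t Ut ?z = c3 * m x * utt / c1"
    "total_x Ut ?z = c3 * (deriv m x * ut + m x * utx) / c1"
    unfolding Ut_def
    by (insert m0, (rule total_tI total_xI, (rule ders derivative_intros | simp only: fst_conv snd_conv simp_thms m0)+)[1], simp add: dir_t_eq dir_x_eq algebra_simps divide_simps)+
  have 3: "total_x Ux ?z = c3 * (((deriv m x)\<^sup>2 + m x * deriv (deriv m) x) * u
          + 3 * m x * deriv m x * ux + (m x)\<^sup>2 * uxx)"
    unfolding Ux_def
    by (insert m0, (rule total_tI total_xI, (rule ders derivative_intros | simp only: fst_conv snd_conv simp_thms m0)+)[1], simp add: dir_t_eq dir_x_eq algebra_simps power2_eq_square)+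
  have fold: "(\<lambda>z. fst ((\<lambda>(t, x, u). (c1 * t + c2, X x, c3 / deriv X x * u)) (jet_base z))) = T"
    "(\<lambda>z. fst (snd ((\<lambda>(t, x, u). (c1 * t + c2, X x, c3 / deriv X x * u)) (jet_base z)))) = Y"
    "(\<lambda>z. snd (snd ((\<lambda>(t, x, u). (c1 * t + c2, X x, c3 / deriv X x * u)) (jet_base z)))) = U"
    by (auto simp: T_def Y_def U_def m_def recip_deriv_def)
  show ?thesis
    unfolding prolongation_def fold Let_def
    by (cases ab, simp add: 1 2 3 Ut[OF z] Ux[OF z])
      (simp add: fp_explicit_def m_def[symmetric] Ut_def Ux_def power2_eq_square, simp add: m_def recip_deriv_def)
qed

lemma fp_transformation_explicit:
  assumes "smooth_on J X" "open J" "\<And>x. x \<in> J \<Longrightarrow> deriv X x \<noteq> 0" "ext_x p \<in> J" "c1 \<noteq> 0"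
  shows "fp_transformation c1 c2 c3 X p = fp_explicit c1 c2 c3 X p"
proof -
  obtain t x u ut ux utt utx uxx a b where p: "p = (((t, x, u), (ut, ux), (utt, utx, uxx)), (a, b))"
    by (metis prod.collapse)
  have x: "x \<in> J" using assms(4) p by (simp add: ext_x_eq)
  show ?thesis
    using assms(3)[OF x] assms(5)
    unfolding p fp_transformation_def
    by (simp only: prod.case prolongation_fp[OF assms(1-3) x assms(5), where ab = "(a, b)"])
      (simp add: fp_explicit_def deriv_recip_deriv[OF assms(1,2) assms(3)[OF x] x] recip_deriv_def divide_simps power2_eq_square)
qed

section \<open>Transformations of the given form are equivalence transformations\<close>

text \<open>The coordinates t, x, u, u_t, u_x, u_tt, u_tx, u_xx, A, B on \<^typ>\<open>ext\<close>.\<close>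

abbreviation "pt p \<equiv> fst (fst (fst (p::ext)))"
abbreviation "px p \<equiv> fst (snd (fst (fst (p::ext))))"
abbreviation "pu p \<equiv> snd (snd (fst (fst (p::ext))))"
abbreviation "put p \<equiv> fst (fst (snd (fst (p::ext))))"
abbreviation "pux p \<equiv> snd (fst (snd (fst (p::ext))))"
abbreviation "putt p \<equiv> fst (snd (snd (fst (p::ext))))"
abbreviation "putx p \<equiv> fst (snd (snd (snd (fst (p::ext)))))"
abbreviation "puxx p \<equiv> snd (snd (snd (snd (fst (p::ext)))))"
abbreviation "pa p \<equiv> fst (snd (p::ext))"
abbreviation "pb p \<equiv> snd (snd (p::ext))"

lemma bounded_linear_coordinates:
  "bounded_linear (\<lambda>p. pt p)" "bounded_linear (\<lambda>p. px p)" "bounded_linear (\<lambda>p. pu p)"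
  "bounded_linear (\<lambda>p. put p)" "bounded_linear (\<lambda>p. pux p)"
  "bounded_linear (\<lambda>p. putt p)" "bounded_linear (\<lambda>p. putx p)" "bounded_linear (\<lambda>p. puxx p)"
  "bounded_linear (\<lambda>p. pa p)" "bounded_linear (\<lambda>p. pb p)"
  by (intro bounded_linear_intros)+

lemma ext_eqI:
  assumes "pt p = pt q" "px p = px q" "pu p = pu q" "put p = put q" "pux p = pux q"
    "putt p = putt q" "putx p = putx q" "puxx p = puxx q" "pa p = pa q" "pb p = pb q"
  shows "p = q"
  using assms by (intro prod_eqI) auto

lemma contact_plane_iff:
  "v \<in> contact_plane z \<longleftrightarrow>
     snd (snd (fst v)) = fst (fst (snd z)) * fst (fst v) + snd (fst (snd z)) * fst (snd (fst v)) \<and>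
     fst (fst (snd v)) = fst (snd (snd z)) * fst (fst v) + fst (snd (snd (snd z))) * fst (snd (fst v)) \<and>
     snd (fst (snd v)) = fst (snd (snd (snd z))) * fst (fst v) + snd (snd (snd (snd z))) * fst (snd (fst v))"
  by (cases z rule: jet_base.cases) (cases v rule: jet_base.cases, auto)

text \<open>Reads one coordinate of \<open>D v\<close> off a formula for the same coordinate of
  \<open>F\<close> that is valid near \<open>p\<close>; this is how coordinate identities on
  \<Omega> are differentiated.\<close>

lemma derivative_component:
  assumes "(F has_derivative D) (at p)" "bounded_linear L" "open S" "p \<in> S"
    "\<And>q. q \<in> S \<Longrightarrow> L (F q) = f q" "(f has_derivative D') (at p)"
  shows "L (D v) = D' v"
proof -
  have "((\<lambda>q. L (F q)) has_derivative (\<lambda>v. L (D v))) (at p)"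
    by (rule bounded_linear.has_derivative[OF assms(2,1)])
  then have "(f has_derivative (\<lambda>v. L (D v))) (at p)"
    by (rule has_derivative_transform_within_open[OF _ assms(3,4)]) (rule assms(5))
  from has_derivative_unique[OF this assms(6)] show ?thesis by (rule fun_cong)
qed

lemma open_ext_x:
  assumes "open \<Omega>" shows "open (ext_x ` \<Omega>)"
proof -
  have "ext_x ` \<Omega> = fst ` snd ` fst ` fst ` \<Omega>" by (force simp: ext_x_eq image_image)
  then show ?thesis by (simp add: assms open_image_fst open_image_snd)
qed

lemma fp_explicit_components:
  "pt (fp_explicit c1 c2 c3 X p) = c1 * pt p + c2"
  "px (fp_explicit c1 c2 c3 X p) = X (px p)"
  "pu (fp_explicit c1 c2 c3 X p) = c3 * recip_deriv X (px p) * pu p"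
  "put (fp_explicit c1 c2 c3 X p) = c3 * recip_deriv X (px p) * put p / c1"
  "pux (fp_explicit c1 c2 c3 X p) = c3 * recip_deriv X (px p) *
     (deriv (recip_deriv X) (px p) * pu p + recip_deriv X (px p) * pux p)"
  "putt (fp_explicit c1 c2 c3 X p) = c3 * recip_deriv X (px p) * putt p / c1\<^sup>2"
  "putx (fp_explicit c1 c2 c3 X p) = c3 * recip_deriv X (px p) *
     (deriv (recip_deriv X) (px p) * put p + recip_deriv X (px p) * putx p) / c1"
  "puxx (fp_explicit c1 c2 c3 X p) = c3 * recip_deriv X (px p) *
     (((deriv (recip_deriv X) (px p))\<^sup>2 + recip_deriv X (px p) * deriv (deriv (recip_deriv X)) (px p)) * pu p
      + 3 * recip_deriv X (px p) * deriv (recip_deriv X) (px p) * pux p + (recip_deriv X (px p))\<^sup>2 * puxx p)"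
  "pa (fp_explicit c1 c2 c3 X p) = pa p / (c1 * (recip_deriv X (px p))\<^sup>2)"
  "pb (fp_explicit c1 c2 c3 X p) = pb p / (c1 * recip_deriv X (px p))
     + deriv (recip_deriv X) (px p) * pa p / (c1 * (recip_deriv X (px p))\<^sup>2)"
  by (simp_all add: fp_explicit_def split: prod.split)

lemma fp_explicit_base:
  "fst (fst (fp_explicit c1 c2 c3 X p)) = (c1 * pt p + c2, X (px p), c3 * recip_deriv X (px p) * pu p)"
  by (simp add: fp_explicit_def split: prod.split)

lemma fp_explicit_fst: "fst (fp_explicit c1 c2 c3 X (z, ab)) = fst (fp_explicit c1 c2 c3 X (z, ab'))"
  by (simp add: fp_explicit_def split: prod.split)

lemma smooth_on_fp_explicit:
  assumes "smooth_on J X" "open J" "\<And>x. x \<in> J \<Longrightarrow> deriv X x \<noteq> 0" "c1 \<noteq> 0"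
    "open D" "ext_x ` D \<subseteq> J"
  shows "smooth_on D (fp_explicit c1 c2 c3 X)"
proof -
  note sm = smooth_on_recip_deriv[OF assms(1-3)]
  have m: "recip_deriv X (px p) \<noteq> 0" if "p \<in> D" for p
    using assms(3)[of "px p"] assms(6) that by (auto simp: recip_deriv_def ext_x_eq)
  have comp: "smooth_on D (\<lambda>p. f (px p))" if "smooth_on J f" for f :: "real \<Rightarrow> real"
    by (rule smooth_on_compose[OF that]) (use assms in \<open>auto intro!: smooth_on_intros simp: ext_x_eq image_subset_iff\<close>)
  have c: "smooth_on D (\<lambda>p. X (px p))" "smooth_on D (\<lambda>p. recip_deriv X (px p))"
    "smooth_on D (\<lambda>p. deriv (recip_deriv X) (px p))"
    "smooth_on D (\<lambda>p. deriv (deriv (recip_deriv X)) (px p))"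
    using comp[OF assms(1)] comp[OF sm] comp[OF smooth_on_deriv[OF sm assms(2)]]
      comp[OF smooth_on_deriv[OF smooth_on_deriv[OF sm assms(2)] assms(2)]] by simp_all
  show ?thesis
    unfolding fp_explicit_def case_prod_unfold
    by (intro smooth_on_intros c assms(5)) (use m assms(4) in auto)
qed

lemma deriv_cong_open:
  assumes "open S" "x \<in> S" "\<And>y. y \<in> S \<Longrightarrow> f y = g y"
  shows "deriv f x = deriv g x"
  by (rule deriv_cong_ev, unfold eventually_nhds) (use assms in blast)+

text \<open>Membership in a contact plane restricts only the t, x, u, u_t and u_x components of a
  vector, so exactly these five components of the derivative are computed.\<close>

lemma fp_explicit_preserves_contact:
  assumes "smooth_on J X" "open J" "\<And>x. x \<in> J \<Longrightarrow> deriv X x \<noteq> 0" "c1 \<noteq> 0"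
    "open D" "ext_x ` D \<subseteq> J" "\<And>p. p \<in> D \<Longrightarrow> \<Phi> p = fp_explicit c1 c2 c3 X p"
  shows "preserves_contact D \<Phi>"
  unfolding preserves_contact_def
proof (intro ballI allI impI)
  fix p v :: ext assume p: "p \<in> D" and v: "fst v \<in> contact_plane (fst p)"
  define m where "m = recip_deriv X"
  have xJ: "px p \<in> J" using p assms(6) by (auto simp: ext_x_eq)
  have sm: "smooth_on J m" unfolding m_def by (rule smooth_on_recip_deriv[OF assms(1-3)])
  have dX: "deriv X (px p) = 1 / m (px p)" and m0: "m (px p) \<noteq> 0"
    using assms(3)[OF xJ] by (simp_all add: m_def recip_deriv_def)
  let ?D = "frechet_derivative \<Phi> (at p)"
  have "smooth_on D \<Phi>"
    by (rule smooth_on_cong[OF smooth_on_fp_explicit[OF assms(1-6), of c2 c3] assms(5)])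
      (assumption | rule assms(7)[symmetric])+
  then have D: "(\<Phi> has_derivative ?D) (at p)" using p by (rule smooth_on_has_derivative)
  have der: "((\<lambda>q. f (px q)) has_derivative (\<lambda>v. deriv f (px p) * px v)) (at p)"
    if "smooth_on J f" for f :: "real \<Rightarrow> real"
    by (rule smooth_on_deriv_has_derivative[OF that]) (auto intro!: derivative_intros xJ)
  note ders = der[OF assms(1)] der[OF sm] der[OF smooth_on_deriv[OF sm assms(2)]]
  note comp = derivative_component[OF D _ assms(5) p]
  note eq = assms(7) fp_explicit_components m_def[symmetric]
  have t: "pt (?D v) = c1 * pt v"
    by (rule trans[OF comp[OF bounded_linear_coordinates(1), of "\<lambda>p. c1 * pt p + c2"]], simp add: eq,
      (rule derivative_intros ders)+) simp
  have x: "px (?D v) = deriv X (px p) * px v"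
    by (rule trans[OF comp[OF bounded_linear_coordinates(2), of "\<lambda>p. X (px p)"]], simp add: eq,
      (rule derivative_intros ders)+) simp
  have u: "pu (?D v) = c3 * (deriv m (px p) * px v * pu p + m (px p) * pu v)"
    by (rule trans[OF comp[OF bounded_linear_coordinates(3), of "\<lambda>p. c3 * m (px p) * pu p"]], simp add: eq,
      (rule ders derivative_intros)+) (simp add: algebra_simps)
  have ut: "put (?D v) = c3 * (deriv m (px p) * px v * put p + m (px p) * put v) / c1"
    by (rule trans[OF comp[OF bounded_linear_coordinates(4), of "\<lambda>p. (c3 / c1) * m (px p) * put p"]], simp add: eq,
      (rule ders derivative_intros)+) (simp add: algebra_simps add_divide_distrib)
  have ux: "pux (?D v) = c3 * (((deriv m (px p))\<^sup>2 + m (px p) * deriv (deriv m) (px p)) * px v * pu p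
      + m (px p) * deriv m (px p) * pu v + 2 * m (px p) * deriv m (px p) * px v * pux p + (m (px p))\<^sup>2 * pux v)"
    by (rule trans[OF comp[OF bounded_linear_coordinates(5),
        of "\<lambda>p. c3 * m (px p) * (deriv m (px p) * pu p + m (px p) * pux p)"]], simp add: eq,
      (rule ders derivative_intros)+) (simp add: algebra_simps power2_eq_square)
  show "fst (?D v) \<in> contact_plane (fst (\<Phi> p))"
    using v unfolding contact_plane_iff t x u ut ux assms(7)[OF p] fp_explicit_components m_def[symmetric]
    using assms(4) m0 by (simp add: dX divide_simps) (simp add: algebra_simps power2_eq_square)
qed

text \<open>The new coefficients live on the image under X of I \<inter> J and are the expected
  expressions in x composed with the inverse of X. The right-hand side of the new equation is c3 m /
  c1 times the old one. This nonzero factor is also the one that u_t acquires, so the two equations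
  hold at corresponding jets simultaneously.\<close>

lemma fp_explicit_maps_class:
  assumes "smooth_on J X" "open J" "\<And>x. x \<in> J \<Longrightarrow> deriv X x \<noteq> 0" "inj_on X J" "open (X ` J)"
    "c1 \<noteq> 0" "c3 \<noteq> 0" "ext_x ` D \<subseteq> J" "\<And>p. p \<in> D \<Longrightarrow> \<Phi> p = fp_explicit c1 c2 c3 X p"
  shows "maps_class D \<Phi>"
  unfolding maps_class_def
proof (intro allI impI)
  fix I A B assume "arbitrary_elements I A B"
  then have I: "open I" "smooth_on I A" "smooth_on I B" "\<And>x. x \<in> I \<Longrightarrow> A x \<noteq> 0"
    by (auto simp: arbitrary_elements_def)
  define m where "m = recip_deriv X"
  define G where "G = inv_into J X"
  define K where "K = I \<inter> J"
  have K: "open K" "K \<subseteq> J" "K \<subseteq> I" using I assms(2) by (auto simp: K_def)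
  have G: "G (X x) = x" if "x \<in> K" for x
    unfolding G_def using assms(4) that K by (auto intro: inv_into_f_f)
  have smJ: "smooth_on J m" unfolding m_def by (rule smooth_on_recip_deriv[OF assms(1-3)])
  note sm = smooth_on_subset[OF smJ K(2)]
  note sm1 = smooth_on_deriv[OF sm K(1)]
  have m0: "m x \<noteq> 0" "inverse (deriv X x) = m x" if "x \<in> K" for x
    using assms(3)[of x] that K by (auto simp: m_def recip_deriv_def inverse_eq_divide)
  have XK: "open (X ` K)"
    by (rule invariance_of_domain) (use smooth_on_continuous[OF assms(1)] assms(4) K
        in \<open>auto intro: continuous_on_subset inj_on_subset\<close>)
  have smG: "smooth_on (X ` K) G"
    and dG: "\<And>x. x \<in> K \<Longrightarrow> (G has_real_derivative m x) (at (X x))"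
    using smooth_on_inverse_function[OF smooth_on_subset[OF assms(1) K(2)] K(1) XK G] assms(3) K m0
    by auto
  \<comment> \<open>Differentiation in the new variable acts on functions of the old one as m d/dx;
    \<open>ddFG\<close> is its second power.\<close>
  have dFG: "deriv (\<lambda>y. F (G y)) (X x) = deriv F x * m x" if "smooth_on K F" "x \<in> K" for F :: "real \<Rightarrow> real" and x
    by (rule DERIV_imp_deriv)
      (use DERIV_chain2[of F "deriv F x" G "X x" "m x"] smooth_on_DERIV[OF that] dG[OF that(2)] G[OF that(2)] in simp)
  have ddFG: "deriv (deriv (\<lambda>y. F (G y))) (X x) = (deriv (deriv F) x * m x + deriv F x * deriv m x) * m x"
    if F: "smooth_on K F" and x: "x \<in> K" for F :: "real \<Rightarrow> real" and x
  proof -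
    have "deriv (deriv (\<lambda>y. F (G y))) (X x) = deriv (\<lambda>y. (\<lambda>x. deriv F x * m x) (G y)) (X x)"
      by (rule deriv_cong_open[OF XK]) (use x dFG[OF F] G in auto)
    also have "\<dots> = deriv (\<lambda>x. deriv F x * m x) x * m x"
      by (rule dFG) (intro smooth_on_intros smooth_on_deriv F sm K x)+
    also have "deriv (\<lambda>x. deriv F x * m x) x = deriv (deriv F) x * m x + deriv F x * deriv m x"
      by (rule DERIV_imp_deriv, (rule derivative_eq_intros smooth_on_DERIV[OF sm x]
        smooth_on_DERIV[OF smooth_on_deriv[OF F K(1)] x] refl)+) (simp add: algebra_simps)
    finally show ?thesis .
  qed
  define A1 where "A1 = (\<lambda>x. A x / (c1 * (m x)\<^sup>2))"
  define B1 where "B1 = (\<lambda>x. B x / (c1 * m x) + deriv m x * A x / (c1 * (m x)\<^sup>2))"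
  note smA = smooth_on_subset[OF I(2) K(3)] and smB = smooth_on_subset[OF I(3) K(3)]
  have smA1: "smooth_on K A1" and smB1: "smooth_on K B1"
    unfolding A1_def B1_def
    by (intro smooth_on_intros smA smB sm sm1 K; use m0 assms(6) in simp)+
  have dA1: "deriv A1 x = deriv A x / (c1 * (m x)\<^sup>2) - 2 * A x * deriv m x / (c1 * (m x) ^ 3)" if x: "x \<in> K" for x
    unfolding A1_def
    by (rule DERIV_imp_deriv, (rule derivative_eq_intros smooth_on_DERIV[OF sm x] smooth_on_DERIV[OF smA x] refl)+)
      (use m0[OF x] assms(6) in \<open>auto simp: divide_simps power2_eq_square power3_eq_cube algebra_simps\<close>)
  have ddA1: "deriv (deriv A1) x = deriv (deriv A) x / (c1 * (m x)\<^sup>2) - 4 * deriv A x * deriv m x / (c1 * (m x) ^ 3)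
      - 2 * A x * deriv (deriv m) x / (c1 * (m x) ^ 3) + 6 * A x * (deriv m x)\<^sup>2 / (c1 * (m x) ^ 4)" if x: "x \<in> K" for x
  proof -
    have "deriv (deriv A1) x = deriv (\<lambda>x. deriv A x / (c1 * (m x)\<^sup>2) - 2 * A x * deriv m x / (c1 * (m x) ^ 3)) x"
      by (rule deriv_cong_open[OF K(1) x]) (rule dA1)
    also have "\<dots> = deriv (deriv A) x / (c1 * (m x)\<^sup>2) - 4 * deriv A x * deriv m x / (c1 * (m x) ^ 3)
      - 2 * A x * deriv (deriv m) x / (c1 * (m x) ^ 3) + 6 * A x * (deriv m x)\<^sup>2 / (c1 * (m x) ^ 4)"
      by (rule DERIV_imp_deriv, (rule derivative_eq_intros smooth_on_DERIV[OF sm x] smooth_on_DERIV[OF smA x]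
          smooth_on_DERIV[OF smooth_on_deriv[OF smA K(1)] x] smooth_on_DERIV[OF sm1 x] refl
          | (use m0(1)[OF x] assms(6) in \<open>simp; fail\<close>))+)
        (use m0[OF x] assms(6) in \<open>auto simp: divide_simps power2_eq_square power3_eq_cube power4_eq_xxxx algebra_simps\<close>)
    finally show ?thesis .
  qed
  have dB1: "deriv B1 x = deriv B x / (c1 * m x) - B x * deriv m x / (c1 * (m x)\<^sup>2)
      + (deriv (deriv m) x * A x + deriv m x * deriv A x) / (c1 * (m x)\<^sup>2)
      - 2 * (deriv m x)\<^sup>2 * A x / (c1 * (m x) ^ 3)" if x: "x \<in> K" for x
    unfolding B1_def
    by (rule DERIV_imp_deriv, (rule derivative_eq_intros smooth_on_DERIV[OF sm x] smooth_on_DERIV[OF smA x]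
        smooth_on_DERIV[OF smB x] smooth_on_DERIV[OF sm1 x] refl
        | (use m0(1)[OF x] assms(6) in \<open>simp; fail\<close>))+)
      (use m0[OF x] assms(6) in \<open>auto simp: divide_simps power2_eq_square power3_eq_cube power4_eq_xxxx algebra_simps\<close>)
  define A' B' where "A' = (\<lambda>y. A1 (G y))" and "B' = (\<lambda>y. B1 (G y))"
  have smA': "smooth_on (X ` K) A'" and smB': "smooth_on (X ` K) B'"
    unfolding A'_def B'_def by (rule smooth_on_compose[OF _ smG XK K(1)]; use smA1 smB1 G in force)+
  show "\<exists>I' A' B'. arbitrary_elements I' A' B' \<and>
           (\<forall>z z' a' b'.
              jet_x z \<in> I \<and> (z, A (jet_x z), B (jet_x z)) \<in> D \<and>
              \<Phi> (z, A (jet_x z), B (jet_x z)) = (z', a', b') \<longrightarrow>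
                jet_x z' \<in> I' \<and> a' = A' (jet_x z') \<and> b' = B' (jet_x z') \<and>
                (z \<in> fokker_planck I A B \<longleftrightarrow> z' \<in> fokker_planck I' A' B'))"
  proof (intro exI conjI allI impI)
    show "arbitrary_elements (X ` K) A' B'"
      unfolding arbitrary_elements_def using XK smA' smB' I(4) K m0 assms(6) G
      by (auto simp: A'_def A1_def)
    fix z z' a' b'
    assume asm: "jet_x z \<in> I \<and> (z, A (jet_x z), B (jet_x z)) \<in> D \<and>
              \<Phi> (z, A (jet_x z), B (jet_x z)) = (z', a', b')"
    obtain t x u ut ux utt utx uxx where z: "z = ((t, x, u), (ut, ux), (utt, utx, uxx))"
      by (cases z rule: jet_base.cases)
    have x: "x \<in> K" using asm assms(8) z by (force simp: K_def ext_x_def)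
    have eq: "(z', a', b') = fp_explicit c1 c2 c3 X (z, A x, B x)" using asm assms(9) z by fastforce
    then have z': "z' = ((c1 * t + c2, X x, c3 * m x * u), (c3 * m x * ut / c1, c3 * m x * (deriv m x * u + m x * ux)),
      (c3 * m x * utt / c1\<^sup>2, c3 * m x * (deriv m x * ut + m x * utx) / c1,
       c3 * m x * (((deriv m x)\<^sup>2 + m x * deriv (deriv m) x) * u + 3 * m x * deriv m x * ux + (m x)\<^sup>2 * uxx)))"
      and ab': "a' = A1 x" "b' = B1 x"
      by (simp_all add: z fp_explicit_def A1_def B1_def m_def)
    show "jet_x z' \<in> X ` K" "a' = A' (jet_x z')" "b' = B' (jet_x z')"
      using x G[OF x] ab' by (auto simp: z' A'_def B'_def)
    have F: "A' (X x) = A1 x" "B' (X x) = B1 x" "deriv A' (X x) = deriv A1 x * m x" "deriv B' (X x) = deriv B1 x * m x"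
      "deriv (deriv A') (X x) = (deriv (deriv A1) x * m x + deriv A1 x * deriv m x) * m x"
      using dFG[OF _ x] ddFG[OF _ x] smA1 smB1 G[OF x] by (auto simp: A'_def B'_def)
    \<comment> \<open>A single name for the common denominator turns the identity \<open>E\<close>
      below into a polynomial identity.\<close>
    define k where "k = 1 / (c1 * (m x)\<^sup>2)"
    have k: "r / (c1 * (m x)\<^sup>2) = r * k" for r by (simp add: k_def)
    have "deriv A' (X x) = (deriv A x * m x - 2 * A x * deriv m x) / (c1 * (m x)\<^sup>2)"
      "deriv (deriv A') (X x) = (deriv (deriv A) x * (m x)\<^sup>2 - 3 * deriv A x * deriv m x * m x
         - 2 * A x * deriv (deriv m) x * m x + 4 * A x * (deriv m x)\<^sup>2) / (c1 * (m x)\<^sup>2)"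
      "deriv B' (X x) = (deriv B x * (m x)\<^sup>2 - B x * deriv m x * m x + deriv (deriv m) x * A x * m x
         + deriv m x * deriv A x * m x - 2 * (deriv m x)\<^sup>2 * A x) / (c1 * (m x)\<^sup>2)"
      "A' (X x) = A x / (c1 * (m x)\<^sup>2)" "B' (X x) = (B x * m x + deriv m x * A x) / (c1 * (m x)\<^sup>2)"
      and c3k: "c3 * m x / c1 = c3 * (m x) ^ 3 / (c1 * (m x)\<^sup>2)"
      unfolding F dA1[OF x] ddA1[OF x] dB1[OF x] unfolding A1_def B1_def
      using m0(1)[OF x] assms(6)
      by (simp_all add: divide_simps power2_eq_square power3_eq_cube power4_eq_xxxx)
        (simp_all add: algebra_simps)
    note F' = this[unfolded k]
    have E: "deriv (deriv A') (X x) * (c3 * m x * u) + 2 * deriv A' (X x) * (c3 * m x * (deriv m x * u + m x * ux)) +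
       A' (X x) * (c3 * m x * (((deriv m x)\<^sup>2 + m x * deriv (deriv m) x) * u + 3 * m x * deriv m x * ux + (m x)\<^sup>2 * uxx)) +
       (deriv B' (X x) * (c3 * m x * u) + B' (X x) * (c3 * m x * (deriv m x * u + m x * ux)))
      = c3 * m x / c1 * (deriv (deriv A) x * u + 2 * deriv A x * ux + A x * uxx + (deriv B x * u + B x * ux))"
      unfolding F' by (simp add: algebra_simps power2_eq_square power3_eq_cube)
    have "z' \<in> fokker_planck (X ` K) A' B' \<longleftrightarrow>
      c3 * m x / c1 * ut = c3 * m x / c1 * (deriv (deriv A) x * u + 2 * deriv A x * ux + A x * uxx + (deriv B x * u + B x * ux))"
      unfolding z' by (subst fokker_planck_iff[OF XK smA' smB']) (use x E in auto)
    then show "z \<in> fokker_planck I A B \<longleftrightarrow> z' \<in> fokker_planck (X ` K) A' B'"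
      unfolding z using fokker_planck_iff[OF I(1-3)] x K(3) m0(1)[OF x] assms(6,7) by auto
  qed
qed

text \<open>Rolle's theorem between two points with equal values; convexity puts the segment between
  them inside \<open>J\<close>.\<close>

lemma inj_on_nonzero_deriv:
  fixes X :: "real \<Rightarrow> real"
  assumes "smooth_on J X" "convex J" "\<And>x. x \<in> J \<Longrightarrow> deriv X x \<noteq> 0"
  shows "inj_on X J"
proof -
  have *: "X a \<noteq> X b" if "a \<in> J" "b \<in> J" "a < b" for a b
  proof
    assume eq: "X a = X b"
    have ab: "{a..b} \<subseteq> J"
      using assms(2) that by (metis atLeastatMost_subset_iff closed_segment_eq_real_ivl
          convex_contains_segment less_eq_real_def)
    have "\<exists>z. a < z \<and> z < b \<and> (*) (deriv X z) = (\<lambda>v. 0)"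
    proof (rule Rolle_deriv[OF that(3) eq])
      show "continuous_on {a..b} X" using smooth_on_continuous[OF assms(1)] ab continuous_on_subset by blast
      show "(X has_derivative (*) (deriv X x)) (at x)" if "a < x" "x < b" for x
      proof -
        have "x \<in> J" using ab that by auto
        from smooth_on_DERIV[OF assms(1) this] show ?thesis by (simp add: has_field_derivative_def)
      qed
    qed
    then obtain z where "a < z" "z < b" "deriv X z * 1 = 0" by metis
    moreover from this have "z \<in> J" using ab by auto
    ultimately show False using assms(3)[of z] by simp
  qed
  then show ?thesis by (metis inj_onI linorder_neqE)
qed

text \<open>Solving for the old t and u dictates the constants 1/c1, -c2/c1 and 1/c3, and the
  function of the inverse transformation is \<open>G\<close>. If n is the reciprocal derivative of
  \<open>G\<close>, then n at X x is 1/m, and its derivatives follow from d/dy = m d/dx.\<close>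

lemma fp_explicit_inverse:
  assumes "smooth_on J X" "open J" "\<And>x. x \<in> J \<Longrightarrow> deriv X x \<noteq> 0" "open (X ` J)"
    "\<And>x. x \<in> J \<Longrightarrow> G (X x) = x" "c1 \<noteq> 0" "c3 \<noteq> 0" "ext_x p \<in> J"
  shows "fp_explicit (1 / c1) (- c2 / c1) (1 / c3) G (fp_explicit c1 c2 c3 X p) = p"
proof -
  define m where "m = recip_deriv X"
  define n where "n = recip_deriv G"
  have sm: "smooth_on J m" unfolding m_def by (rule smooth_on_recip_deriv[OF assms(1-3)])
  have m0: "m x \<noteq> 0" "deriv X x = 1 / m x" if "x \<in> J" for x
    using assms(3)[OF that] by (simp_all add: m_def recip_deriv_def)
  have dGm: "(G has_real_derivative m x) (at (X x))" if "x \<in> J" for x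
    using smooth_on_inverse_function(2)[OF assms(1,2,4,5,3) that] m0[OF that] by simp
  have n: "n (X x) = 1 / m x" if "x \<in> J" for x
    using DERIV_imp_deriv[OF dGm[OF that]] by (simp add: n_def recip_deriv_def)
  have dfG: "((\<lambda>y. f (G y)) has_real_derivative deriv f x * m x) (at (X x))"
    if "smooth_on J f" "x \<in> J" for f :: "real \<Rightarrow> real" and x
    using DERIV_chain2[of f "deriv f x" G "X x" "m x"] smooth_on_DERIV[OF that] dGm[OF that(2)] assms(5)[OF that(2)]
    by simp
  have n1: "deriv n (X x) = - deriv m x / m x" if x: "x \<in> J" for x
  proof -
    have "deriv n (X x) = deriv (\<lambda>y. 1 / m (G y)) (X x)"
      by (rule deriv_cong_open[OF assms(4)]) (use x n assms(5) in auto)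
    also have "\<dots> = - deriv m x / m x"
      by (rule DERIV_imp_deriv, (rule derivative_eq_intros refl
            dfG[OF sm x])+)
        (use m0[OF x] x assms(5) in \<open>auto simp: divide_simps power2_eq_square\<close>)
    finally show ?thesis .
  qed
  have n2: "deriv (deriv n) (X x) = (deriv m x)\<^sup>2 / m x - deriv (deriv m) x" if x: "x \<in> J" for x
  proof -
    have "deriv (deriv n) (X x) = deriv (\<lambda>y. - deriv m (G y) / m (G y)) (X x)"
      by (rule deriv_cong_open[OF assms(4)]) (use x n1 assms(5) in auto)
    also have "\<dots> = (deriv m x)\<^sup>2 / m x - deriv (deriv m) x"
      by (rule DERIV_imp_deriv, (rule derivative_eq_intros refl
            dfG[OF sm x]
            dfG[OF smooth_on_deriv[OF sm assms(2)] x])+)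
        (use m0[OF x] x assms(5) in \<open>auto simp: divide_simps power2_eq_square algebra_simps\<close>)
    finally show ?thesis .
  qed
  have x: "px p \<in> J" using assms(8) by (simp add: ext_x_eq)
  show ?thesis
    by (rule ext_eqI; unfold fp_explicit_components n_def[symmetric] m_def[symmetric] assms(5)[OF x] n[OF x] n1[OF x] n2[OF x];
        use m0(1)[OF x] assms(6,7) in \<open>simp add: divide_simps\<close>;
        (simp add: algebra_simps power2_eq_square)?)
qed

text \<open>Convexity of the base makes its projection to x an interval, on which X is injective.
  This gives a smooth inverse of the same form and lets the new coefficients be functions of X
  x.\<close>

lemma fp_form_imp_equivalence:
  assumes "open \<Omega>" "\<Omega> \<subseteq> ext_space" "convex (ext_base ` \<Omega>)" "has_fp_form \<Omega> \<Phi>"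
  shows "equivalence_transformation \<Omega> \<Phi>"
proof -
  define J where "J = ext_x ` \<Omega>"
  obtain c1 c2 c3 X where c: "c1 \<noteq> 0" "c3 \<noteq> 0" and X: "smooth_on J X" "\<And>x. x \<in> J \<Longrightarrow> deriv X x \<noteq> 0"
    and \<Phi>: "\<And>p. p \<in> \<Omega> \<Longrightarrow> \<Phi> p = fp_transformation c1 c2 c3 X p"
    using assms(4) unfolding has_fp_form_def J_def by (metis mult_eq_0_iff)
  have J: "open J" unfolding J_def by (rule open_ext_x) fact
  have \<Omega>J: "ext_x ` \<Omega> \<subseteq> J" by (simp add: J_def)
  have J': "ext_x p \<in> J" "px p \<in> J" if "p \<in> \<Omega>" for p using that by (auto simp: J_def ext_x_eq)
  have "J = (\<lambda>q. fst (snd q)) ` (ext_base ` \<Omega>)" by (simp add: J_def image_image ext_x_eq ext_base_eq)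
  moreover have "bounded_linear (\<lambda>q::base. fst (snd q))" by (intro bounded_linear_intros)
  ultimately have conv: "convex J"
    using assms(3) by (simp add: convex_linear_image bounded_linear.linear)
  have inj: "inj_on X J" by (rule inj_on_nonzero_deriv[OF X(1) conv X(2)])
  have XJ: "open (X ` J)" by (rule invariance_of_domain[OF smooth_on_continuous[OF X(1)] J inj])
  define G where "G = inv_into J X"
  have G: "G (X x) = x" if "x \<in> J" for x unfolding G_def using inj that by simp
  have ex: "\<Phi> p = fp_explicit c1 c2 c3 X p" if "p \<in> \<Omega>" for p
    using \<Phi>[OF that] fp_transformation_explicit[OF X(1) J X(2) J'(1)[OF that] c(1)] by simp
  define \<Psi> where "\<Psi> = fp_explicit (1 / c1) (- c2 / c1) (1 / c3) G"
  have inv: "\<Psi> (\<Phi> p) = p" if "p \<in> \<Omega>" for p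
    unfolding \<Psi>_def ex[OF that] using fp_explicit_inverse[OF X(1) J X(2) XJ G c J'(1)[OF that]] by simp
  have sm: "smooth_on \<Omega> \<Phi>"
    by (rule smooth_on_cong[OF smooth_on_fp_explicit[OF X(1) J X(2) c(1) assms(1) \<Omega>J, of c2 c3] assms(1)])
      (assumption | rule ex[symmetric])+
  have op: "open (\<Phi> ` \<Omega>)"
    by (rule invariance_of_domain[OF smooth_on_continuous[OF sm] assms(1)]) (metis inv inj_onI)
  have smG: "smooth_on (X ` J) G" and dG: "deriv G y \<noteq> 0" if "y \<in> X ` J" for y
    using smooth_on_inverse_function[OF X(1) J XJ G X(2)] X(2) that DERIV_imp_deriv by force+
  have diffeo: "diffeomorphism_on \<Omega> \<Phi>"
    unfolding diffeomorphism_on_def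
  proof (intro conjI exI[of _ \<Psi>] ballI assms(1) op sm inv)
    show "smooth_on (\<Phi> ` \<Omega>) \<Psi>"
      unfolding \<Psi>_def
    proof (rule smooth_on_fp_explicit[OF _ XJ])
      show "smooth_on (X ` J) G" using smooth_on_inverse_function(1)[OF X(1) J XJ G X(2)] by simp
      show "ext_x ` \<Phi> ` \<Omega> \<subseteq> X ` J"
        using J' by (auto simp: ex ext_x_eq fp_explicit_components)
    qed (use dG c op in auto)
  qed
  have "projectable \<Omega> \<Phi>"
    unfolding projectable_def ext_base_eq
  proof
    show "\<exists>\<phi>. \<forall>p\<in>\<Omega>. fst (fst (\<Phi> p)) = \<phi> (fst (fst p))"
      by (rule exI[of _ "\<lambda>q. (c1 * fst q + c2, X (fst (snd q)), c3 * recip_deriv X (fst (snd q)) * snd (snd q))"])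
        (simp add: ex fp_explicit_base)
    \<comment> \<open>The jet part of the explicit form ignores A and B, so a dummy value 0 for both
      defines \<psi>.\<close>
    show "\<exists>\<psi>. \<forall>p\<in>\<Omega>. fst (\<Phi> p) = \<psi> (fst p)"
      using ex fp_explicit_fst[of c1 c2 c3 X _ _ 0]
      by (intro exI[of _ "\<lambda>z. fst (fp_explicit c1 c2 c3 X (z, 0))"]) (metis prod.collapse)
  qed
  moreover have "\<Phi> ` \<Omega> \<subseteq> ext_space"
  proof (rule image_subsetI)
    fix p assume p: "p \<in> \<Omega>"
    then have "pa p \<noteq> 0" using assms(2) by (auto simp: ext_space_def)
    then have "pa (\<Phi> p) \<noteq> 0"
      using c X(2)[OF J'(2)[OF p]] by (simp add: ex[OF p] fp_explicit_components recip_deriv_def)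
    then show "\<Phi> p \<in> ext_space" by (simp add: ext_space_def case_prod_unfold)
  qed
  moreover have "preserves_contact \<Omega> \<Phi>"
    by (rule fp_explicit_preserves_contact[OF X(1) J X(2) c(1) assms(1) \<Omega>J ex])
  moreover have "maps_class \<Omega> \<Phi>"
    by (rule fp_explicit_maps_class[OF X(1) J X(2) inj XJ c \<Omega>J ex])
  ultimately show ?thesis
    using assms(2) diffeo by (simp add: equivalence_transformation_def)
qed

section \<open>Equivalence transformations over a convex base\<close>

lemma has_derivative_along_line:
  fixes F :: "'a::real_normed_vector \<Rightarrow> real"
  assumes "(F has_derivative D) (at (p + s *\<^sub>R v))"
  shows "((\<lambda>s. F (p + s *\<^sub>R v)) has_real_derivative D v) (at s)"
proof -
  have "((\<lambda>s. p + s *\<^sub>R v) has_derivative (\<lambda>h. h *\<^sub>R v)) (at s)"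
    by (auto intro!: derivative_eq_intros)
  from has_derivative_compose[OF this assms]
  show ?thesis
    unfolding has_field_derivative_def
    by (rule has_derivative_eq_rhs)
      (simp add: fun_eq_iff linear_cmul[OF has_derivative_linear[OF assms]])
qed

lemma open_line:
  fixes p v :: "'a::real_normed_vector"
  assumes "open S" "p \<in> S"
  obtains \<epsilon> where "\<epsilon> > 0" "\<And>s. \<bar>s\<bar> < \<epsilon> \<Longrightarrow> p + s *\<^sub>R v \<in> S"
proof -
  have "continuous_on UNIV (\<lambda>s::real. p + s *\<^sub>R v)" by (intro continuous_intros)
  then have "open ((\<lambda>s::real. p + s *\<^sub>R v) -` S)" by (rule open_vimage[OF assms(1)])
  moreover have "0 \<in> (\<lambda>s::real. p + s *\<^sub>R v) -` S" using assms(2) by simp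
  ultimately obtain \<epsilon> where "\<epsilon> > 0" "ball 0 \<epsilon> \<subseteq> (\<lambda>s::real. p + s *\<^sub>R v) -` S"
    using open_contains_ball by blast
  then show thesis by (intro that[of \<epsilon>]) (auto simp: subset_iff dist_norm)
qed

lemma constant_on_line:
  fixes F :: "'a::real_normed_vector \<Rightarrow> real"
  assumes "\<And>s. 0 \<le> s \<Longrightarrow> s \<le> 1 \<Longrightarrow> \<exists>D. (F has_derivative D) (at (p + s *\<^sub>R v)) \<and> D v = 0"
  shows "F (p + v) = F p"
proof -
  have d: "((\<lambda>s. F (p + s *\<^sub>R v)) has_real_derivative 0) (at s)" if "0 \<le> s" "s \<le> 1" for s
    using assms[OF that] has_derivative_along_line by metis
  have "F (p + 1 *\<^sub>R v) = F (p + 0 *\<^sub>R v)"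
    by (rule DERIV_isconst_end[where f = "\<lambda>s. F (p + s *\<^sub>R v)"])
      (auto intro!: continuous_at_imp_continuous_on DERIV_isCont[OF d] d)
  then show ?thesis by simp
qed

text \<open>The direction \<open>e\<close> is transversal to the hyperplane, so \<open>p\<close> is
  a limit of points off it. With \<open>L\<close> the coordinate u this removes the restriction to
  nonzero u.\<close>

lemma zero_if_zero_off_hyperplane:
  fixes f :: "'a::real_normed_vector \<Rightarrow> real"
  assumes "open S" "continuous_on S f" "bounded_linear L" "L e \<noteq> 0"
    "\<And>p. p \<in> S \<Longrightarrow> L p \<noteq> (0::real) \<Longrightarrow> f p = 0" "p \<in> S"
  shows "f p = 0"
proof (cases "L p = 0")
  case True
  obtain \<epsilon> where \<epsilon>: "\<epsilon> > 0" "\<And>s. \<bar>s\<bar> < \<epsilon> \<Longrightarrow> p + s *\<^sub>R e \<in> S"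
    using open_line[OF assms(1,6)] by blast
  have "f (p + s *\<^sub>R e) = 0" if "s \<noteq> 0" "\<bar>s\<bar> < \<epsilon>" for s
    using assms(4) \<epsilon>(2)[OF that(2)] that True assms(3)
    by (intro assms(5)) (auto simp: linear_add linear_cmul bounded_linear.linear)
  then have "eventually (\<lambda>s. f (p + s *\<^sub>R e) = 0) (at 0)"
    using \<epsilon>(1) by (auto simp: eventually_at)
  then have "((\<lambda>s. f (p + s *\<^sub>R e)) \<longlongrightarrow> 0) (at 0)"
    by (rule tendsto_eventually)
  moreover have "isCont f p" using assms(1,2,6) continuous_on_eq_continuous_at by blast
  then have "((\<lambda>s. f (p + s *\<^sub>R e)) \<longlongrightarrow> f p) (at 0)"
    by (rule isCont_tendsto_compose) (auto intro!: tendsto_eq_intros)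
  ultimately show ?thesis using LIM_unique by blast
qed (use assms in simp)

text \<open>Two points with equal \<open>c\<close> are joined inside the convex \<open>W\<close> by
  a segment in the kernel of \<open>c\<close>, so \<open>f\<close> takes the same value at both and
  the chosen \<open>g\<close> is well defined. Near c q it coincides with \<open>f\<close> on the
  line through q in direction \<open>e\<close>, which gives smoothness.\<close>

lemma function_of_coordinate:
  fixes f :: "'a::euclidean_space \<Rightarrow> real"
  assumes W: "open W" "convex W" and f: "smooth_on W f" and c: "bounded_linear c" "c e = (1::real)"
    and 0: "\<And>q v. q \<in> W \<Longrightarrow> c v = 0 \<Longrightarrow> frechet_derivative f (at q) v = 0"
  obtains g where "smooth_on (c ` W) g" "\<And>q. q \<in> W \<Longrightarrow> f q = g (c q)"
    "\<And>q. q \<in> W \<Longrightarrow> frechet_derivative f (at q) e = deriv g (c q)"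
proof -
  note linc = bounded_linear.linear[OF c(1)]
  have line: "c (q + s *\<^sub>R e) = c q + s" for q s
    using c(2) linc by (simp add: linear_add linear_cmul)
  have const: "f q = f q'" if "q \<in> W" "q' \<in> W" "c q = c q'" for q q'
  proof -
    have "f (q + (q' - q)) = f q"
    proof (rule constant_on_line)
      fix s :: real assume s: "0 \<le> s" "s \<le> 1"
      have "q + s *\<^sub>R (q' - q) = (1 - s) *\<^sub>R q + s *\<^sub>R q'" by (simp add: algebra_simps)
      then have "q + s *\<^sub>R (q' - q) \<in> W" using convexD_alt[OF W(2) that(1,2) s] by simp
      then show "\<exists>D. (f has_derivative D) (at (q + s *\<^sub>R (q' - q))) \<and> D (q' - q) = 0"
        using smooth_on_has_derivative[OF f] 0 that(3) linc by (metis linear_diff eq_iff_diff_eq_0)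
    qed
    then show ?thesis by simp
  qed
  define g where "g x = f (SOME q. q \<in> W \<and> c q = x)" for x
  have g: "f q = g (c q)" if "q \<in> W" for q
    unfolding g_def by (rule const) (use that someI[of "\<lambda>r. r \<in> W \<and> c r = c q" q] in auto)
  have sm: "smooth_on (c ` W) g"
  proof (rule smooth_on_local, elim imageE)
    fix x q assume q: "q \<in> W" and x: "x = c q"
    define N where "N = (\<lambda>y. q + (y - x) *\<^sub>R e) -` W"
    have cont: "continuous_on UNIV (\<lambda>y. q + (y - x) *\<^sub>R e)" by (intro continuous_intros)
    have N: "open N" unfolding N_def by (rule open_vimage[OF W(1) cont])
    have gy: "g y = f (q + (y - x) *\<^sub>R e)" if "y \<in> N" for y
      using g[of "q + (y - x) *\<^sub>R e"] that by (simp add: N_def line x)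
    have "smooth_on N (\<lambda>y. f (q + (y - x) *\<^sub>R e))"
    proof (rule smooth_on_compose[OF f _ N W(1)])
      show "smooth_on N (\<lambda>y. q + (y - x) *\<^sub>R e)"
        by (intro smooth_on_add smooth_on_const N smooth_on_bounded_linear[OF bounded_linear_scaleR_left]
            smooth_on_diff smooth_on_ident)
    qed (auto simp: N_def)
    then have "smooth_on N g"
      by (rule smooth_on_cong[OF _ N]) (rule gy[symmetric])
    moreover have "x \<in> N" using q by (simp add: N_def)
    ultimately show "\<exists>N. open N \<and> x \<in> N \<and> smooth_on N g" using N by blast
  qed
  have "frechet_derivative f (at q) e = deriv g (c q)" if q: "q \<in> W" for q
  proof -
    have "((\<lambda>q. g (c q)) has_derivative (\<lambda>v. deriv g (c q) * c v)) (at q)"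
      by (rule smooth_on_deriv_has_derivative[OF sm]) (use q c(1) in \<open>auto intro: bounded_linear_imp_has_derivative\<close>)
    then have "(f has_derivative (\<lambda>v. deriv g (c q) * c v)) (at q)"
      by (rule has_derivative_transform_within_open[OF _ W(1) q]) (simp add: g)
    from frechet_derivative_at[OF this] show ?thesis using c(2) by (metis mult.right_neutral)
  qed
  with sm g show thesis by (rule that)
qed

section \<open>Partial derivatives on the space of (t, x, u)\<close>

definition partial_t :: "(base \<Rightarrow> real) \<Rightarrow> base \<Rightarrow> real" where
  "partial_t f q = frechet_derivative f (at q) (1, 0, 0)"
definition partial_x :: "(base \<Rightarrow> real) \<Rightarrow> base \<Rightarrow> real" where
  "partial_x f q = frechet_derivative f (at q) (0, 1, 0)"
definition partial_u :: "(base \<Rightarrow> real) \<Rightarrow> base \<Rightarrow> real" where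
  "partial_u f q = frechet_derivative f (at q) (0, 0, 1)"

lemma smooth_on_partial:
  assumes "smooth_on W f"
  shows "smooth_on W (partial_t f)" "smooth_on W (partial_x f)" "smooth_on W (partial_u f)"
  unfolding partial_t_def[abs_def] partial_x_def[abs_def] partial_u_def[abs_def]
  by (rule smooth_on_frechet[OF assms])+

lemma frechet_derivative_partial:
  assumes "smooth_on W f" "q \<in> W"
  shows "frechet_derivative f (at q) v =
    partial_t f q * fst v + partial_x f q * fst (snd v) + partial_u f q * snd (snd v)"
proof -
  let ?D = "frechet_derivative f (at q)"
  have lin: "linear ?D" using smooth_on_has_derivative[OF assms] has_derivative_linear by blast
  have v: "v = fst v *\<^sub>R (1, 0, 0) + fst (snd v) *\<^sub>R (0, 1, 0) + snd (snd v) *\<^sub>R (0, 0, 1)"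
    by (simp add: prod_eq_iff)
  have "?D v = ?D (fst v *\<^sub>R (1, 0, 0) + fst (snd v) *\<^sub>R (0, 1, 0) + snd (snd v) *\<^sub>R (0, 0, 1))"
    using v by simp
  then show ?thesis
    by (simp only: linear_add[OF lin] linear_cmul[OF lin] partial_t_def partial_x_def partial_u_def)
      simp
qed

lemma base_fun_has_derivative:
  fixes p :: ext
  assumes "smooth_on W f" "fst (fst p) \<in> W"
  shows "((\<lambda>p. f (fst (fst p))) has_derivative
    (\<lambda>v. partial_t f (fst (fst p)) * pt v + partial_x f (fst (fst p)) * px v
       + partial_u f (fst (fst p)) * pu v)) (at p)"
proof -
  have "((\<lambda>p. fst (fst p)) has_derivative (\<lambda>v. fst (fst v))) (at p)" by (intro derivative_intros)
  from has_derivative_compose[OF this smooth_on_has_derivative[OF assms]]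
  show ?thesis by (simp add: frechet_derivative_partial[OF assms])
qed

text \<open>Convexity is imposed on the projection to (t, x, u), where vanishing partial derivatives
  are integrated; in \<Omega> itself only small displacements of a point occur.\<close>

locale convex_equivalence =
  fixes \<Omega> :: "ext set" and \<Phi> :: "ext \<Rightarrow> ext"
  assumes open_\<Omega>: "open \<Omega>" and convex_base: "convex (ext_base ` \<Omega>)"
    and equivalence: "equivalence_transformation \<Omega> \<Phi>"
begin

definition "W = (\<lambda>p. fst (fst p)) ` \<Omega>"
definition "D p = frechet_derivative \<Phi> (at p)"

lemma ext_base_\<Omega>: "ext_base ` \<Omega> = W"
  by (auto simp: W_def ext_base_eq)

lemma W_I [simp]: "p \<in> \<Omega> \<Longrightarrow> fst (fst p) \<in> W"
  by (auto simp: W_def)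

lemma W_E: "q \<in> W \<Longrightarrow> (\<And>p. p \<in> \<Omega> \<Longrightarrow> fst (fst p) = q \<Longrightarrow> thesis) \<Longrightarrow> thesis"
  by (auto simp: W_def)

lemma open_W: "open W"
proof -
  have "W = fst ` fst ` \<Omega>" by (auto simp: W_def image_image)
  then show ?thesis by (simp add: open_\<Omega> open_image_fst)
qed

lemma convex_W: "convex W"
  using convex_base by (simp add: ext_base_\<Omega>)

lemma smooth: "smooth_on \<Omega> \<Phi>"
  using equivalence by (simp add: equivalence_transformation_def diffeomorphism_on_def)

lemma pa_nonzero: "p \<in> \<Omega> \<Longrightarrow> pa p \<noteq> 0"
  using equivalence by (force simp: equivalence_transformation_def ext_space_def)

lemma D_derivative: "p \<in> \<Omega> \<Longrightarrow> (\<Phi> has_derivative D p) (at p)"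
  unfolding D_def by (rule smooth_on_has_derivative[OF smooth])

lemma linear_D: "p \<in> \<Omega> \<Longrightarrow> linear (D p)"
  using D_derivative has_derivative_linear by blast

lemma inj_\<Phi>: "inj_on \<Phi> \<Omega>"
  using equivalence unfolding equivalence_transformation_def diffeomorphism_on_def by (metis inj_onI)

lemma inj_D:
  assumes "p \<in> \<Omega>"
  shows "inj (D p)"
proof -
  obtain g where g: "smooth_on (\<Phi> ` \<Omega>) g" "\<And>p. p \<in> \<Omega> \<Longrightarrow> g (\<Phi> p) = p"
    using equivalence unfolding equivalence_transformation_def diffeomorphism_on_def by blast
  let ?E = "frechet_derivative g (at (\<Phi> p))"
  have "(g has_derivative ?E) (at (\<Phi> p))" using smooth_on_has_derivative[OF g(1)] assms by blast
  from has_derivative_compose[OF D_derivative[OF assms] this]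
  have "((\<lambda>p. g (\<Phi> p)) has_derivative (\<lambda>v. ?E (D p v))) (at p)" .
  then have "((\<lambda>p. p) has_derivative (\<lambda>v. ?E (D p v))) (at p)"
    by (rule has_derivative_transform_within_open[OF _ open_\<Omega> assms]) (rule g(2))
  from has_derivative_unique[OF this has_derivative_ident] show ?thesis by (metis injI)
qed

lemma D_eq_0: "p \<in> \<Omega> \<Longrightarrow> D p v = 0 \<Longrightarrow> v = 0"
  using inj_D linear_D linear_0 injD by metis

lemma surj_D: "p \<in> \<Omega> \<Longrightarrow> \<exists>v. D p v = w"
  using linear_injective_imp_surjective[OF linear_D inj_D] by (metis surjD)

definition "base_map = (SOME \<phi>. \<forall>p\<in>\<Omega>. ext_base (\<Phi> p) = \<phi> (ext_base p))"
definition "T q = fst (base_map q)"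
definition "Y q = fst (snd (base_map q))"
definition "U q = snd (snd (base_map q))"

lemma base_map: "p \<in> \<Omega> \<Longrightarrow> fst (fst (\<Phi> p)) = base_map (fst (fst p))"
  using equivalence someI_ex[of "\<lambda>\<phi>. \<forall>p\<in>\<Omega>. ext_base (\<Phi> p) = \<phi> (ext_base p)"]
  by (auto simp: equivalence_transformation_def projectable_def base_map_def ext_base_eq)

lemma base_components:
  assumes "p \<in> \<Omega>"
  shows "pt (\<Phi> p) = T (fst (fst p))" "px (\<Phi> p) = Y (fst (fst p))" "pu (\<Phi> p) = U (fst (fst p))"
  by (simp_all add: T_def Y_def U_def base_map assms)

text \<open>Projectability supplies a base map without any regularity. Near a point it is recovered
  as a smooth composite by freezing all coordinates except t, x, u at their values at some
  \<open>p\<close> above that point.\<close>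

lemma smooth_base_component:
  assumes "bounded_linear L" "\<And>p. p \<in> \<Omega> \<Longrightarrow> L (\<Phi> p) = (f (fst (fst p)) :: real)"
  shows "smooth_on W f"
proof (rule smooth_on_local, elim W_E)
  fix q p assume p: "p \<in> \<Omega>" "fst (fst p) = q"
  let ?lift = "\<lambda>r. ((r, snd (fst p)), snd p)"
  define N where "N = ?lift -` \<Omega>"
  have N: "open N" unfolding N_def by (rule open_vimage[OF open_\<Omega>]) (intro continuous_intros)
  have "smooth_on N (\<lambda>r. L (\<Phi> (?lift r)))"
    by (intro smooth_on_bounded_linear[OF assms(1)] smooth_on_compose[OF smooth] smooth_on_intros N open_\<Omega>)
      (auto simp: N_def)
  then have "smooth_on N f"
    by (rule smooth_on_cong[OF _ N]) (use assms(2) in \<open>auto simp: N_def\<close>)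
  moreover have "q \<in> N" using p by (auto simp: N_def)
  ultimately show "\<exists>N. open N \<and> q \<in> N \<and> smooth_on N f" using N by blast
qed

lemma smooth_base: "smooth_on W T" "smooth_on W Y" "smooth_on W U"
  using smooth_base_component[OF bounded_linear_coordinates(1), of T]
    smooth_base_component[OF bounded_linear_coordinates(2), of Y]
    smooth_base_component[OF bounded_linear_coordinates(3), of U] base_components by auto

lemma D_base:
  assumes "p \<in> \<Omega>"
  defines "q \<equiv> fst (fst p)"
  shows "pt (D p v) = partial_t T q * pt v + partial_x T q * px v + partial_u T q * pu v"
    "px (D p v) = partial_t Y q * pt v + partial_x Y q * px v + partial_u Y q * pu v"
    "pu (D p v) = partial_t U q * pt v + partial_x U q * px v + partial_u U q * pu v"
  unfolding q_def
  using derivative_component[OF D_derivative[OF assms(1)] bounded_linear_coordinates(1) open_\<Omega> assms(1)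
      base_components(1) base_fun_has_derivative[OF smooth_base(1)], of v]
    derivative_component[OF D_derivative[OF assms(1)] bounded_linear_coordinates(2) open_\<Omega> assms(1)
      base_components(2) base_fun_has_derivative[OF smooth_base(2)], of v]
    derivative_component[OF D_derivative[OF assms(1)] bounded_linear_coordinates(3) open_\<Omega> assms(1)
      base_components(3) base_fun_has_derivative[OF smooth_base(3)], of v] assms(1) by simp_all

text \<open>The second-order components and the A and B components of \<open>v\<close> are free, so
  this covers the lifts of D_t and D_x as well as vectors that only change u_tt.\<close>

lemma contact:
  assumes "p \<in> \<Omega>" "pu v = put p * pt v + pux p * px v" "put v = putt p * pt v + putx p * px v"
    "pux v = putx p * pt v + puxx p * px v"
  shows "pu (D p v) = put (\<Phi> p) * pt (D p v) + pux (\<Phi> p) * px (D p v)"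
    "put (D p v) = putt (\<Phi> p) * pt (D p v) + putx (\<Phi> p) * px (D p v)"
    "pux (D p v) = putx (\<Phi> p) * pt (D p v) + puxx (\<Phi> p) * px (D p v)"
proof -
  have "fst (D p v) \<in> contact_plane (fst (\<Phi> p))"
  proof -
    have "preserves_contact \<Omega> \<Phi>" using equivalence by (simp add: equivalence_transformation_def)
    moreover have "fst v \<in> contact_plane (fst p)"
      unfolding contact_plane_iff using assms(2-4) by (simp add: mult.commute)
    ultimately show ?thesis using assms(1) unfolding preserves_contact_def D_def by blast
  qed
  then show "pu (D p v) = put (\<Phi> p) * pt (D p v) + pux (\<Phi> p) * px (D p v)"
    "put (D p v) = putt (\<Phi> p) * pt (D p v) + putx (\<Phi> p) * px (D p v)"
    "pux (D p v) = putx (\<Phi> p) * pt (D p v) + puxx (\<Phi> p) * px (D p v)"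
    by (auto simp: contact_plane_iff)
qed

lemma fst_\<Phi>_cong:
  assumes "p \<in> \<Omega>" "p' \<in> \<Omega>" "fst p = fst p'"
  shows "fst (\<Phi> p) = fst (\<Phi> p')"
  using equivalence assms unfolding equivalence_transformation_def projectable_def by metis

text \<open>One new pair serves every point of \<Omega> over the graph of the affine pair, whatever
  its t, u and derivatives. The slope \<open>k\<close> of B is the parameter that brings the term k
  u into the equation.\<close>

lemma affine_class_image:
  fixes x0 a a1 b k :: real
  obtains I A B where "open I" "smooth_on I A" "smooth_on I B" "\<And>y. y \<in> I \<Longrightarrow> A y \<noteq> 0"
    "\<And>p. p \<in> \<Omega> \<Longrightarrow> pa p = a + a1 * (px p - x0) \<Longrightarrow> pb p = b + k * (px p - x0) \<Longrightarrow>
      px (\<Phi> p) \<in> I \<and> pa (\<Phi> p) = A (px (\<Phi> p)) \<and> pb (\<Phi> p) = B (px (\<Phi> p))"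
    "\<And>p. p \<in> \<Omega> \<Longrightarrow> pa p = a + a1 * (px p - x0) \<Longrightarrow> pb p = b + k * (px p - x0) \<Longrightarrow>
      put p = 2 * a1 * pux p + pa p * puxx p + k * pu p + pb p * pux p \<longleftrightarrow>
      put (\<Phi> p) = deriv (deriv A) (px (\<Phi> p)) * pu (\<Phi> p) + 2 * deriv A (px (\<Phi> p)) * pux (\<Phi> p)
        + A (px (\<Phi> p)) * puxx (\<Phi> p) + (deriv B (px (\<Phi> p)) * pu (\<Phi> p) + B (px (\<Phi> p)) * pux (\<Phi> p))"
proof -
  define A0 where "A0 = (\<lambda>x. a + a1 * (x - x0))"
  define B0 where "B0 = (\<lambda>x. b + k * (x - x0))"
  \<comment> \<open>An affine A may have a zero; points of \<Omega> over the graph avoid it because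
    the A-coordinate does not vanish on \<Omega>.\<close>
  define I0 where "I0 = {x. A0 x \<noteq> 0}"
  have I0: "open I0"
    unfolding I0_def A0_def by (rule open_Collect_neq) (intro continuous_intros)+
  have sm: "smooth_on I0 A0" "smooth_on I0 B0"
    unfolding A0_def B0_def by (intro smooth_on_intros I0)+
  have d: "deriv A0 = (\<lambda>x. a1)" "deriv B0 = (\<lambda>x. k)"
    by (auto simp: A0_def B0_def intro!: ext DERIV_imp_deriv derivative_eq_intros)
  have ae0: "arbitrary_elements I0 A0 B0"
    using I0 sm by (simp add: arbitrary_elements_def) (simp add: I0_def)
  have mc: "maps_class \<Omega> \<Phi>" using equivalence by (simp add: equivalence_transformation_def)
  obtain I A B where ae: "arbitrary_elements I A B" and
    *: "\<forall>z z' a' b'. jet_x z \<in> I0 \<and> (z, A0 (jet_x z), B0 (jet_x z)) \<in> \<Omega> \<and>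
              \<Phi> (z, A0 (jet_x z), B0 (jet_x z)) = (z', a', b') \<longrightarrow>
                jet_x z' \<in> I \<and> a' = A (jet_x z') \<and> b' = B (jet_x z') \<and>
                (z \<in> fokker_planck I0 A0 B0 \<longleftrightarrow> z' \<in> fokker_planck I A B)"
    using mc[unfolded maps_class_def, THEN spec, THEN spec, THEN spec, THEN mp, OF ae0] by (elim exE conjE)
  have I: "open I" "smooth_on I A" "smooth_on I B" "\<And>y. y \<in> I \<Longrightarrow> A y \<noteq> 0"
    using ae by (auto simp: arbitrary_elements_def)
  have fp: "fst p \<in> fokker_planck J F G \<longleftrightarrow>
      put p = deriv (deriv F) (px p) * pu p + 2 * deriv F (px p) * pux p
        + F (px p) * puxx p + (deriv G (px p) * pu p + G (px p) * pux p)"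
    if "open J" "smooth_on J F" "smooth_on J G" "px p \<in> J" for J F G p
    using fokker_planck_iff[OF that] by (metis prod.collapse)
  have main: "px (\<Phi> p) \<in> I \<and> pa (\<Phi> p) = A (px (\<Phi> p)) \<and> pb (\<Phi> p) = B (px (\<Phi> p)) \<and>
      (fst p \<in> fokker_planck I0 A0 B0 \<longleftrightarrow> fst (\<Phi> p) \<in> fokker_planck I A B) \<and> px p \<in> I0"
    if "p \<in> \<Omega>" "pa p = A0 (px p)" "pb p = B0 (px p)" for p
  proof -
    have "px p \<in> I0" using pa_nonzero[OF that(1)] that(2) by (simp add: I0_def)
    moreover have "p = (fst p, A0 (jet_x (fst p)), B0 (jet_x (fst p)))"
      using that by (simp add: jet_x_eq prod_eq_iff)
    ultimately show ?thesis
      using *[THEN spec, of "fst p", THEN spec, of "fst (\<Phi> p)", THEN spec, of "pa (\<Phi> p)", THEN spec,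
          of "pb (\<Phi> p)"] that(1) by (simp add: jet_x_eq)
  qed
  show thesis
  proof (rule that[OF I])
    fix p assume p: "p \<in> \<Omega>" "pa p = a + a1 * (px p - x0)" "pb p = b + k * (px p - x0)"
    have AB0: "pa p = A0 (px p)" "pb p = B0 (px p)" using p by (simp_all add: A0_def B0_def)
    note m = main[OF p(1) AB0]
    show "px (\<Phi> p) \<in> I \<and> pa (\<Phi> p) = A (px (\<Phi> p)) \<and> pb (\<Phi> p) = B (px (\<Phi> p))" using m by simp
    show "put p = 2 * a1 * pux p + pa p * puxx p + k * pu p + pb p * pux p \<longleftrightarrow>
      put (\<Phi> p) = deriv (deriv A) (px (\<Phi> p)) * pu (\<Phi> p) + 2 * deriv A (px (\<Phi> p)) * pux (\<Phi> p)
        + A (px (\<Phi> p)) * puxx (\<Phi> p) + (deriv B (px (\<Phi> p)) * pu (\<Phi> p) + B (px (\<Phi> p)) * pux (\<Phi> p))"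
      using m fp[OF I0 sm, of p] fp[OF I(1-3), of "\<Phi> p"] AB0
      by (simp add: d add.assoc)
  qed
qed

end

section \<open>The new independent variables\<close>

context convex_equivalence
begin

text \<open>Only first derivatives at \<open>p\<close> are compared, so straight lines suffice. The
  direction with base part \<open>w\<close> and slopes \<open>a1\<close>, \<open>k\<close> stays
  over the graph of an affine pair because \<open>w\<close> has x-component 1. If Y were stationary,
  so would be the new A and B, for all slopes. The difference of two such directions is a pure
  change of A, which the derivative of \<Phi> would annihilate, against its injectivity. With w =
  (0, 1, 0) this also excludes Y_x = 0.\<close>

lemma Y_not_stationary:
  fixes w :: base
  assumes p: "p \<in> \<Omega>" and w: "fst (snd w) = 1"
  shows "partial_t Y (fst (fst p)) * fst w + partial_x Y (fst (fst p)) + partial_u Y (fst (fst p)) * snd (snd w) \<noteq> 0"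
proof
  assume 0: "partial_t Y (fst (fst p)) * fst w + partial_x Y (fst (fst p)) + partial_u Y (fst (fst p)) * snd (snd w) = 0"
  have *: "pa (D p ((w, 0), (a1, k))) = 0 \<and> pb (D p ((w, 0), (a1, k))) = 0" for a1 k
  proof -
    define v :: ext where "v = ((w, 0), (a1, k))"
    obtain I A B where I: "open I" "smooth_on I A" "smooth_on I B"
      and AB: "\<And>p'. p' \<in> \<Omega> \<Longrightarrow> pa p' = pa p + a1 * (px p' - px p) \<Longrightarrow> pb p' = pb p + k * (px p' - px p) \<Longrightarrow>
        px (\<Phi> p') \<in> I \<and> pa (\<Phi> p') = A (px (\<Phi> p')) \<and> pb (\<Phi> p') = B (px (\<Phi> p'))"
      using affine_class_image[where ?x0.0 = "px p" and a = "pa p" and ?a1.0 = a1 and b = "pb p" and k = k] by metis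
    obtain \<epsilon> where \<epsilon>: "\<epsilon> > 0" "\<And>s. \<bar>s\<bar> < \<epsilon> \<Longrightarrow> p + s *\<^sub>R v \<in> \<Omega>"
      using open_line[OF open_\<Omega> p] by blast
    have AB': "px (\<Phi> (p + s *\<^sub>R v)) \<in> I \<and> pa (\<Phi> (p + s *\<^sub>R v)) = A (px (\<Phi> (p + s *\<^sub>R v)))
      \<and> pb (\<Phi> (p + s *\<^sub>R v)) = B (px (\<Phi> (p + s *\<^sub>R v)))" if "\<bar>s\<bar> < \<epsilon>" for s
      by (rule AB[OF \<epsilon>(2)[OF that]]) (use w in \<open>simp_all add: v_def\<close>)
    have p0: "px (\<Phi> p) \<in> I" using AB'[of 0] \<epsilon>(1) by (simp only: scaleR_zero_left add_0_right abs_zero)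
    have D: "(\<Phi> has_derivative D p) (at (p + 0 *\<^sub>R v))"
      by (simp only: scaleR_zero_left add_0_right D_derivative[OF p])
    have line: "((\<lambda>s. L (\<Phi> (p + s *\<^sub>R v))) has_real_derivative L (D p v)) (at 0)"
      if "bounded_linear L" for L
      using has_derivative_along_line[OF bounded_linear.has_derivative[OF that D]] by simp
    have x0: "px (D p v) = 0"
      using 0 w by (simp add: D_base[OF p] v_def)
    have comp: "((\<lambda>s. F (px (\<Phi> (p + s *\<^sub>R v)))) has_real_derivative 0) (at 0)"
      if "smooth_on I F" for F
      using DERIV_chain2[of F "deriv F (px (\<Phi> p))" "\<lambda>s. px (\<Phi> (p + s *\<^sub>R v))" 0 0]
        smooth_on_DERIV[OF that p0] line[OF bounded_linear_coordinates(2)] x0 by auto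
    have pa0: "((\<lambda>s. pa (\<Phi> (p + s *\<^sub>R v))) has_real_derivative 0) (at 0)"
      by (rule has_field_derivative_transform_within[OF comp[OF I(2)] \<epsilon>(1)], simp) (use AB' in \<open>simp add: dist_norm\<close>)
    have pb0: "((\<lambda>s. pb (\<Phi> (p + s *\<^sub>R v))) has_real_derivative 0) (at 0)"
      by (rule has_field_derivative_transform_within[OF comp[OF I(3)] \<epsilon>(1)], simp) (use AB' in \<open>simp add: dist_norm\<close>)
    show ?thesis
      using DERIV_unique[OF line[OF bounded_linear_coordinates(9)] pa0]
        DERIV_unique[OF line[OF bounded_linear_coordinates(10)] pb0] by (simp add: v_def)
  qed
  define e :: ext where "e = (0, (1, 0))"
  have "e = ((w, 0), (1, 0)) - ((w, 0), (0, 0))" by (simp add: e_def zero_prod_def)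
  then have "D p e = D p ((w, 0), (1, 0)) - D p ((w, 0), (0, 0))"
    by (metis linear_D[OF p] linear_diff)
  then have ab: "pa (D p e) = 0" "pb (D p e) = 0" using *[of 1 0] *[of 0 0] by simp_all
  obtain \<epsilon> where \<epsilon>: "\<epsilon> > 0" "\<And>s. \<bar>s\<bar> < \<epsilon> \<Longrightarrow> p + s *\<^sub>R e \<in> \<Omega>"
    using open_line[OF open_\<Omega> p] by blast
  \<comment> \<open>By projectability onto jets, a change of A alone does not move the image
    jet.\<close>
  have fst0: "L (D p e) = 0" if L: "bounded_linear L" "\<And>p p'. fst p = fst p' \<Longrightarrow> L p = (L p' :: real)" for L
  proof -
    have "((\<lambda>s. L (\<Phi> (p + s *\<^sub>R e))) has_real_derivative L (D p e)) (at 0)"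
      by (rule has_derivative_along_line[OF bounded_linear.has_derivative[OF L(1)]])
        (simp only: scaleR_zero_left add_0_right D_derivative[OF p])
    moreover have "((\<lambda>s. L (\<Phi> (p + s *\<^sub>R e))) has_real_derivative 0) (at 0)"
    proof (rule has_field_derivative_transform_within[of "\<lambda>s. L (\<Phi> p)", OF DERIV_const \<epsilon>(1)], simp)
      fix s :: real assume "dist s 0 < \<epsilon>"
      then show "L (\<Phi> p) = L (\<Phi> (p + s *\<^sub>R e))"
        by (intro L(2) fst_\<Phi>_cong p \<epsilon>(2)) (simp_all add: dist_norm e_def)
    qed
    ultimately show ?thesis by (rule DERIV_unique)
  qed
  have "D p e = 0"
    by (rule ext_eqI) (use ab in \<open>simp_all add: bounded_linear_coordinates(1-8)[THEN fst0]\<close>)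
  from D_eq_0[OF p this] show False by (simp add: e_def prod_eq_iff)
qed

text \<open>An affine expression in the two free components of w that has no zero must be constant;
  the instances used are the zeros it would otherwise have.\<close>

lemma Y_partials:
  assumes "q \<in> W"
  shows "partial_t Y q = 0" "partial_u Y q = 0" "partial_x Y q \<noteq> 0"
proof -
  from assms obtain p where p: "p \<in> \<Omega>" "fst (fst p) = q" by (rule W_E)
  have *: "partial_t Y q * t + partial_x Y q + partial_u Y q * u \<noteq> 0" for t u
    using Y_not_stationary[OF p(1), of "(t, 1, u)"] p(2) by simp
  show "partial_t Y q = 0" using *[of "- partial_x Y q / partial_t Y q" 0] by (cases "partial_t Y q = 0") auto
  show "partial_u Y q = 0" using *[of 0 "- partial_x Y q / partial_u Y q"] by (cases "partial_u Y q = 0") auto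
  show "partial_x Y q \<noteq> 0" using *[of 0 0] by simp
qed

lemma D_x: "p \<in> \<Omega> \<Longrightarrow> px (D p v) = partial_x Y (fst (fst p)) * px v"
  using D_base(2)[of p v] Y_partials by simp

text \<open>If D_x T did not vanish, the contact condition would also keep the new u_tx and u_tt fixed when
  u_tt varies, against injectivity.\<close>

lemma total_x_T:
  assumes p: "p \<in> \<Omega>" and u: "pu p \<noteq> 0"
  shows "partial_x T (fst (fst p)) + partial_u T (fst (fst p)) * pux p = 0"
proof (rule ccontr)
  assume DT: "partial_x T (fst (fst p)) + partial_u T (fst (fst p)) * pux p \<noteq> 0"
  let ?v = "((0, 0, (1, 0, 0)), 0) :: ext"
  obtain r where r: "r > 0" "ball p r \<subseteq> \<Omega>" using open_\<Omega> p open_contains_ball by blast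
  have nv: "norm ?v = 1" by (simp add: norm_Pair)
  \<comment> \<open>Half the radius: a point within r/2 of \<open>p\<close>, moved by at most
    \<open>s\<close> along the unit vector in u_tt, stays in the ball.\<close>
  define s where "s = r / 2"
  have s: "0 < s" "s < r" using r by (auto simp: s_def)
  have near: "q + h *\<^sub>R ?v \<in> \<Omega>" if "q \<in> ball p (r / 2)" "0 \<le> h" "h \<le> s" for q h
  proof -
    have "dist p (q + h *\<^sub>R ?v) \<le> dist p q + norm (h *\<^sub>R ?v)"
      using norm_triangle_ineq4[of "p - q" "h *\<^sub>R ?v"] by (simp add: dist_norm algebra_simps)
    also have "\<dots> < r" using that unfolding norm_scaleR nv by (simp add: s_def)
    finally show ?thesis using r(2) by auto
  qed
  \<comment> \<open>A change of u_tt moves no base coordinate, so contact keeps the new u_t and u_x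
    fixed. This is shown on a whole ball so that it can be differentiated at \<open>p\<close>, which
    gives \<open>D1\<close>.\<close>
  have first: "put (\<Phi> (q + s *\<^sub>R ?v)) = put (\<Phi> q)" "pux (\<Phi> (q + s *\<^sub>R ?v)) = pux (\<Phi> q)"
    if q: "q \<in> ball p (r / 2)" for q
  proof -
    have in\<Omega>: "q + h *\<^sub>R (s *\<^sub>R ?v) \<in> \<Omega>" if "0 \<le> h" "h \<le> 1" for h
      using near[OF q, of "h * s"] that s by (simp add: mult_left_le_one_le)
    have zero: "put (D p' (s *\<^sub>R ?v)) = 0" "pux (D p' (s *\<^sub>R ?v)) = 0" if "p' \<in> \<Omega>" for p'
      using contact(2,3)[OF that, of "s *\<^sub>R ?v"] D_base(1,2)[OF that, of "s *\<^sub>R ?v"] by simp_all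
    show "put (\<Phi> (q + s *\<^sub>R ?v)) = put (\<Phi> q)"
      by (rule constant_on_line[where F = "\<lambda>p. put (\<Phi> p)"])
        (use bounded_linear.has_derivative[OF bounded_linear_coordinates(4) D_derivative] in\<Omega> zero(1) in blast)
    show "pux (\<Phi> (q + s *\<^sub>R ?v)) = pux (\<Phi> q)"
      by (rule constant_on_line[where F = "\<lambda>p. pux (\<Phi> p)"])
        (use bounded_linear.has_derivative[OF bounded_linear_coordinates(5) D_derivative] in\<Omega> zero(2) in blast)
  qed
  define p' where "p' = p + s *\<^sub>R ?v"
  have p': "p' \<in> \<Omega>" unfolding p'_def using near[of p s] s r by simp
  have base': "fst (fst p') = fst (fst p)" "put p' = put p" "pux p' = pux p" "puxx p' = puxx p" "putx p' = putx p"
    "snd p' = snd p" "putt p' = putt p + s"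
    by (simp_all add: p'_def)
  have D1: "put (D p' w) = put (D p w)" "pux (D p' w) = pux (D p w)" for w
  proof -
    have shift: "((\<lambda>q. q + s *\<^sub>R ?v) has_derivative (\<lambda>w. w)) (at p)" by (auto intro!: derivative_eq_intros)
    from has_derivative_compose[OF this, of \<Phi> "D p'"] D_derivative[OF p']
    have sh: "((\<lambda>q. \<Phi> (q + s *\<^sub>R ?v)) has_derivative D p') (at p)" by (simp add: p'_def)
    have pb: "p \<in> ball p (r / 2)" using r by simp
    show "put (D p' w) = put (D p w)"
      by (rule derivative_component[OF sh bounded_linear_coordinates(4) open_ball pb first(1)
            bounded_linear.has_derivative[OF bounded_linear_coordinates(4) D_derivative[OF p]]])
    show "pux (D p' w) = pux (D p w)"
      by (rule derivative_component[OF sh bounded_linear_coordinates(5) open_ball pb first(2)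
            bounded_linear.has_derivative[OF bounded_linear_coordinates(5) D_derivative[OF p]]])
  qed
  have same: "put (\<Phi> p') = put (\<Phi> p)" "pux (\<Phi> p') = pux (\<Phi> p)"
    using first[of p] r by (simp_all add: p'_def)
  have sameb: "fst (fst (\<Phi> p')) = fst (fst (\<Phi> p))" using base_map[OF p] base_map[OF p'] base'(1) by simp
  \<comment> \<open>The slope of B that puts \<open>p\<close> on the equation with constant A;
    \<open>p'\<close> is on it as well because u_tt does not occur there.\<close>
  define k where "k = (put p - pa p * puxx p - pb p * pux p) / pu p"
  have k: "put p = pa p * puxx p + k * pu p + pb p * pux p" using u by (simp add: k_def)
  obtain I A B where A0: "\<And>y. y \<in> I \<Longrightarrow> A y \<noteq> 0"
    and AB: "\<And>q. q \<in> \<Omega> \<Longrightarrow> pa q = pa p + 0 * (px q - px p) \<Longrightarrow> pb q = pb p + k * (px q - px p) \<Longrightarrow>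
      px (\<Phi> q) \<in> I \<and> pa (\<Phi> q) = A (px (\<Phi> q)) \<and> pb (\<Phi> q) = B (px (\<Phi> q))"
    and FP: "\<And>q. q \<in> \<Omega> \<Longrightarrow> pa q = pa p + 0 * (px q - px p) \<Longrightarrow> pb q = pb p + k * (px q - px p) \<Longrightarrow>
      put q = 2 * 0 * pux q + pa q * puxx q + k * pu q + pb q * pux q \<longleftrightarrow>
      put (\<Phi> q) = deriv (deriv A) (px (\<Phi> q)) * pu (\<Phi> q) + 2 * deriv A (px (\<Phi> q)) * pux (\<Phi> q)
        + A (px (\<Phi> q)) * puxx (\<Phi> q) + (deriv B (px (\<Phi> q)) * pu (\<Phi> q) + B (px (\<Phi> q)) * pux (\<Phi> q))"
    by (rule affine_class_image[where ?x0.0 = "px p" and a = "pa p" and ?a1.0 = 0 and b = "pb p" and k = k]) blast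
  have uxx: "puxx (\<Phi> p') = puxx (\<Phi> p)"
  proof -
    have "A (px (\<Phi> p)) \<noteq> 0" using A0 AB[OF p] by simp
    then show ?thesis using FP[OF p] FP[OF p'] k by (simp add: base' same sameb)
  qed
  have ab: "snd (\<Phi> p') = snd (\<Phi> p)" using AB[OF p] AB[OF p'] by (simp add: base' sameb prod_eq_iff)
  \<comment> \<open>The lift of D_x, free of u_tt and therefore the same vector at \<open>p\<close>
    and \<open>p'\<close>. Its image has t-component D_x T, assumed nonzero, so the contact
    relations can be solved for the new u_tx and then for the new u_tt.\<close>
  let ?w = "(((0, 1, pux p), (putx p, puxx p), 0), 0) :: ext"
  have t: "pt (D p ?w) = pt (D p' ?w)" "px (D p ?w) = px (D p' ?w)" "pt (D p ?w) \<noteq> 0"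
    using DT by (simp_all add: D_base(1)[OF p] D_base(1)[OF p'] D_x[OF p] D_x[OF p'] base')
  have utx: "putx (\<Phi> p') = putx (\<Phi> p)"
    using contact(3)[OF p, of ?w] contact(3)[OF p', of ?w] t D1(2)[of ?w] uxx by (simp add: base')
  have utt: "putt (\<Phi> p') = putt (\<Phi> p)"
    using contact(2)[OF p, of ?w] contact(2)[OF p', of ?w] t D1(1)[of ?w] utx by (simp add: base')
  have "\<Phi> p' = \<Phi> p"
    by (rule ext_eqI) (simp_all add: sameb same uxx utx utt ab)
  then have "p' = p" using inj_\<Phi> p p' by (auto dest: inj_onD)
  then show False using base'(7) s by simp
qed

text \<open>D_x T = T_x + T_u u_x vanishes at two values of u_x over the same base point, so both
  coefficients vanish; continuity adds the points with u = 0.\<close>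

lemma T_partials_x_u:
  assumes "q \<in> W"
  shows "partial_x T q = 0" "partial_u T q = 0"
proof -
  have L: "bounded_linear (\<lambda>q::base. snd (snd q))" by (intro bounded_linear_intros)
  have *: "partial_x T q = 0 \<and> partial_u T q = 0" if q: "q \<in> W" "snd (snd q) \<noteq> 0" for q
  proof -
    obtain p where p: "p \<in> \<Omega>" "fst (fst p) = q" using q(1) by (rule W_E)
    let ?v = "((0, (0, 1), 0), 0) :: ext"
    obtain \<epsilon> where \<epsilon>: "\<epsilon> > 0" "\<And>s. \<bar>s\<bar> < \<epsilon> \<Longrightarrow> p + s *\<^sub>R ?v \<in> \<Omega>"
      using open_line[OF open_\<Omega> p(1)] by blast
    have 1: "partial_x T q + partial_u T q * pux p = 0"
      using total_x_T[OF p(1)] p(2) q(2) by simp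
    have 2: "partial_x T q + partial_u T q * (pux p + \<epsilon> / 2) = 0"
      using total_x_T[OF \<epsilon>(2)[of "\<epsilon> / 2"]] p(2) q(2) \<epsilon>(1) by simp
    have "partial_u T q * (\<epsilon> / 2) = 0" using 1 2 by (simp only: distrib_left)
    with \<epsilon>(1) 1 show ?thesis by simp
  qed
  show "partial_x T q = 0"
    by (rule zero_if_zero_off_hyperplane[OF open_W smooth_on_continuous[OF smooth_on_partial(2)[OF smooth_base(1)]] L, of "(0, 0, 1)"])
      (use * assms in auto)
  show "partial_u T q = 0"
    by (rule zero_if_zero_off_hyperplane[OF open_W smooth_on_continuous[OF smooth_on_partial(3)[OF smooth_base(1)]] L, of "(0, 0, 1)"])
      (use * assms in auto)
qed

text \<open>Uses surjectivity of the derivative of \<Phi>. A preimage of the t-direction forces T_t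
  to be nonzero. A preimage of the u-direction then has no t- and no x-component, so U_u is
  nonzero.\<close>

lemma partials_nonzero:
  assumes "q \<in> W"
  shows "partial_t T q \<noteq> 0" "partial_u U q \<noteq> 0"
proof -
  from assms obtain p where p: "p \<in> \<Omega>" "fst (fst p) = q" by (rule W_E)
  obtain v where "D p v = (((1, 0, 0), 0), 0)" using surj_D[OF p(1)] by blast
  then show t: "partial_t T q \<noteq> 0"
    using D_base(1)[OF p(1), of v] T_partials_x_u[OF assms] p(2) by auto
  obtain v where v: "D p v = (((0, 0, 1), 0), 0)" using surj_D[OF p(1)] by blast
  have "pt v = 0" using D_base(1)[OF p(1), of v] T_partials_x_u[OF assms] p(2) t v by simp
  moreover have "px v = 0" using D_x[OF p(1), of v] Y_partials(3)[OF assms] p(2) v by simp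
  ultimately show "partial_u U q \<noteq> 0" using D_base(3)[OF p(1), of v] p(2) v by auto
qed

end

lemma ext_fun_has_derivative:
  fixes f :: "real \<Rightarrow> real"
  assumes "smooth_on J f" "px p \<in> J"
  shows "((\<lambda>p. f (px p)) has_derivative (\<lambda>v. deriv f (px p) * px v)) (at p)"
  by (rule smooth_on_deriv_has_derivative[OF assms(1)]) (auto intro!: derivative_intros assms(2))

lemma quadratic_zero_coefficients:
  fixes a0 a1 a2 \<epsilon> :: real
  assumes "\<epsilon> > 0" "\<And>s. \<bar>s\<bar> < \<epsilon> \<Longrightarrow> a0 + a1 * s + a2 * s\<^sup>2 = 0"
  shows "a0 = 0" "a1 = 0" "a2 = 0"
proof -
  show a0: "a0 = 0" using assms(2)[of 0] assms(1) by simp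
  have 1: "a1 * (\<epsilon> / 2) + a2 * (\<epsilon> / 2)\<^sup>2 = 0" using assms(2)[of "\<epsilon> / 2"] assms(1) a0 by simp
  have 2: "- a1 * (\<epsilon> / 2) + a2 * (\<epsilon> / 2)\<^sup>2 = 0" using assms(2)[of "- (\<epsilon> / 2)"] assms(1) a0 by simp
  have "a1 * (\<epsilon> / 2) = 0" using 1 2 by linarith
  then show "a1 = 0" using assms(1) by simp
  have "a2 * (\<epsilon> / 2)\<^sup>2 = 0" using 1 2 by linarith
  then show "a2 = 0" using assms(1) by simp
qed

lemma affine_if_deriv2_zero:
  fixes f :: "real \<Rightarrow> real"
  assumes "smooth_on J f" "open J" "convex J" "\<And>x. x \<in> J \<Longrightarrow> deriv (deriv f) x = 0"
  obtains c d where "\<And>x. x \<in> J \<Longrightarrow> f x = c * x + d" "\<And>x. x \<in> J \<Longrightarrow> deriv f x = c"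
proof -
  have "\<exists>c. \<forall>x\<in>J. deriv f x = c"
    by (rule has_field_derivative_zero_constant[OF assms(3)])
      (use smooth_on_DERIV[OF smooth_on_deriv[OF assms(1,2)]] assms(4) in \<open>metis has_field_derivative_at_within\<close>)
  then obtain c where c: "\<And>x. x \<in> J \<Longrightarrow> deriv f x = c" by blast
  have "\<exists>d. \<forall>x\<in>J. f x - c * x = d"
  proof (rule has_field_derivative_zero_constant[OF assms(3)])
    fix x assume x: "x \<in> J"
    have "((\<lambda>x. f x - c * x) has_real_derivative deriv f x - c) (at x)"
      by (auto intro!: derivative_eq_intros smooth_on_DERIV[OF assms(1) x])
    then show "((\<lambda>x. f x - c * x) has_real_derivative 0) (at x within J)"
      using c[OF x] by (auto intro: has_field_derivative_at_within)
  qed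
  then obtain d where "\<And>x. x \<in> J \<Longrightarrow> f x - c * x = d" by blast
  then show thesis using c by (intro that[of c d]) (auto simp: algebra_simps)
qed

section \<open>Reduction to functions of one variable and the prolonged components\<close>

context convex_equivalence
begin

definition "JT = fst ` W"
definition "JX = (\<lambda>q. fst (snd q)) ` W"
definition "JU = (\<lambda>q. snd (snd q)) ` W"

lemma bounded_linear_base:
  "bounded_linear (\<lambda>q::base. fst q)" "bounded_linear (\<lambda>q::base. fst (snd q))" "bounded_linear (\<lambda>q::base. snd (snd q))"
  by (intro bounded_linear_intros)+

lemma open_J: "open JT" "open JX" "open JU"
proof -
  have "JX = fst ` snd ` W" "JU = snd ` snd ` W" by (auto simp: JX_def JU_def image_image)
  then show "open JT" "open JX" "open JU"
    by (simp_all add: JT_def open_W open_image_fst open_image_snd)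
qed

lemma convex_J: "convex JT" "convex JX" "convex JU"
  unfolding JT_def JX_def JU_def
  by (rule convex_linear_image[OF bounded_linear.linear convex_W], rule bounded_linear_base)+

lemma coordinates_in_J [simp]:
  assumes "p \<in> \<Omega>" shows "pt p \<in> JT" "px p \<in> JX" "pu p \<in> JU"
  using W_I[OF assms] by (auto simp: JT_def JX_def JU_def)

definition "\<tau> = (SOME g. smooth_on JT g \<and> (\<forall>q\<in>W. T q = g (fst q)) \<and> (\<forall>q\<in>W. partial_t T q = deriv g (fst q)))"
definition "X = (SOME g. smooth_on JX g \<and> (\<forall>q\<in>W. Y q = g (fst (snd q))) \<and> (\<forall>q\<in>W. partial_x Y q = deriv g (fst (snd q))))"

lemma \<tau>: "smooth_on JT \<tau>" "\<And>q. q \<in> W \<Longrightarrow> T q = \<tau> (fst q)" "\<And>q. q \<in> W \<Longrightarrow> partial_t T q = deriv \<tau> (fst q)"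
proof -
  have "\<exists>g. smooth_on JT g \<and> (\<forall>q\<in>W. T q = g (fst q)) \<and> (\<forall>q\<in>W. partial_t T q = deriv g (fst q))"
  proof (rule function_of_coordinate[OF open_W convex_W smooth_base(1) bounded_linear_base(1), of "(1, 0, 0)"])
    show "frechet_derivative T (at q) v = 0" if "q \<in> W" "fst v = 0" for q v
      using that frechet_derivative_partial[OF smooth_base(1), of q v] T_partials_x_u by simp
    fix g
    assume "smooth_on (fst ` W) g" "\<And>q. q \<in> W \<Longrightarrow> T q = g (fst q)"
      "\<And>q. q \<in> W \<Longrightarrow> frechet_derivative T (at q) (1, 0, 0) = deriv g (fst q)"
    then show ?thesis unfolding JT_def partial_t_def by (intro exI[of _ g]) simp
  qed simp
  from someI_ex[OF this, folded \<tau>_def]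
  show "smooth_on JT \<tau>" "\<And>q. q \<in> W \<Longrightarrow> T q = \<tau> (fst q)" "\<And>q. q \<in> W \<Longrightarrow> partial_t T q = deriv \<tau> (fst q)"
    by blast+
qed

lemma X: "smooth_on JX X" "\<And>q. q \<in> W \<Longrightarrow> Y q = X (fst (snd q))" "\<And>q. q \<in> W \<Longrightarrow> partial_x Y q = deriv X (fst (snd q))"
proof -
  have "\<exists>g. smooth_on JX g \<and> (\<forall>q\<in>W. Y q = g (fst (snd q))) \<and> (\<forall>q\<in>W. partial_x Y q = deriv g (fst (snd q)))"
  proof (rule function_of_coordinate[OF open_W convex_W smooth_base(2) bounded_linear_base(2), of "(0, 1, 0)"])
    show "frechet_derivative Y (at q) v = 0" if "q \<in> W" "fst (snd v) = 0" for q v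
      using that frechet_derivative_partial[OF smooth_base(2), of q v] Y_partials by simp
    fix g
    assume "smooth_on ((\<lambda>q. fst (snd q)) ` W) g" "\<And>q. q \<in> W \<Longrightarrow> Y q = g (fst (snd q))"
      "\<And>q. q \<in> W \<Longrightarrow> frechet_derivative Y (at q) (0, 1, 0) = deriv g (fst (snd q))"
    then show ?thesis unfolding JX_def partial_x_def by (intro exI[of _ g]) simp
  qed simp
  from someI_ex[OF this, folded X_def]
  show "smooth_on JX X" "\<And>q. q \<in> W \<Longrightarrow> Y q = X (fst (snd q))" "\<And>q. q \<in> W \<Longrightarrow> partial_x Y q = deriv X (fst (snd q))"
    by blast+
qed

lemma deriv_X_nonzero: "x \<in> JX \<Longrightarrow> deriv X x \<noteq> 0"
  using Y_partials(3) X(3) by (auto simp: JX_def)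

lemma deriv_\<tau>_nonzero: "t \<in> JT \<Longrightarrow> deriv \<tau> t \<noteq> 0"
  using partials_nonzero(1) \<tau>(3) by (auto simp: JT_def)

lemmas smooth_X = X(1) smooth_on_deriv[OF X(1) open_J(2)]
  smooth_on_deriv[OF smooth_on_deriv[OF X(1) open_J(2)] open_J(2)]

lemma D_t: "p \<in> \<Omega> \<Longrightarrow> pt (D p v) = deriv \<tau> (pt p) * pt v"
  using D_base(1)[of p v] T_partials_x_u \<tau>(3) by simp

lemma D_x_deriv: "p \<in> \<Omega> \<Longrightarrow> px (D p v) = deriv X (px p) * px v"
  using D_x[of p v] X(3) by simp

lemma \<Phi>_t: "p \<in> \<Omega> \<Longrightarrow> pt (\<Phi> p) = \<tau> (pt p)" and \<Phi>_x: "p \<in> \<Omega> \<Longrightarrow> px (\<Phi> p) = X (px p)"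
  by (simp_all add: base_components \<tau>(2) X(2))

text \<open>The contact relation along the lift of D_t, whose image has no x-component;
  \<open>\<Phi>_ux\<close> uses D_x in the same way, whose image has no t-component.\<close>

lemma \<Phi>_ut:
  assumes p: "p \<in> \<Omega>"
  shows "put (\<Phi> p) * deriv \<tau> (pt p) = partial_t U (fst (fst p)) + partial_u U (fst (fst p)) * put p"
  using contact(1)[OF p, of "(((1, 0, put p), (putt p, putx p), 0), 0)"]
  by (simp add: D_t[OF p] D_x_deriv[OF p] D_base(3)[OF p])

lemma \<Phi>_ux:
  assumes p: "p \<in> \<Omega>"
  shows "pux (\<Phi> p) * deriv X (px p) = partial_x U (fst (fst p)) + partial_u U (fst (fst p)) * pux p"
  using contact(1)[OF p, of "(((0, 1, pux p), (putx p, puxx p), 0), 0)"]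
  by (simp add: D_t[OF p] D_x_deriv[OF p] D_base(3)[OF p])

text \<open>\<open>P0\<close>, \<open>P1\<close> and \<open>P2\<close> are the coefficients of 1,
  u_x and u_x^2 in D_x D_x U; the remaining term is U_u u_xx. \<open>P1\<close> keeps the two mixed
  derivatives apart.\<close>

definition "P0 = partial_x (partial_x U)"
definition "P1 q = partial_u (partial_x U) q + partial_x (partial_u U) q"
definition "P2 = partial_u (partial_u U)"

text \<open>The identity \<open>\<Phi>_ux\<close> holds on all of \<Omega> and is differentiated
  along the lift of D_x; contact turns the derivative of the new u_x into the new u_xx times
  X'.\<close>

lemma \<Phi>_uxx:
  assumes p: "p \<in> \<Omega>"
  shows "puxx (\<Phi> p) * (deriv X (px p))\<^sup>2 + pux (\<Phi> p) * deriv (deriv X) (px p) =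
    P0 (fst (fst p)) + P1 (fst (fst p)) * pux p + P2 (fst (fst p)) * (pux p)\<^sup>2 + partial_u U (fst (fst p)) * puxx p"
proof -
  let ?q = "fst (fst p)"
  let ?v = "(((0, 1, pux p), (putx p, puxx p), 0), 0) :: ext"
  have l: "((\<lambda>p. pux (\<Phi> p) * deriv X (px p)) has_derivative
     (\<lambda>v. pux (\<Phi> p) * (deriv (deriv X) (px p) * px v) + pux (D p v) * deriv X (px p))) (at p)"
    by (intro has_derivative_mult bounded_linear.has_derivative[OF bounded_linear_coordinates(5) D_derivative[OF p]]
        ext_fun_has_derivative[OF smooth_X(2)] coordinates_in_J p)
  have r: "((\<lambda>p. partial_x U (fst (fst p)) + partial_u U (fst (fst p)) * pux p) has_derivative
     (\<lambda>v. (partial_t (partial_x U) ?q * pt v + partial_x (partial_x U) ?q * px v + partial_u (partial_x U) ?q * pu v)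
      + (partial_u U ?q * pux v + (partial_t (partial_u U) ?q * pt v + partial_x (partial_u U) ?q * px v
          + partial_u (partial_u U) ?q * pu v) * pux p))) (at p)"
    by (intro has_derivative_add has_derivative_mult base_fun_has_derivative[OF smooth_on_partial(2)[OF smooth_base(3)]]
       base_fun_has_derivative[OF smooth_on_partial(3)[OF smooth_base(3)]] W_I p
       bounded_linear_imp_has_derivative bounded_linear_coordinates)
  have "pux (\<Phi> p) * (deriv (deriv X) (px p) * px ?v) + pux (D p ?v) * deriv X (px p) =
     (partial_t (partial_x U) ?q * pt ?v + partial_x (partial_x U) ?q * px ?v + partial_u (partial_x U) ?q * pu ?v)
      + (partial_u U ?q * pux ?v + (partial_t (partial_u U) ?q * pt ?v + partial_x (partial_u U) ?q * px ?v
          + partial_u (partial_u U) ?q * pu ?v) * pux p)"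
    by (rule fun_cong[OF has_derivative_unique[OF _ r]], rule has_derivative_transform_within_open[OF l open_\<Omega> p \<Phi>_ux])
  moreover have "pux (D p ?v) = puxx (\<Phi> p) * deriv X (px p)"
    using contact(3)[OF p, of ?v] by (simp add: D_t[OF p] D_x_deriv[OF p])
  ultimately show ?thesis
    by (simp add: P0_def P1_def P2_def algebra_simps power2_eq_square)
qed

lemma constant_class_image:
  assumes p: "p \<in> \<Omega>"
  obtains I A B where "open I" "smooth_on I A" "smooth_on I B"
    "\<And>p'. p' \<in> \<Omega> \<Longrightarrow> pa p' = pa p \<Longrightarrow> pb p' = pb p + k * (px p' - px p) \<Longrightarrow>
      X (px p') \<in> I \<and> pa (\<Phi> p') = A (X (px p')) \<and> pb (\<Phi> p') = B (X (px p'))"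
    "\<And>p'. p' \<in> \<Omega> \<Longrightarrow> pa p' = pa p \<Longrightarrow> pb p' = pb p + k * (px p' - px p) \<Longrightarrow>
      put p' = pa p' * puxx p' + k * pu p' + pb p' * pux p' \<Longrightarrow>
      put (\<Phi> p') = deriv (deriv A) (X (px p')) * U (fst (fst p')) + 2 * deriv A (X (px p')) * pux (\<Phi> p')
        + A (X (px p')) * puxx (\<Phi> p') + (deriv B (X (px p')) * U (fst (fst p')) + B (X (px p')) * pux (\<Phi> p'))"
proof (rule affine_class_image[where ?x0.0 = "px p" and a = "pa p" and ?a1.0 = 0 and b = "pb p" and k = k])
  fix I A B
  assume 1: "open I" "smooth_on I A" "smooth_on I B"
    and 2: "\<And>p'. p' \<in> \<Omega> \<Longrightarrow> pa p' = pa p + 0 * (px p' - px p) \<Longrightarrow> pb p' = pb p + k * (px p' - px p) \<Longrightarrow>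
      px (\<Phi> p') \<in> I \<and> pa (\<Phi> p') = A (px (\<Phi> p')) \<and> pb (\<Phi> p') = B (px (\<Phi> p'))"
    and 3: "\<And>p'. p' \<in> \<Omega> \<Longrightarrow> pa p' = pa p + 0 * (px p' - px p) \<Longrightarrow> pb p' = pb p + k * (px p' - px p) \<Longrightarrow>
      put p' = 2 * 0 * pux p' + pa p' * puxx p' + k * pu p' + pb p' * pux p' \<longleftrightarrow>
      put (\<Phi> p') = deriv (deriv A) (px (\<Phi> p')) * pu (\<Phi> p') + 2 * deriv A (px (\<Phi> p')) * pux (\<Phi> p')
        + A (px (\<Phi> p')) * puxx (\<Phi> p') + (deriv B (px (\<Phi> p')) * pu (\<Phi> p') + B (px (\<Phi> p')) * pux (\<Phi> p'))"
  show thesis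
    by (rule that[OF 1]) (use 2 3 in \<open>simp_all add: \<Phi>_x base_components(3)\<close>)
qed

lemma \<Phi>_a_deriv:
  assumes p: "p \<in> \<Omega>" and u: "pu p \<noteq> 0"
  shows "pa (\<Phi> p) * deriv \<tau> (pt p) = pa p * (deriv X (px p))\<^sup>2"
proof -
  define k where "k = (put p - pa p * puxx p - pb p * pux p) / pu p"
  have k: "put p = pa p * puxx p + k * pu p + pb p * pux p" using u by (simp add: k_def)
  obtain I A B where
    AB: "\<And>p'. p' \<in> \<Omega> \<Longrightarrow> pa p' = pa p \<Longrightarrow> pb p' = pb p + k * (px p' - px p) \<Longrightarrow>
      X (px p') \<in> I \<and> pa (\<Phi> p') = A (X (px p')) \<and> pb (\<Phi> p') = B (X (px p'))"
    and FP: "\<And>p'. p' \<in> \<Omega> \<Longrightarrow> pa p' = pa p \<Longrightarrow> pb p' = pb p + k * (px p' - px p) \<Longrightarrow>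
      put p' = pa p' * puxx p' + k * pu p' + pb p' * pux p' \<Longrightarrow>
      put (\<Phi> p') = deriv (deriv A) (X (px p')) * U (fst (fst p')) + 2 * deriv A (X (px p')) * pux (\<Phi> p')
        + A (X (px p')) * puxx (\<Phi> p') + (deriv B (X (px p')) * U (fst (fst p')) + B (X (px p')) * pux (\<Phi> p'))"
    using constant_class_image[OF p] by metis
  \<comment> \<open>Raising u_xx by s and u_t by a s stays on the equation u_t = a u_xx + k u + b
    u_x.\<close>
  define v :: ext where "v = ((0, (pa p, 0), (0, 0, 1)), 0)"
  obtain \<epsilon> where \<epsilon>: "\<epsilon> > 0" "\<And>s. \<bar>s\<bar> < \<epsilon> \<Longrightarrow> p + s *\<^sub>R v \<in> \<Omega>"
    using open_line[OF open_\<Omega> p] by blast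
  define s where "s = \<epsilon> / 2"
  define p' where "p' = p + s *\<^sub>R v"
  have s: "s > 0" and p': "p' \<in> \<Omega>" using \<epsilon> by (auto simp: s_def p'_def)
  have c: "fst (fst p') = fst (fst p)" "put p' = put p + s * pa p" "pux p' = pux p" "puxx p' = puxx p + s" "snd p' = snd p"
    by (simp_all add: p'_def v_def)
  have ux: "pux (\<Phi> p') = pux (\<Phi> p)"
    using \<Phi>_ux[OF p] \<Phi>_ux[OF p'] deriv_X_nonzero[of "px p"] p by (simp add: c) (metis coordinates_in_J(2) mult_right_cancel)
  have 1: "put (\<Phi> p') - put (\<Phi> p) = A (X (px p)) * (puxx (\<Phi> p') - puxx (\<Phi> p))"
    using FP[OF p] FP[OF p'] k ux by (simp add: c algebra_simps)
  have 2: "(put (\<Phi> p') - put (\<Phi> p)) * deriv \<tau> (pt p) = partial_u U (fst (fst p)) * (s * pa p)"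
    using \<Phi>_ut[OF p] \<Phi>_ut[OF p'] by (simp add: c algebra_simps)
  have 3: "(puxx (\<Phi> p') - puxx (\<Phi> p)) * (deriv X (px p))\<^sup>2 = partial_u U (fst (fst p)) * s"
    using \<Phi>_uxx[OF p] \<Phi>_uxx[OF p'] ux by (simp add: c algebra_simps)
  have "A (X (px p)) * deriv \<tau> (pt p) * (partial_u U (fst (fst p)) * s)
      = (A (X (px p)) * (puxx (\<Phi> p') - puxx (\<Phi> p)) * deriv \<tau> (pt p)) * (deriv X (px p))\<^sup>2"
    unfolding 3[symmetric] by (simp only: mult_ac)
  also have "\<dots> = pa p * (deriv X (px p))\<^sup>2 * (partial_u U (fst (fst p)) * s)"
    unfolding 2[unfolded 1] by (simp only: mult_ac)
  finally have "A (X (px p)) * deriv \<tau> (pt p) * (partial_u U (fst (fst p)) * s)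
      = pa p * (deriv X (px p))\<^sup>2 * (partial_u U (fst (fst p)) * s)" .
  then have "A (X (px p)) * deriv \<tau> (pt p) = pa p * (deriv X (px p))\<^sup>2"
    using partials_nonzero(2)[OF W_I[OF p]] s by simp
  then show ?thesis using AB[OF p] by simp
qed

lemma deriv2_\<tau>:
  assumes "t \<in> JT"
  shows "deriv (deriv \<tau>) t = 0"
proof -
  obtain q0 where q0: "q0 \<in> W" "fst q0 = t" using assms by (auto simp: JT_def)
  \<comment> \<open>The formula for the new A asks for nonzero u; a small change of u reaches such a
    point with the same t.\<close>
  obtain q where q: "q \<in> W" "fst q = t" "snd (snd q) \<noteq> 0"
  proof (cases "snd (snd q0) = 0")
    case True
    obtain \<epsilon> where \<epsilon>: "\<epsilon> > 0" "\<And>s. \<bar>s\<bar> < \<epsilon> \<Longrightarrow> q0 + s *\<^sub>R (0, 0, 1) \<in> W"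
      using open_line[OF open_W q0(1)] by blast
    show ?thesis using that[OF \<epsilon>(2)[of "\<epsilon> / 2"]] \<epsilon>(1) True q0(2) by simp
  qed (use that q0 in blast)
  obtain p where p: "p \<in> \<Omega>" "fst (fst p) = q" using q(1) by (rule W_E)
  define v :: ext where "v = (((1, 0, 0), 0), 0)"
  obtain \<epsilon> where \<epsilon>: "\<epsilon> > 0" "\<And>s. \<bar>s\<bar> < \<epsilon> \<Longrightarrow> p + s *\<^sub>R v \<in> \<Omega>"
    using open_line[OF open_\<Omega> p(1)] by blast
  obtain I A B where
    AB: "\<And>p'. p' \<in> \<Omega> \<Longrightarrow> pa p' = pa p \<Longrightarrow> pb p' = pb p + 0 * (px p' - px p) \<Longrightarrow>
      X (px p') \<in> I \<and> pa (\<Phi> p') = A (X (px p')) \<and> pb (\<Phi> p') = B (X (px p'))"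
    by (rule constant_class_image[OF p(1), of 0]) blast
  \<comment> \<open>A shift of t alone keeps x, A and B, hence also the new A as a function of X x;
    in its formula only \<tau>' could change.\<close>
  have "deriv \<tau> (t + s) = deriv \<tau> t" if "\<bar>s\<bar> < \<epsilon>" for s
  proof -
    let ?p = "p + s *\<^sub>R v"
    have c: "pt v = 1" "px v = 0" "pu v = 0" "snd v = 0" "pt p = t"
      using p q by (simp_all add: v_def)
    have "pa (\<Phi> ?p) = pa (\<Phi> p)" using AB[OF p(1)] AB[OF \<epsilon>(2)[OF that]] by (simp add: c)
    then have "pa (\<Phi> p) * deriv \<tau> (t + s) = pa (\<Phi> p) * deriv \<tau> t"
      using \<Phi>_a_deriv[OF p(1)] \<Phi>_a_deriv[OF \<epsilon>(2)[OF that]] p q by (simp add: c)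
    moreover have "pa (\<Phi> p) \<noteq> 0"
      using \<Phi>_a_deriv[OF p(1)] pa_nonzero[OF p(1)] deriv_X_nonzero[OF coordinates_in_J(2)[OF p(1)]] p q by auto
    ultimately show ?thesis by simp
  qed
  then have "deriv \<tau> x = deriv \<tau> t" if "dist x t < \<epsilon>" for x
    using that[unfolded dist_real_def] by (metis add_diff_cancel_left' diff_add_cancel add.commute)
  then have "((deriv \<tau>) has_real_derivative 0) (at t)"
    by (intro has_field_derivative_transform_within[OF DERIV_const \<epsilon>(1)]) auto
  then show ?thesis by (rule DERIV_imp_deriv)
qed

end

section \<open>Determining equations\<close>

context convex_equivalence
begin

definition "c1 = (SOME c. \<forall>t\<in>JT. deriv \<tau> t = c)"
definition "c2 = (SOME d. \<forall>t\<in>JT. \<tau> t = c1 * t + d)"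

lemma \<tau>_affine:
  assumes "t \<in> JT"
  shows "deriv \<tau> t = c1" "\<tau> t = c1 * t + c2" "c1 \<noteq> 0"
proof -
  obtain c d where cd: "\<And>t. t \<in> JT \<Longrightarrow> \<tau> t = c * t + d" "\<And>t. t \<in> JT \<Longrightarrow> deriv \<tau> t = c"
    by (rule affine_if_deriv2_zero[OF \<tau>(1) open_J(1) convex_J(1) deriv2_\<tau>], assumption, rule that)
  have "\<exists>c. \<forall>t\<in>JT. deriv \<tau> t = c" using cd(2) by blast
  from someI_ex[OF this, folded c1_def] have 1: "\<forall>t\<in>JT. deriv \<tau> t = c1" .
  have "c1 = c" using 1 cd(2) assms by force
  then have "\<exists>d. \<forall>t\<in>JT. \<tau> t = c1 * t + d" using cd(1) by blast
  from someI_ex[OF this, folded c2_def] show "\<tau> t = c1 * t + c2" using assms by blast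
  show "deriv \<tau> t = c1" using 1 assms by blast
  with deriv_\<tau>_nonzero[OF assms] show "c1 \<noteq> 0" by simp
qed

lemma \<Phi>_a_nonzero_u:
  assumes "p \<in> \<Omega>" "pu p \<noteq> 0"
  shows "pa (\<Phi> p) = pa p * (deriv X (px p))\<^sup>2 / c1"
  using \<Phi>_a_deriv[OF assms] \<tau>_affine[OF coordinates_in_J(1)[OF assms(1)]] by (simp add: field_simps)

text \<open>The new coefficients are known only through their composites with X; this extracts their
  derivatives in the new variable.\<close>

lemma deriv_via_X:
  assumes "smooth_on I F" "X x \<in> I" "x \<in> JX" "(g has_real_derivative g') (at x)" "\<epsilon> > 0"
    "\<And>y. dist y x < \<epsilon> \<Longrightarrow> F (X y) = g y"
  shows "deriv F (X x) * deriv X x = g'"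
proof -
  have "((\<lambda>y. F (X y)) has_real_derivative deriv F (X x) * deriv X x) (at x)"
    by (rule DERIV_chain2[OF smooth_on_DERIV[OF assms(1,2)] smooth_on_DERIV[OF X(1) assms(3)]])
  then have "(g has_real_derivative deriv F (X x) * deriv X x) (at x)"
    by (rule has_field_derivative_transform_within[OF _ assms(5)]) (use assms(6) in simp_all)
  then show ?thesis using assms(4) by (rule DERIV_unique)
qed

text \<open>Along \<open>e\<close> the point stays over the graph of the test pair, which makes the
  new coefficients explicit there. At the base point of \<open>p\<close>, raising u_x by s and u_t
  by b s stays on the equation. After substitution the new equation times c1 reads D_t U = N U + M
  D_x U + a D_x D_x U, a quadratic identity in s, whose coefficients are the last three
  conclusions.\<close>

lemma solution_jet:
  assumes p: "p \<in> \<Omega>" and k: "put p = pa p * puxx p + k * pu p + pb p * pux p" and u: "pu p \<noteq> 0"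
  defines "q \<equiv> fst (fst p)" and "x \<equiv> px p" and "a \<equiv> pa p" and "b \<equiv> pb p"
  defines "e \<equiv> (((0, 1, 0), 0), (0, k)) :: ext"
  obtains I A B M N \<epsilon> where "open I" "smooth_on I A" "smooth_on I B" "\<epsilon> > 0"
    "\<And>s. \<bar>s\<bar> < \<epsilon> \<Longrightarrow> p + s *\<^sub>R e \<in> \<Omega>" "\<And>s. \<bar>s\<bar> < \<epsilon> \<Longrightarrow> X (x + s) \<in> I"
    "\<And>s. \<bar>s\<bar> < \<epsilon> \<Longrightarrow> A (X (x + s)) = a * (deriv X (x + s))\<^sup>2 / c1"
    "\<And>s. \<bar>s\<bar> < \<epsilon> \<Longrightarrow> B (X (x + s)) = pb (\<Phi> (p + s *\<^sub>R e))"
    "M = c1 * (2 * deriv A (X x) + B (X x)) / deriv X x - a * deriv (deriv X) x / deriv X x"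
    "N = c1 * (deriv (deriv A) (X x) + deriv B (X x))"
    "P2 q = 0" "M * partial_u U q = b * partial_u U q - a * P1 q"
    "partial_t U q + partial_u U q * put p = N * U q + M * (partial_x U q + partial_u U q * pux p)
       + a * (P0 q + P1 q * pux p + partial_u U q * puxx p)"
proof -
  obtain I A B where I: "open I" "smooth_on I A" "smooth_on I B" and
    AB: "\<And>p'. p' \<in> \<Omega> \<Longrightarrow> pa p' = pa p \<Longrightarrow> pb p' = pb p + k * (px p' - px p) \<Longrightarrow>
      X (px p') \<in> I \<and> pa (\<Phi> p') = A (X (px p')) \<and> pb (\<Phi> p') = B (X (px p'))"
    and FP: "\<And>p'. p' \<in> \<Omega> \<Longrightarrow> pa p' = pa p \<Longrightarrow> pb p' = pb p + k * (px p' - px p) \<Longrightarrow>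
      put p' = pa p' * puxx p' + k * pu p' + pb p' * pux p' \<Longrightarrow>
      put (\<Phi> p') = deriv (deriv A) (X (px p')) * U (fst (fst p')) + 2 * deriv A (X (px p')) * pux (\<Phi> p')
        + A (X (px p')) * puxx (\<Phi> p') + (deriv B (X (px p')) * U (fst (fst p')) + B (X (px p')) * pux (\<Phi> p'))"
    by (rule constant_class_image[OF p, of k]) blast
  have c1: "c1 \<noteq> 0" using \<tau>_affine(3) coordinates_in_J(1)[OF p] by blast
  have X': "deriv X x \<noteq> 0" unfolding x_def by (rule deriv_X_nonzero[OF coordinates_in_J(2)[OF p]])
  obtain \<epsilon> where \<epsilon>: "\<epsilon> > 0" "\<And>s. \<bar>s\<bar> < \<epsilon> \<Longrightarrow> p + s *\<^sub>R e \<in> \<Omega>"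
    using open_line[OF open_\<Omega> p] by blast
  have e: "pa e = 0" "pb e = k" "px e = 1" "pu e = 0" by (simp_all add: e_def)
  have curve: "X (x + s) \<in> I \<and> A (X (x + s)) = a * (deriv X (x + s))\<^sup>2 / c1 \<and> B (X (x + s)) = pb (\<Phi> (p + s *\<^sub>R e))"
    if "\<bar>s\<bar> < \<epsilon>" for s
    using AB[OF \<epsilon>(2)[OF that]] \<Phi>_a_nonzero_u[OF \<epsilon>(2)[OF that]] u by (simp add: e x_def a_def)
  define M where "M = c1 * (2 * deriv A (X x) + B (X x)) / deriv X x - a * deriv (deriv X) x / deriv X x"
  define N where "N = c1 * (deriv (deriv A) (X x) + deriv B (X x))"
  define v :: ext where "v = ((0, (b, 1), 0), 0)"
  have v: "fst (fst v) = 0" "put v = b" "pux v = 1" "puxx v = 0" "snd v = 0" by (simp_all add: v_def zero_prod_def)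
  obtain \<delta> where \<delta>: "\<delta> > 0" "\<And>s. \<bar>s\<bar> < \<delta> \<Longrightarrow> p + s *\<^sub>R v \<in> \<Omega>"
    using open_line[OF open_\<Omega> p] by blast
  have poly: "(N * U q + M * (partial_x U q + partial_u U q * pux p)
       + a * (P0 q + P1 q * pux p + P2 q * (pux p)\<^sup>2 + partial_u U q * puxx p) - partial_t U q - partial_u U q * put p)
     + (M * partial_u U q + a * P1 q + 2 * a * P2 q * pux p - b * partial_u U q) * s + a * P2 q * s\<^sup>2 = 0"
    if s: "\<bar>s\<bar> < \<delta>" for s
  proof -
    let ?p = "p + s *\<^sub>R v"
    note p' = \<delta>(2)[OF s]
    have c: "fst (fst ?p) = q" "put ?p = put p + s * b" "pux ?p = pux p + s" "puxx ?p = puxx p" "snd ?p = snd p"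
      "px ?p = x" "pu ?p = pu p" "pt ?p = pt p"
      by (simp_all add: v q_def x_def)
    define R where "R = partial_x U q + partial_u U q * (pux p + s)"
    define S where "S = P0 q + P1 q * (pux p + s) + P2 q * (pux p + s)\<^sup>2 + partial_u U q * puxx p"
    have 1: "c1 * put (\<Phi> ?p) = partial_t U q + partial_u U q * (put p + s * b)"
      using \<Phi>_ut[OF p'] \<tau>_affine(1)[OF coordinates_in_J(1)[OF p]] unfolding c by (simp add: q_def mult.commute)
    have 2: "pux (\<Phi> ?p) = R / deriv X x"
      using \<Phi>_ux[OF p'] X' unfolding c by (simp add: R_def q_def x_def field_simps)
    have 3: "(deriv X x)\<^sup>2 * puxx (\<Phi> ?p) = S - R / deriv X x * deriv (deriv X) x"
      using \<Phi>_uxx[OF p'] unfolding c 2 by (simp add: S_def q_def x_def algebra_simps)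
    have A0: "c1 * A (X x) = a * (deriv X x)\<^sup>2"
      using curve[of 0] \<epsilon>(1) c1 by simp
    have "put (\<Phi> ?p) = deriv (deriv A) (X x) * U q + 2 * deriv A (X x) * pux (\<Phi> ?p)
        + A (X x) * puxx (\<Phi> ?p) + (deriv B (X x) * U q + B (X x) * pux (\<Phi> ?p))"
      using FP[OF p'] k unfolding c by (simp add: x_def q_def algebra_simps b_def)
    then have "c1 * put (\<Phi> ?p) = N * U q + c1 * (2 * deriv A (X x) + B (X x)) * pux (\<Phi> ?p)
        + (c1 * A (X x)) * puxx (\<Phi> ?p)"
      by (simp add: N_def algebra_simps)
    also have "(c1 * A (X x)) * puxx (\<Phi> ?p) = a * (S - R / deriv X x * deriv (deriv X) x)"
      unfolding A0 3[symmetric] by simp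
    also have "c1 * (2 * deriv A (X x) + B (X x)) * pux (\<Phi> ?p) = (M + a * deriv (deriv X) x / deriv X x) * R"
      unfolding 2 M_def using X' by (simp add: field_simps)
    finally have "partial_t U q + partial_u U q * (put p + s * b) = N * U q + M * R + a * S"
      unfolding 1 by (simp add: algebra_simps)
    then show ?thesis
      unfolding R_def S_def by (simp add: algebra_simps power2_eq_square)
  qed
  note coeffs = quadratic_zero_coefficients[OF \<delta>(1) poly]
  have P2: "P2 q = 0" using coeffs(3) pa_nonzero[OF p] by (simp add: a_def)
  show thesis
    by (rule that[OF I \<epsilon> _ _ _ M_def N_def P2]) (use coeffs(1,2) P2 curve in \<open>simp_all add: algebra_simps\<close>)
qed

text \<open>The coefficient of -a in c1 times the new B. The term with \<open>P1\<close> comes from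
  M = b - a P1 / U_u. The 3 X'' is the difference of 4 X'', from twice the derivative of the new A,
  and one X'' from the new u_xx.\<close>

definition "\<sigma> q = deriv X (fst (snd q)) * P1 q / partial_u U q + 3 * deriv (deriv X) (fst (snd q))"
text \<open>The coefficient of a once M and N are inserted into the constant term of the quadratic:
  X''' stems from the second derivative of the new A, the derivative of \<sigma> from that of the
  new B.\<close>

definition "L q = (2 * deriv (deriv (deriv X)) (fst (snd q)) - partial_x \<sigma> q) / deriv X (fst (snd q)) * U q
  - P1 q / partial_u U q * partial_x U q + P0 q"

lemma smooth_of_x:
  fixes f :: "real \<Rightarrow> real"
  assumes "smooth_on JX f"
  shows "smooth_on W (\<lambda>q. f (fst (snd q)))"
  by (rule smooth_on_compose[OF assms _ open_W open_J(2)])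
    (auto intro!: smooth_on_intros open_W simp: JX_def)

lemma smooth_\<sigma>: "smooth_on W \<sigma>"
  unfolding \<sigma>_def[abs_def] P1_def
  by (intro smooth_on_intros smooth_of_x smooth_X smooth_on_partial smooth_base open_W partials_nonzero(2))

text \<open>The coefficient linear in s fixes M, which contains the new B and the derivative of the
  new A. The latter is 2 a X'' / c1, so B is the only unknown left.\<close>

lemma \<Phi>_b_nonzero_u:
  assumes p: "p \<in> \<Omega>" and u: "pu p \<noteq> 0"
  shows "c1 * pb (\<Phi> p) = deriv X (px p) * pb p - pa p * \<sigma> (fst (fst p))"
proof -
  define k where "k = (put p - pa p * puxx p - pb p * pux p) / pu p"
  have k: "put p = pa p * puxx p + k * pu p + pb p * pux p" using u by (simp add: k_def)
  let ?q = "fst (fst p)" and ?x = "px p"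
  obtain I A B M \<epsilon> where I: "smooth_on I A" "\<epsilon> > 0"
    and XI: "\<And>s. \<bar>s\<bar> < \<epsilon> \<Longrightarrow> X (?x + s) \<in> I"
    and A: "\<And>s. \<bar>s\<bar> < \<epsilon> \<Longrightarrow> A (X (?x + s)) = pa p * (deriv X (?x + s))\<^sup>2 / c1"
    and B: "\<And>s. \<bar>s\<bar> < \<epsilon> \<Longrightarrow> B (X (?x + s)) = pb (\<Phi> (p + s *\<^sub>R (((0, 1, 0), 0), (0, k))))"
    and M: "M = c1 * (2 * deriv A (X ?x) + B (X ?x)) / deriv X ?x - pa p * deriv (deriv X) ?x / deriv X ?x"
    "M * partial_u U ?q = pb p * partial_u U ?q - pa p * P1 ?q"
    by (rule solution_jet[OF p k u]) blast
  have J: "?x \<in> JX" using p by simp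
  note X' = deriv_X_nonzero[OF J]
  have c1: "c1 \<noteq> 0" using \<tau>_affine(3) coordinates_in_J(1)[OF p] by blast
  have "deriv A (X ?x) * deriv X ?x = pa p * (2 * deriv X ?x * deriv (deriv X) ?x) / c1"
  proof (rule deriv_via_X[OF I(1) _ J _ I(2)])
    show "((\<lambda>x. pa p * (deriv X x)\<^sup>2 / c1) has_real_derivative pa p * (2 * deriv X ?x * deriv (deriv X) ?x) / c1) (at ?x)"
      using c1 by (auto intro!: derivative_eq_intros smooth_on_DERIV[OF smooth_X(2) J])
    show "A (X y) = pa p * (deriv X y)\<^sup>2 / c1" if "dist y ?x < \<epsilon>" for y
      using A[of "y - ?x"] that by (simp add: dist_real_def)
  qed (use XI[of 0] I(2) in simp)
  then have A1: "c1 * deriv A (X ?x) = 2 * pa p * deriv (deriv X) ?x" using X' c1 by (simp add: field_simps)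
  have B0: "B (X ?x) = pb (\<Phi> p)" using B[of 0] I(2) by (simp only: scaleR_zero_left add_0_right abs_zero)
  have Uu: "partial_u U ?q \<noteq> 0" using partials_nonzero(2) p by simp
  then have Meq: "M = pb p - pa p * P1 ?q / partial_u U ?q" using M(2) by (simp add: field_simps)
  have cB: "c1 * B (X ?x) = M * deriv X ?x + pa p * deriv (deriv X) ?x - 2 * (c1 * deriv A (X ?x))"
    using X' by (simp add: M(1) field_simps)
  show ?thesis
    using cB unfolding B0 A1 \<sigma>_def Meq by (simp add: algebra_simps)
qed

text \<open>The formulas for the new A and B are differentiated along the line in direction
  \<open>e\<close>, where u keeps its nonzero value; this evaluates N. Since the old B has slope
  \<open>k\<close> on that line, \<open>k\<close> reappears in N. After M and N are inserted, u_x
  and u_xx survive only inside \<open>k\<close>.\<close>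

lemma determining_equation:
  assumes p: "p \<in> \<Omega>" and u: "pu p \<noteq> 0"
  shows "P2 (fst (fst p)) = 0"
    "(put p - pa p * puxx p - pb p * pux p) * ((partial_u U (fst (fst p)) * pu p - U (fst (fst p))) / pu p)
     + partial_t U (fst (fst p))
     - pb p * (partial_x U (fst (fst p)) + deriv (deriv X) (px p) / deriv X (px p) * U (fst (fst p)))
     - pa p * L (fst (fst p)) = 0"
proof -
  define k where "k = (put p - pa p * puxx p - pb p * pux p) / pu p"
  have k: "put p = pa p * puxx p + k * pu p + pb p * pux p" using u by (simp add: k_def)
  let ?q = "fst (fst p)" and ?x = "px p"
  define e :: ext where "e = (((0, 1, 0), 0), (0, k))"
  obtain I A B M N \<epsilon> where I: "smooth_on I A" "smooth_on I B" "\<epsilon> > 0" and open_I: "open I"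
    and e\<Omega>: "\<And>s. \<bar>s\<bar> < \<epsilon> \<Longrightarrow> p + s *\<^sub>R e \<in> \<Omega>"
    and XI: "\<And>s. \<bar>s\<bar> < \<epsilon> \<Longrightarrow> X (?x + s) \<in> I"
    and A: "\<And>s. \<bar>s\<bar> < \<epsilon> \<Longrightarrow> A (X (?x + s)) = pa p * (deriv X (?x + s))\<^sup>2 / c1"
    and B: "\<And>s. \<bar>s\<bar> < \<epsilon> \<Longrightarrow> B (X (?x + s)) = pb (\<Phi> (p + s *\<^sub>R e))"
    and N: "N = c1 * (deriv (deriv A) (X ?x) + deriv B (X ?x))"
    and P2: "P2 ?q = 0"
    and M: "M * partial_u U ?q = pb p * partial_u U ?q - pa p * P1 ?q"
    and E: "partial_t U ?q + partial_u U ?q * put p = N * U ?q + M * (partial_x U ?q + partial_u U ?q * pux p)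
       + pa p * (P0 ?q + P1 ?q * pux p + partial_u U ?q * puxx p)"
    unfolding e_def by (rule solution_jet[OF p k u]) blast
  show "P2 ?q = 0" by fact
  have J: "?x \<in> JX" using p by simp
  note X' = deriv_X_nonzero[OF J]
  have c1: "c1 \<noteq> 0" using \<tau>_affine(3) coordinates_in_J(1)[OF p] by blast
  have Uu: "partial_u U ?q \<noteq> 0" using partials_nonzero(2) p by simp
  have ev: "fst (fst e) = (0, 1, 0)" "pa e = 0" "pb e = k" by (simp_all add: e_def)
  have Jy: "y \<in> JX" if "dist y ?x < \<epsilon>" for y
    using coordinates_in_J(2)[OF e\<Omega>[of "y - ?x"]] that by (simp add: dist_real_def ev)
  have XIy: "X y \<in> I" "A (X y) = pa p * (deriv X y)\<^sup>2 / c1" if "dist y ?x < \<epsilon>" for y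
    using XI[of "y - ?x"] A[of "y - ?x"] that by (simp_all add: dist_real_def)
  \<comment> \<open>Required near \<open>?x\<close> and not only at it, because it is differentiated
    once more; the radius left around x is \<epsilon> minus the distance to
    \<open>?x\<close>.\<close>
  have A1: "deriv A (X x) = 2 * pa p * deriv (deriv X) x / c1" if x: "dist x ?x < \<epsilon>" for x
  proof -
    have "deriv A (X x) * deriv X x = pa p * (2 * deriv X x * deriv (deriv X) x) / c1"
    proof (rule deriv_via_X[OF I(1) XIy(1)[OF x] Jy[OF x], where \<epsilon> = "\<epsilon> - dist x ?x"])
      show "((\<lambda>x. pa p * (deriv X x)\<^sup>2 / c1) has_real_derivative pa p * (2 * deriv X x * deriv (deriv X) x) / c1) (at x)"
        using c1 by (auto intro!: derivative_eq_intros smooth_on_DERIV[OF smooth_X(2) Jy[OF x]])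
      show "A (X y) = pa p * (deriv X y)\<^sup>2 / c1" if "dist y x < \<epsilon> - dist x ?x" for y
        by (rule XIy(2)) (use that dist_triangle[of y ?x x] in linarith)
    qed (use x in simp)
    then show ?thesis using deriv_X_nonzero[OF Jy[OF x]] c1 by (simp add: field_simps)
  qed
  have "deriv (deriv A) (X ?x) * deriv X ?x = 2 * pa p * deriv (deriv (deriv X)) ?x / c1"
  proof (rule deriv_via_X[OF smooth_on_deriv[OF I(1) open_I] _ J _ I(3) A1])
    show "((\<lambda>x. 2 * pa p * deriv (deriv X) x / c1) has_real_derivative 2 * pa p * deriv (deriv (deriv X)) ?x / c1) (at ?x)"
      using c1 by (auto intro!: derivative_eq_intros smooth_on_DERIV[OF smooth_X(3) J])
  qed (use XI[of 0] I(3) in simp_all)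
  then have A2: "c1 * deriv (deriv A) (X ?x) * deriv X ?x = 2 * pa p * deriv (deriv (deriv X)) ?x"
    using c1 by (simp add: field_simps)
  have B1: "c1 * deriv B (X ?x) * deriv X ?x = deriv (deriv X) ?x * pb p + deriv X ?x * k - pa p * partial_x \<sigma> ?q"
  proof -
    have "deriv B (X ?x) * deriv X ?x = (deriv (deriv X) ?x * pb p + deriv X ?x * k - pa p * partial_x \<sigma> ?q) / c1"
    proof (rule deriv_via_X[OF I(2) _ J _ I(3)])
      have "((\<lambda>y. \<sigma> (?q + (y - ?x) *\<^sub>R (0, 1, 0))) has_real_derivative partial_x \<sigma> ?q) (at ?x)"
      proof -
        have "(\<sigma> has_derivative frechet_derivative \<sigma> (at ?q)) (at (?q + 0 *\<^sub>R (0, 1, 0)))"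
          using smooth_on_has_derivative[OF smooth_\<sigma> W_I[OF p]] by (simp only: scaleR_zero_left add_0_right)
        from has_derivative_along_line[OF this]
        have "((\<lambda>s. \<sigma> (?q + s *\<^sub>R (0, 1, 0))) has_real_derivative partial_x \<sigma> ?q) (at (?x - ?x))"
          by (simp add: partial_x_def)
        moreover have "((\<lambda>y. y - ?x) has_real_derivative 1) (at ?x)" by (auto intro!: derivative_eq_intros)
        ultimately show ?thesis
          using DERIV_chain2[where f = "\<lambda>s. \<sigma> (?q + s *\<^sub>R (0, 1, 0))" and g = "\<lambda>y. y - ?x"]
          by (metis mult.right_neutral)
      qed
      then show "((\<lambda>y. (deriv X y * (pb p + k * (y - ?x)) - pa p * \<sigma> (?q + (y - ?x) *\<^sub>R (0, 1, 0))) / c1)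
        has_real_derivative (deriv (deriv X) ?x * pb p + deriv X ?x * k - pa p * partial_x \<sigma> ?q) / c1) (at ?x)"
        by (auto intro!: derivative_eq_intros smooth_on_DERIV[OF smooth_X(2) J] simp: c1)
      fix y assume y: "dist y ?x < \<epsilon>"
      then have y': "\<bar>y - ?x\<bar> < \<epsilon>" by (simp add: dist_real_def)
      have "c1 * pb (\<Phi> (p + (y - ?x) *\<^sub>R e)) = deriv X y * (pb p + k * (y - ?x)) - pa p * \<sigma> (?q + (y - ?x) *\<^sub>R (0, 1, 0))"
        using \<Phi>_b_nonzero_u[OF e\<Omega>[OF y']] u by (simp add: ev mult.commute)
      moreover have "B (X y) = c1 * pb (\<Phi> (p + (y - ?x) *\<^sub>R e)) / c1" using B[OF y'] c1 by simp
      ultimately show "B (X y) = (deriv X y * (pb p + k * (y - ?x)) - pa p * \<sigma> (?q + (y - ?x) *\<^sub>R (0, 1, 0))) / c1"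
        by simp
    qed (use XI[of 0] I(3) in simp)
    then show ?thesis using c1 by (simp add: field_simps)
  qed
  have M': "M = pb p - pa p * P1 ?q / partial_u U ?q" using M Uu by (simp add: field_simps)
  have N': "N = k + deriv (deriv X) ?x / deriv X ?x * pb p
      + pa p * ((2 * deriv (deriv (deriv X)) ?x - partial_x \<sigma> ?q) / deriv X ?x)"
  proof -
    have "N * deriv X ?x = deriv (deriv X) ?x * pb p + deriv X ?x * k - pa p * partial_x \<sigma> ?q
        + 2 * pa p * deriv (deriv (deriv X)) ?x"
      unfolding N using A2 B1 by (simp add: algebra_simps)
    then have "N = (deriv (deriv X) ?x * pb p + deriv X ?x * k - pa p * partial_x \<sigma> ?q
        + 2 * pa p * deriv (deriv (deriv X)) ?x) / deriv X ?x"
      using X' by (simp add: eq_divide_eq)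
    then show ?thesis using X' by (simp add: add_divide_distrib diff_divide_distrib algebra_simps)
  qed
  have "partial_t U ?q + partial_u U ?q * (k * pu p) = N * U ?q + M * partial_x U ?q + pa p * P0 ?q"
  proof -
    have "partial_t U ?q + partial_u U ?q * (k * pu p)
      = (partial_t U ?q + partial_u U ?q * put p) - partial_u U ?q * (pa p * puxx p + pb p * pux p)"
      using k by (simp add: algebra_simps)
    also have "\<dots> = N * U ?q + M * partial_x U ?q + (M * partial_u U ?q) * pux p
       + pa p * (P0 ?q + P1 ?q * pux p + partial_u U ?q * puxx p) - partial_u U ?q * (pa p * puxx p + pb p * pux p)"
      unfolding E by (simp add: algebra_simps)
    also have "\<dots> = N * U ?q + M * partial_x U ?q + pa p * P0 ?q"
      unfolding M by (simp add: algebra_simps)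
    finally show ?thesis .
  qed
  then have "k * (partial_u U ?q * pu p - U ?q) + partial_t U ?q
     - pb p * (partial_x U ?q + deriv (deriv X) ?x / deriv X ?x * U ?q) - pa p * L ?q = 0"
    unfolding N' M' L_def by (simp add: algebra_simps)
  then show "(put p - pa p * puxx p - pb p * pux p) * ((partial_u U ?q * pu p - U ?q) / pu p)
     + partial_t U ?q - pb p * (partial_x U ?q + deriv (deriv X) ?x / deriv X ?x * U ?q) - pa p * L ?q = 0"
    by (simp add: k_def)
qed
text \<open>The determining equation is affine in u_t, then in b, then in a, with coefficients that
  depend on the base point only.\<close>

lemma U_equations_nonzero_u:
  assumes q: "q \<in> W" and u: "snd (snd q) \<noteq> 0"
  shows "P2 q = 0" "partial_t U q = 0" "partial_u U q * snd (snd q) - U q = 0"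
    "partial_x U q * deriv X (fst (snd q)) + deriv (deriv X) (fst (snd q)) * U q = 0"
proof -
  obtain p where p: "p \<in> \<Omega>" "fst (fst p) = q" using q by (rule W_E)
  define K where "K = (partial_u U q * pu p - U q) / pu p"
  define Z where "Z = partial_x U q + deriv (deriv X) (px p) / deriv X (px p) * U q"
  have E: "(put r - pa r * puxx r - pb r * pux r) * K + partial_t U q - pb r * Z - pa r * L q = 0"
    if "r \<in> \<Omega>" "fst (fst r) = q" for r
    using determining_equation(2)[OF that(1)] u p(2) that(2) by (simp add: K_def Z_def)
  show "P2 q = 0" using determining_equation(1)[OF p(1)] u p(2) by simp
  have K: "K = 0"
  proof -
    define v :: ext where "v = ((0, (1, 0), 0), 0)"
    obtain \<epsilon> where \<epsilon>: "\<epsilon> > 0" "\<And>s. \<bar>s\<bar> < \<epsilon> \<Longrightarrow> p + s *\<^sub>R v \<in> \<Omega>"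
      using open_line[OF open_\<Omega> p(1)] by blast
    have "(put p + \<epsilon> / 2 - pa p * puxx p - pb p * pux p) * K + partial_t U q - pb p * Z - pa p * L q = 0"
      using E[OF \<epsilon>(2)[of "\<epsilon> / 2"]] \<epsilon>(1) p(2) by (simp add: v_def)
    with E[OF p] have "\<epsilon> / 2 * K = 0" by (simp only: algebra_simps)
    with \<epsilon>(1) show ?thesis by simp
  qed
  have Z: "Z = 0"
  proof -
    define v :: ext where "v = (0, (0, 1))"
    obtain \<epsilon> where \<epsilon>: "\<epsilon> > 0" "\<And>s. \<bar>s\<bar> < \<epsilon> \<Longrightarrow> p + s *\<^sub>R v \<in> \<Omega>"
      using open_line[OF open_\<Omega> p(1)] by blast
    have "partial_t U q - (pb p + \<epsilon> / 2) * Z - pa p * L q = 0"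
      using E[OF \<epsilon>(2)[of "\<epsilon> / 2"]] \<epsilon>(1) p(2) K by (simp add: v_def)
    with E[OF p] have "\<epsilon> / 2 * Z = 0" unfolding K by (simp only: algebra_simps)
    with \<epsilon>(1) show ?thesis by simp
  qed
  have L: "L q = 0"
  proof -
    define v :: ext where "v = (0, (1, 0))"
    obtain \<epsilon> where \<epsilon>: "\<epsilon> > 0" "\<And>s. \<bar>s\<bar> < \<epsilon> \<Longrightarrow> p + s *\<^sub>R v \<in> \<Omega>"
      using open_line[OF open_\<Omega> p(1)] by blast
    have "partial_t U q - (pa p + \<epsilon> / 2) * L q = 0"
      using E[OF \<epsilon>(2)[of "\<epsilon> / 2"]] \<epsilon>(1) p(2) K Z by (simp add: v_def)
    with E[OF p] have "\<epsilon> / 2 * L q = 0" unfolding K Z by (simp add: algebra_simps)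
    with \<epsilon>(1) show ?thesis by simp
  qed
  show "partial_t U q = 0" using E[OF p] K Z L by simp
  show "partial_u U q * snd (snd q) - U q = 0" using K u p(2) by (simp add: K_def)
  show "partial_x U q * deriv X (fst (snd q)) + deriv (deriv X) (fst (snd q)) * U q = 0"
    using Z deriv_X_nonzero[OF coordinates_in_J(2)[OF p(1)]] p(2) by (simp add: Z_def field_simps)
qed

lemma zero_on_W:
  assumes "smooth_on W f" "\<And>q. q \<in> W \<Longrightarrow> snd (snd q) \<noteq> 0 \<Longrightarrow> f q = (0::real)" "q \<in> W"
  shows "f q = 0"
  by (rule zero_if_zero_off_hyperplane[OF open_W smooth_on_continuous[OF assms(1)] bounded_linear_base(3) _ assms(2,3),
        where e = "(0, 0, 1)"]) simp_all

lemma U_equations: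
  assumes q: "q \<in> W"
  shows "P2 q = 0" "partial_t U q = 0" "U q = partial_u U q * snd (snd q)"
    "partial_x U q * deriv X (fst (snd q)) + deriv (deriv X) (fst (snd q)) * U q = 0"
proof -
  note sm = smooth_on_partial[OF smooth_base(3)] smooth_on_partial(3)[OF smooth_on_partial(3)[OF smooth_base(3)]]
  have smu: "smooth_on W (\<lambda>q. snd (snd q))" by (rule smooth_on_linear[OF bounded_linear_base(3) open_W])
  show "P2 q = 0"
    by (rule zero_on_W[OF _ U_equations_nonzero_u(1) q]) (simp_all add: P2_def sm)
  show "partial_t U q = 0"
    by (rule zero_on_W[OF sm(1) U_equations_nonzero_u(2) q])
  have "partial_u U q * snd (snd q) - U q = 0"
    by (rule zero_on_W[OF _ U_equations_nonzero_u(3) q]) (intro smooth_on_intros sm smu smooth_base open_W)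
  then show "U q = partial_u U q * snd (snd q)" by simp
  show "partial_x U q * deriv X (fst (snd q)) + deriv (deriv X) (fst (snd q)) * U q = 0"
    by (rule zero_on_W[OF _ U_equations_nonzero_u(4) q])
      (intro smooth_on_intros sm smooth_of_x smooth_X smooth_base open_W)
qed

text \<open>The equations give H = X' U the differential X' U_u du, so H = h(u) on the convex base.
  Then h' = X' U_u and h'' = X' U_uu = 0, so h' is a constant c3, and U = u U_u rules out an
  additive constant.\<close>

lemma U_form: "\<exists>c3. \<forall>q\<in>W. U q = c3 * recip_deriv X (fst (snd q)) * snd (snd q) \<and>
  partial_u U q = c3 * recip_deriv X (fst (snd q))"
proof -
  define H where "H = (\<lambda>q. deriv X (fst (snd q)) * U q)"
  have smH: "smooth_on W H"
    unfolding H_def by (intro smooth_on_intros smooth_of_x smooth_X smooth_base open_W)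
  have der: "((\<lambda>q. f (fst (snd q)) * g q) has_derivative
      (\<lambda>v. f (fst (snd q)) * frechet_derivative g (at q) v + deriv f (fst (snd q)) * fst (snd v) * g q)) (at q)"
    if "smooth_on JX f" "smooth_on W g" "q \<in> W" for f :: "real \<Rightarrow> real" and g q
    by (intro has_derivative_mult smooth_on_has_derivative[OF that(2,3)] smooth_on_deriv_has_derivative[OF that(1)])
      (use that(3) in \<open>auto simp: JX_def intro!: derivative_intros\<close>)
  have DH: "frechet_derivative H (at q) v = deriv X (fst (snd q)) * partial_u U q * snd (snd v)" if q: "q \<in> W" for q v
  proof -
    have "frechet_derivative H (at q) v = deriv X (fst (snd q)) * frechet_derivative U (at q) v
        + deriv (deriv X) (fst (snd q)) * fst (snd v) * U q"
      unfolding H_def using fun_cong[OF frechet_derivative_at[OF der[OF smooth_X(2) smooth_base(3) q]], of v] by simp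
    also have "\<dots> = deriv X (fst (snd q)) * partial_u U q * snd (snd v)
        + (partial_x U q * deriv X (fst (snd q)) + deriv (deriv X) (fst (snd q)) * U q) * fst (snd v)"
      unfolding frechet_derivative_partial[OF smooth_base(3) q] U_equations(2)[OF q] by (simp add: algebra_simps)
    finally show ?thesis using U_equations(4)[OF q] by simp
  qed
  obtain h where h: "smooth_on JU h" "\<And>q. q \<in> W \<Longrightarrow> H q = h (snd (snd q))"
    "\<And>q. q \<in> W \<Longrightarrow> frechet_derivative H (at q) (0, 0, 1) = deriv h (snd (snd q))"
    unfolding JU_def
  proof (rule function_of_coordinate[OF open_W convex_W smH bounded_linear_base(3), of "(0, 0, 1)"])
    show "frechet_derivative H (at q) v = 0" if "q \<in> W" "snd (snd v) = 0" for q v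
      using DH[OF that(1), of v] that(2) by simp
  qed (simp, rule that[unfolded JU_def])
  have h1: "deriv h (snd (snd q)) = deriv X (fst (snd q)) * partial_u U q" if "q \<in> W" for q
    using h(3)[OF that] DH[OF that] by simp
  have h2: "deriv (deriv h) u = 0" if "u \<in> JU" for u
  proof -
    obtain q where q: "q \<in> W" "u = snd (snd q)" using \<open>u \<in> JU\<close> by (auto simp: JU_def)
    have "((\<lambda>q. deriv h (snd (snd q))) has_derivative (\<lambda>v. deriv (deriv h) u * snd (snd v))) (at q)"
      unfolding q(2)
      by (rule smooth_on_deriv_has_derivative[OF smooth_on_deriv[OF h(1) open_J(3)]])
        (use q in \<open>auto simp: JU_def intro!: derivative_intros\<close>)
    then have "((\<lambda>q. deriv X (fst (snd q)) * partial_u U q) has_derivative (\<lambda>v. deriv (deriv h) u * snd (snd v))) (at q)"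
      by (rule has_derivative_transform_within_open[OF _ open_W q(1)]) (rule h1)
    from fun_cong[OF has_derivative_unique[OF this der[OF smooth_X(2) smooth_on_partial(3)[OF smooth_base(3)] q(1)]], of "(0, 0, 1)"]
    have "deriv (deriv h) u = deriv X (fst (snd q)) * P2 q" by (simp add: P2_def partial_u_def)
    then show ?thesis using U_equations(1)[OF q(1)] by simp
  qed
  obtain c3 where c3: "\<And>u. u \<in> JU \<Longrightarrow> deriv h u = c3"
    by (rule affine_if_deriv2_zero[OF h(1) open_J(3) convex_J(3) h2], assumption) blast
  show ?thesis
  proof (intro exI ballI)
    fix q assume q: "q \<in> W"
    have "deriv X (fst (snd q)) * partial_u U q = c3" using h1[OF q] c3[of "snd (snd q)"] q by (simp add: JU_def)
    moreover have "deriv X (fst (snd q)) \<noteq> 0" using deriv_X_nonzero q by (auto simp: JX_def)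
    ultimately have "partial_u U q = c3 * recip_deriv X (fst (snd q))" by (simp add: recip_deriv_def field_simps)
    with U_equations(3)[OF q]
    show "U q = c3 * recip_deriv X (fst (snd q)) * snd (snd q) \<and> partial_u U q = c3 * recip_deriv X (fst (snd q))"
      by simp
  qed
qed

end

section \<open>Assembly of all ten components\<close>

context convex_equivalence
begin

lemma partial_product_with_u:
  assumes f: "smooth_on JX f" and F: "\<And>q. q \<in> W \<Longrightarrow> F q = f (fst (snd q)) * snd (snd q)" and q: "q \<in> W"
  shows "partial_x F q = deriv f (fst (snd q)) * snd (snd q)" "partial_u F q = f (fst (snd q))"
proof -
  have "((\<lambda>q. f (fst (snd q)) * snd (snd q)) has_derivative
      (\<lambda>v. f (fst (snd q)) * snd (snd v) + deriv f (fst (snd q)) * fst (snd v) * snd (snd q))) (at q)"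
    by (intro has_derivative_mult smooth_on_deriv_has_derivative[OF f] derivative_intros)
      (use q in \<open>auto simp: JX_def\<close>)
  then have "(F has_derivative
      (\<lambda>v. f (fst (snd q)) * snd (snd v) + deriv f (fst (snd q)) * fst (snd v) * snd (snd q))) (at q)"
    by (rule has_derivative_transform_within_open[OF _ open_W q]) (simp add: F)
  from fun_cong[OF frechet_derivative_at[OF this]]
  show "partial_x F q = deriv f (fst (snd q)) * snd (snd q)" "partial_u F q = f (fst (snd q))"
    unfolding partial_x_def partial_u_def by (metis add_0 fst_conv mult.right_neutral mult_zero_right snd_conv,
      metis add.right_neutral fst_conv mult.right_neutral mult_zero_right mult_zero_left snd_conv)
qed

lemma partial_x_of_x:
  assumes f: "smooth_on JX f" and F: "\<And>q. q \<in> W \<Longrightarrow> F q = f (fst (snd q))" and q: "q \<in> W"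
  shows "partial_x F q = deriv f (fst (snd q))"
proof -
  have "((\<lambda>q. f (fst (snd q))) has_derivative (\<lambda>v. deriv f (fst (snd q)) * fst (snd v))) (at q)"
    by (rule smooth_on_deriv_has_derivative[OF f]) (use q in \<open>auto simp: JX_def intro!: derivative_intros\<close>)
  then have "(F has_derivative (\<lambda>v. deriv f (fst (snd q)) * fst (snd v))) (at q)"
    by (rule has_derivative_transform_within_open[OF _ open_W q]) (simp add: F)
  from fun_cong[OF frechet_derivative_at[OF this], of "(0, 1, 0)"] show ?thesis
    by (simp add: partial_x_def)
qed

text \<open>With U known, the prolongation identities give the new u_t, u_x and u_xx. The new u_t is
  then differentiated along the lifts of D_t and D_x, and contact yields u_tt and u_tx. The formulas
  for A and B hold for nonzero u and extend to u = 0 because both sides are continuous.\<close>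

lemma fp_form: "has_fp_form \<Omega> \<Phi>"
proof (cases "\<Omega> = {}")
  case True
  \<comment> \<open>No point is available to show that the constants are nonzero, so ones and the
    identity are supplied.\<close>
  then show ?thesis
    by (auto simp: has_fp_form_def intro!: exI[of _ "1::real"] exI[of _ "\<lambda>x::real. x"] smooth_on_ident)
next
  case False
  then obtain p0 where p0: "p0 \<in> \<Omega>" by blast
  have c1: "c1 \<noteq> 0" using \<tau>_affine(3) coordinates_in_J(1)[OF p0] by blast
  obtain c3 where U0: "\<And>q. q \<in> W \<Longrightarrow> U q = c3 * recip_deriv X (fst (snd q)) * snd (snd q)"
    "\<And>q. q \<in> W \<Longrightarrow> partial_u U q = c3 * recip_deriv X (fst (snd q))"
    using U_form by blast
  have c3: "c3 \<noteq> 0" using partials_nonzero(2)[OF W_I[OF p0]] U0(2)[OF W_I[OF p0]] by auto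
  define m where "m = recip_deriv X"
  have sm: "smooth_on JX m"
    unfolding m_def by (rule smooth_on_recip_deriv[OF X(1) open_J(2) deriv_X_nonzero])
  note sm1 = smooth_on_deriv[OF sm open_J(2)]
  have m: "m x \<noteq> 0" "deriv X x = 1 / m x" "deriv (deriv X) x = - deriv m x / (m x)\<^sup>2" if "x \<in> JX" for x
    using deriv_X_nonzero[OF that] deriv_recip_deriv[OF X(1) open_J(2) deriv_X_nonzero[OF that] that]
    by (simp_all add: m_def recip_deriv_def power_divide)
  have WJ: "fst (snd q) \<in> JX" if "q \<in> W" for q using that by (auto simp: JX_def)
  note U = U0[folded m_def]
  have smc: "smooth_on JX (\<lambda>x. c3 * m x)" "smooth_on JX (\<lambda>x. c3 * deriv m x)"
    by (intro smooth_on_intros sm sm1 open_J)+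
  have dc: "deriv (\<lambda>x. c3 * m x) x = c3 * deriv m x" "deriv (\<lambda>x. c3 * deriv m x) x = c3 * deriv (deriv m) x"
    if "x \<in> JX" for x
    by (rule DERIV_imp_deriv, auto intro!: derivative_eq_intros smooth_on_DERIV[OF sm that] smooth_on_DERIV[OF sm1 that])+
  have Ux: "partial_x U q = c3 * deriv m (fst (snd q)) * snd (snd q)" if "q \<in> W" for q
    using partial_product_with_u(1)[OF smc(1) U(1) that] dc(1)[OF WJ[OF that]] by simp
  have P0: "P0 q = c3 * deriv (deriv m) (fst (snd q)) * snd (snd q)" if "q \<in> W" for q
    using partial_product_with_u(1)[OF smc(2) Ux that] dc(2)[OF WJ[OF that]] by (simp add: P0_def)
  have P1: "P1 q = 2 * c3 * deriv m (fst (snd q))" if "q \<in> W" for q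
    using partial_product_with_u(2)[OF smc(2) Ux that] partial_x_of_x[OF smc(1) U(2) that] dc(1)[OF WJ[OF that]]
    by (simp add: P1_def)
  have ut: "put (\<Phi> p) = (c3 / c1) * m (px p) * put p" if p: "p \<in> \<Omega>" for p
    using \<Phi>_ut[OF p] \<tau>_affine(1)[OF coordinates_in_J(1)[OF p]] U(2)[OF W_I[OF p]] U_equations(2)[OF W_I[OF p]] c1
    by (simp add: field_simps)
  have ux: "pux (\<Phi> p) = c3 * m (px p) * (deriv m (px p) * pu p + m (px p) * pux p)" if p: "p \<in> \<Omega>" for p
    using \<Phi>_ux[OF p] m[OF coordinates_in_J(2)[OF p]] U(2)[OF W_I[OF p]] Ux[OF W_I[OF p]]
    by (simp add: field_simps)
  have uxx: "puxx (\<Phi> p) = c3 * m (px p) * (((deriv m (px p))\<^sup>2 + m (px p) * deriv (deriv m) (px p)) * pu p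
      + 3 * m (px p) * deriv m (px p) * pux p + (m (px p))\<^sup>2 * puxx p)" if p: "p \<in> \<Omega>" for p
  proof -
    let ?x = "px p"
    note mx = m[OF coordinates_in_J(2)[OF p]]
    have "puxx (\<Phi> p) / (m ?x)\<^sup>2 = c3 * deriv (deriv m) ?x * pu p + 2 * c3 * deriv m ?x * pux p + c3 * m ?x * puxx p
        + pux (\<Phi> p) * deriv m ?x / (m ?x)\<^sup>2"
      using \<Phi>_uxx[OF p] mx P0[OF W_I[OF p]] P1[OF W_I[OF p]] U_equations(1)[OF W_I[OF p]] U(2)[OF W_I[OF p]]
      by (simp add: power_divide)
    then have "puxx (\<Phi> p) = (c3 * deriv (deriv m) ?x * pu p + 2 * c3 * deriv m ?x * pux p + c3 * m ?x * puxx p) * (m ?x)\<^sup>2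
        + pux (\<Phi> p) * deriv m ?x"
      using mx(1) by (simp add: field_simps)
    then show ?thesis unfolding ux[OF p] by (simp add: algebra_simps power2_eq_square)
  qed
  have D_ut: "put (D p v) = (c3 / c1) * (m (px p) * put v + deriv m (px p) * px v * put p)" if p: "p \<in> \<Omega>" for p v
  proof -
    have "((\<lambda>p. (c3 / c1) * (m (px p) * put p)) has_derivative
      (\<lambda>v. (c3 / c1) * (m (px p) * put v + deriv m (px p) * px v * put p))) (at p)"
      by (intro has_derivative_mult_right has_derivative_mult ext_fun_has_derivative[OF sm] coordinates_in_J p
          bounded_linear_imp_has_derivative bounded_linear_coordinates)
    from derivative_component[OF D_derivative[OF p] bounded_linear_coordinates(4) open_\<Omega> p _ this] ut
    show ?thesis by simp
  qed
  have utt: "putt (\<Phi> p) = c3 * m (px p) * putt p / c1\<^sup>2" if p: "p \<in> \<Omega>" for p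
    using contact(2)[OF p, of "(((1, 0, put p), (putt p, putx p), 0), 0)"] \<tau>_affine(1)[OF coordinates_in_J(1)[OF p]] c1
    by (simp add: D_ut[OF p] D_t[OF p] D_x_deriv[OF p] field_simps power2_eq_square)
  have utx: "putx (\<Phi> p) = c3 * m (px p) * (deriv m (px p) * put p + m (px p) * putx p) / c1" if p: "p \<in> \<Omega>" for p
    using contact(2)[OF p, of "(((0, 1, pux p), (putx p, puxx p), 0), 0)"] m[OF coordinates_in_J(2)[OF p]] c1
    by (simp add: D_ut[OF p] D_t[OF p] D_x_deriv[OF p] field_simps)
  let ?E = "fp_explicit c1 c2 c3 X"
  have smE: "smooth_on \<Omega> ?E"
    by (rule smooth_on_fp_explicit[OF X(1) open_J(2) deriv_X_nonzero c1 open_\<Omega>])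
      (simp_all add: ext_x_eq image_subset_iff)
  have ab: "pa (\<Phi> p) - pa (?E p) = 0 \<and> pb (\<Phi> p) - pb (?E p) = 0" if p: "p \<in> \<Omega>" "pu p \<noteq> 0" for p
  proof
    note mx = m[OF coordinates_in_J(2)[OF p(1)]]
    show "pa (\<Phi> p) - pa (?E p) = 0"
      using \<Phi>_a_nonzero_u[OF p] mx by (simp add: fp_explicit_components m_def[symmetric] power_divide)
    \<comment> \<open>For the U found, P1 / U_u = 2 m' / m, so \<sigma> reduces to X'', written here
      through m.\<close>
    have "\<sigma> (fst (fst p)) = - deriv m (px p) / (m (px p))\<^sup>2"
      using mx c3 by (simp add: \<sigma>_def P1[OF W_I[OF p(1)]] U(2)[OF W_I[OF p(1)]] field_simps power2_eq_square)
    then have "c1 * pb (\<Phi> p) = pb p / m (px p) + pa p * deriv m (px p) / (m (px p))\<^sup>2"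
      using \<Phi>_b_nonzero_u[OF p] mx by simp
    then have "pb (\<Phi> p) = (pb p / m (px p) + pa p * deriv m (px p) / (m (px p))\<^sup>2) / c1"
      using c1 by (simp add: eq_divide_eq mult.commute)
    then show "pb (\<Phi> p) - pb (?E p) = 0"
      by (simp add: fp_explicit_components m_def[symmetric] add_divide_distrib mult.commute)
  qed
  have "pa (\<Phi> p) - pa (?E p) = 0" if p: "p \<in> \<Omega>" for p
    by (rule zero_if_zero_off_hyperplane[OF open_\<Omega> _ bounded_linear_coordinates(3) _ _ p, where e = "(((0, 0, 1), 0), 0)"])
      (use ab in \<open>auto intro!: continuous_intros smooth_on_continuous[OF smooth] smooth_on_continuous[OF smE]\<close>)
  moreover have "pb (\<Phi> p) - pb (?E p) = 0" if p: "p \<in> \<Omega>" for p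
    by (rule zero_if_zero_off_hyperplane[OF open_\<Omega> _ bounded_linear_coordinates(3) _ _ p, where e = "(((0, 0, 1), 0), 0)"])
      (use ab in \<open>auto intro!: continuous_intros smooth_on_continuous[OF smooth] smooth_on_continuous[OF smE]\<close>)
  ultimately have "\<Phi> p = ?E p" if p: "p \<in> \<Omega>" for p
    by (intro ext_eqI; unfold fp_explicit_components m_def[symmetric])
      (use p \<tau>_affine(2)[OF coordinates_in_J(1)[OF p]] ut[OF p] ux[OF p] uxx[OF p] utt[OF p] utx[OF p] U(1)[OF W_I[OF p]] in
        \<open>simp_all add: \<Phi>_t \<Phi>_x base_components(3) fp_explicit_components m_def\<close>)
  then have "\<Phi> p = fp_transformation c1 c2 c3 X p" if "p \<in> \<Omega>" for p
    using fp_transformation_explicit[OF X(1) open_J(2) deriv_X_nonzero _ c1, of p] that by (simp add: ext_x_eq)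
  moreover have "ext_x ` \<Omega> = JX" by (auto simp: JX_def W_def ext_x_eq image_image)
  ultimately show ?thesis
    unfolding has_fp_form_def using c1 c3 X(1) deriv_X_nonzero
    by (intro exI[of _ c1] exI[of _ c2] exI[of _ c3] exI[of _ X] conjI ballI) simp_all
qed

end

section \<open>From convex bases to arbitrary open sets\<close>

lemma equivalence_imp_fp_form:
  assumes "open \<Omega>" "convex (ext_base ` \<Omega>)" "equivalence_transformation \<Omega> \<Phi>"
  shows "has_fp_form \<Omega> \<Phi>"
proof -
  interpret convex_equivalence \<Omega> \<Phi> by unfold_locales fact+
  show ?thesis by (rule fp_form)
qed

lemma has_fp_form_subset:
  assumes "has_fp_form V \<Phi>" "S \<subseteq> V"
  shows "has_fp_form S \<Phi>"
proof -
  obtain c1 c2 c3 X where *: "c1 * c3 \<noteq> 0" "smooth_on (ext_x ` V) X" "\<forall>x \<in> ext_x ` V. deriv X x \<noteq> 0"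
    "\<forall>p\<in>V. \<Phi> p = fp_transformation c1 c2 c3 X p"
    using assms(1) unfolding has_fp_form_def by (elim exE conjE)
  have sub: "ext_x ` S \<subseteq> ext_x ` V" using assms(2) by (rule image_mono)
  show ?thesis
    unfolding has_fp_form_def
  proof (intro exI conjI)
    show "c1 * c3 \<noteq> 0" by fact
    show "smooth_on (ext_x ` S) X" by (rule smooth_on_subset[OF *(2) sub])
    show "\<forall>x\<in>ext_x ` S. deriv X x \<noteq> 0" using *(3) sub by (meson subsetD)
    show "\<forall>p\<in>S. \<Phi> p = fp_transformation c1 c2 c3 X p" using *(4) assms(2) by (meson subsetD)
  qed
qed

text \<open>The image of \<open>S\<close> is open by invariance of domain; the remaining conditions
  restrict, with the same inverse and the same new coefficients.\<close>

lemma equivalence_transformation_subset: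
  assumes "equivalence_transformation V \<Phi>" "S \<subseteq> V" "open S"
  shows "equivalence_transformation S \<Phi>"
proof -
  have V: "V \<subseteq> ext_space" "\<Phi> ` V \<subseteq> ext_space" "diffeomorphism_on V \<Phi>" "projectable V \<Phi>"
    "preserves_contact V \<Phi>" "maps_class V \<Phi>"
    using assms(1) by (simp_all add: equivalence_transformation_def)
  obtain g where g: "smooth_on (\<Phi> ` V) g" "\<And>p. p \<in> V \<Longrightarrow> g (\<Phi> p) = p" and sm: "smooth_on V \<Phi>"
    using V(3) unfolding diffeomorphism_on_def by blast
  have smS: "smooth_on S \<Phi>" by (rule smooth_on_subset[OF sm assms(2)])
  have "open (\<Phi> ` S)"
    by (rule invariance_of_domain[OF smooth_on_continuous[OF smS] assms(3)]) (metis assms(2) g(2) inj_onI subsetD)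
  then have "diffeomorphism_on S \<Phi>"
    unfolding diffeomorphism_on_def using assms(2,3) smS g smooth_on_subset[OF g(1) image_mono[OF assms(2)]] by blast
  moreover have "maps_class S \<Phi>"
    unfolding maps_class_def
  proof (intro allI impI)
    fix I A B assume ae: "arbitrary_elements I A B"
    obtain I' A' B' where "arbitrary_elements I' A' B'" and
      *: "\<forall>z z' a' b'. jet_x z \<in> I \<and> (z, A (jet_x z), B (jet_x z)) \<in> V \<and>
              \<Phi> (z, A (jet_x z), B (jet_x z)) = (z', a', b') \<longrightarrow>
                jet_x z' \<in> I' \<and> a' = A' (jet_x z') \<and> b' = B' (jet_x z') \<and>
                (z \<in> fokker_planck I A B \<longleftrightarrow> z' \<in> fokker_planck I' A' B')"
      using V(6)[unfolded maps_class_def, THEN spec, THEN spec, THEN spec, THEN mp, OF ae] by (elim exE conjE)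
    show "\<exists>I' A' B'. arbitrary_elements I' A' B' \<and>
           (\<forall>z z' a' b'. jet_x z \<in> I \<and> (z, A (jet_x z), B (jet_x z)) \<in> S \<and>
              \<Phi> (z, A (jet_x z), B (jet_x z)) = (z', a', b') \<longrightarrow>
                jet_x z' \<in> I' \<and> a' = A' (jet_x z') \<and> b' = B' (jet_x z') \<and>
                (z \<in> fokker_planck I A B \<longleftrightarrow> z' \<in> fokker_planck I' A' B'))"
      by (intro exI conjI allI impI, fact, (use * assms(2) in fast)+)
  qed
  moreover have "projectable S \<Phi>" using V(4) assms(2) unfolding projectable_def by (meson subsetD)
  moreover have "preserves_contact S \<Phi>" using V(5) assms(2) unfolding preserves_contact_def by blast
  moreover have "S \<subseteq> ext_space" "\<Phi> ` S \<subseteq> ext_space" using V(1,2) assms(2) by blast+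
  ultimately show ?thesis by (simp add: equivalence_transformation_def)
qed

lemma convex_ext_base_ball: "convex (ext_base ` ball p r)"
proof -
  have "bounded_linear (\<lambda>p::ext. fst (fst p))" by (intro bounded_linear_intros)
  then have "convex ((\<lambda>p::ext. fst (fst p)) ` ball p r)"
    by (intro convex_linear_image bounded_linear.linear) auto
  then show ?thesis by (simp add: ext_base_eq)
qed

text \<open>The neighbourhoods are shrunk to balls, whose projection to (t, x, u) is convex, so that
  the convex case applies to each of them.\<close>

lemma locally_near_points_mono:
  assumes "locally_near_points P \<Omega> \<Phi>"
    "\<And>V p r. P V \<Phi> \<Longrightarrow> V \<subseteq> \<Omega> \<Longrightarrow> ball p r \<subseteq> V \<Longrightarrow> Q (ball p r) \<Phi>"
  shows "locally_near_points Q \<Omega> \<Phi>"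
  unfolding locally_near_points_def
proof
  fix p assume "p \<in> \<Omega>"
  then obtain V where V: "open V" "p \<in> V" "V \<subseteq> \<Omega>" "P V \<Phi>"
    using assms(1) unfolding locally_near_points_def by blast
  obtain r where "r > 0" "ball p r \<subseteq> V" using V open_contains_ball by blast
  then show "\<exists>V. open V \<and> p \<in> V \<and> V \<subseteq> \<Omega> \<and> Q V \<Phi>"
    using assms(2)[OF V(4,3)] V(3) by (intro exI[of _ "ball p r"]) auto
qed

text \<open>Belonging to the pseudogroup is a condition near each point, so there c1, c2, c3 and X
  may change from point to point; over a convex base one choice serves all of \<Omega>.\<close>

theorem proposition34:
  fixes \<Omega> :: "ext set" and \<Phi> :: "ext \<Rightarrow> ext"
  assumes "open \<Omega>" and "\<Omega> \<subseteq> ext_space"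
  shows "((\<Omega>, \<Phi>) \<in> equivalence_pseudogroup \<longleftrightarrow> locally_near_points has_fp_form \<Omega> \<Phi>) \<and>
         (convex (ext_base ` \<Omega>) \<longrightarrow> (equivalence_transformation \<Omega> \<Phi> \<longleftrightarrow> has_fp_form \<Omega> \<Phi>))"
proof (intro conjI impI iffI)
  assume "(\<Omega>, \<Phi>) \<in> equivalence_pseudogroup"
  then have "locally_near_points equivalence_transformation \<Omega> \<Phi>"
    by (simp add: equivalence_pseudogroup_def)
  then show "locally_near_points has_fp_form \<Omega> \<Phi>"
    by (rule locally_near_points_mono)
      (blast intro: equivalence_imp_fp_form equivalence_transformation_subset convex_ext_base_ball)
next
  assume "locally_near_points has_fp_form \<Omega> \<Phi>"
  then have "locally_near_points equivalence_transformation \<Omega> \<Phi>"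
    using assms(2)
    by (elim locally_near_points_mono)
      (blast intro: fp_form_imp_equivalence has_fp_form_subset convex_ext_base_ball)
  then show "(\<Omega>, \<Phi>) \<in> equivalence_pseudogroup"
    by (simp add: equivalence_pseudogroup_def)
next
  assume "convex (ext_base ` \<Omega>)" "equivalence_transformation \<Omega> \<Phi>"
  then show "has_fp_form \<Omega> \<Phi>" using assms(1) by (intro equivalence_imp_fp_form)
next
  assume "convex (ext_base ` \<Omega>)" "has_fp_form \<Omega> \<Phi>"
  then show "equivalence_transformation \<Omega> \<Phi>" using assms by (intro fp_form_imp_equivalence)
qed

end
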